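(* Let $r\ge 0$ be an integer, let $\mathcal{K}$ be the Fredholm integral operator with kernel $\kappa$ satisfying the standing assumptions in the context, and let $\lambda\neq 0$ be a simple eigenvalue of $\mathcal{K}$. For all sufficiently large $n$, let $\lambda_n^C$ be the simple eigenvalue of $\mathcal{Q}_n\mathcal{K}$ approximating $\lambda$ (the unique eigenvalue of $\mathcal{Q}_n\mathcal{K}$ inside $\Gamma$), let $\psi_n^C\in\mathcal{R}(E_n)$ with $\|\psi_n^C\|_\infty=1$ be a corresponding collocation eigenfunction, $\mathcal{Q}_n\mathcal{K}\psi_n^C=\lambda_n^C\psi_n^C$, and let $\psi_n^S=\frac{1}{\lambda_n^C}\mathcal{K}\psi_n^C$ be the iterated collocation eigenfunction. Then, for sufficiently large $n$ (with $h=1/n$), $$\|\psi_n^C-E\psi_n^C\|_\infty=O(h^{2r+1}),\qquad \|\psi_n^S-E\psi_n^S\|_\infty=O(h^{2r+2}),$$ and $$|\lambda-\lambda_n^C|=O(h^{2r+2}).$$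
   Context: Kernel and operator: $\mathcal{X}=\mathcal{C}[0,1]$ with the supremum norm $\|\cdot\|_\infty$ (essential supremum norm on $\mathcal{L}^\infty[0,1]$), $\Omega=[0,1]\times[0,1]$, $\kappa:\Omega\to\mathbb{R}$, and $(\mathcal{K}x)(s)=\int_0^1\kappa(s,t)x(t)\,dt$, $s\in[0,1]$. Standing assumptions: $\kappa$ is smooth, $\kappa\in\mathcal{C}^{2r+2}(\Omega)$, and its partial derivatives $D^{(\alpha,\beta)}\kappa(s,t)=\frac{\partial^{\alpha+\beta}\kappa}{\partial s^\alpha\partial t^\beta}(s,t)$ with $0\le\alpha+\beta\le 2r+3$ exist with finite bound $C_2=\max_{0\le\alpha+\beta\le 2r+3}\sup_{0\le s,t\le1}|D^{(\alpha,\beta)}\kappa(s,t)|$. The operator $\mathcal{K}$ is compact on $\mathcal{C}[0,1]$, extends continuously to $\mathcal{L}^\infty[0,1]$ by the same formula, and $\mathcal{R}(\mathcal{K})\subset\mathcal{C}^{2r+2}[0,1]$. Projection: for $n\in\mathbb{N}$ let $h=1/n$, $t_j=j/n$, $\Delta_j=[t_{j-1},t_j]$. $\mathcal{X}_n$ is the space of $x\in\mathcal{L}^\infty[0,1]$ whose restriction to each $\Delta_j$ ($j=1,\dots,n$) is a polynomial of degree $\le 2r$ (no continuity at the $t_j$ required). Nodes: for $r\ge1$, $\tau_j^i=t_{j-1}+\frac{ih}{2r}$, $i=0,\dots,2r$; for $r=0$, the single node $\tau_j=\frac{t_{j-1}+t_j}{2}$. The interpolatory projection $\mathcal{Q}_n:\mathcal{C}[0,1]\to\mathcal{X}_n$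 sends $x$ to the function which on each $\Delta_j$ is the polynomial of degree $\le 2r$ agreeing with $x$ at the $2r+1$ nodes of $\Delta_j$; it is extended (Hahn–Banach) to a projection $\mathcal{L}^\infty[0,1]\to\mathcal{X}_n$. Spectral notions: $\Gamma$ is a fixed simple closed rectifiable positively oriented curve in the resolvent set $\rho(\mathcal{K})$ separating $\lambda$ from the rest of the spectrum of $\mathcal{K}$ (in particular from $0$), with $\lambda$ inside. $E=-\frac1{2\pi i}\int_\Gamma(\mathcal{K}-z\mathcal{I})^{-1}dz$ is the spectral projection of $\mathcal{K}$ associated with $\lambda$; when applied to elements of $\mathcal{X}_n$ it is given by the same formula for the extension of $\mathcal{K}$ to $\mathcal{L}^\infty[0,1]$. $E_n=-\frac1{2\pi i}\int_\Gamma(\mathcal{Q}_n\mathcal{K}-z\mathcal{I})^{-1}dz$ is the spectral projection of $\mathcal{Q}_n\mathcal{K}$; for $n$ large it is well defined and has the same rank as $E$. $\mathcal{R}(\cdot)$ denotes range. "Simple" means algebraic multiplicity (the rank of the spectral projection) equal to one. $O(h^p)$ means bounded in absolute value by $Ch^p$ with $C$ independent of $n$. *)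

theory Defs
  imports
    "HOL-Analysis.Analysis"
    "HOL-Complex_Analysis.Winding_Numbers"
    "HOL-Computational_Algebra.Polynomial"
    "HOL-Library.Landau_Symbols"
begin

section \<open>The complex Banach space of essentially bounded functions on the unit interval\<close>

text \<open>
  Spectral theory needs complex scalars, so all function spaces are complex, while the kernel
  stays real. Representatives are total functions on the real line; only their values almost
  everywhere on the unit interval matter.
\<close>

abbreviation unit_M :: "real measure"
  where "unit_M \<equiv> lebesgue_on {0..1}"

definition ess_bdd :: "(real \<Rightarrow> complex) \<Rightarrow> bool"
  where "ess_bdd f \<longleftrightarrow> f \<in> borel_measurable unit_M \<and> (\<exists>M. AE t in unit_M. norm (f t) \<le> M)"

definition ess_norm :: "(real \<Rightarrow> complex) \<Rightarrow> real"
  where "ess_norm f = Inf {M. 0 \<le> M \<and> (AE t in unit_M. norm (f t) \<le> M)}"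

definition linf_rel :: "(real \<Rightarrow> complex) \<Rightarrow> (real \<Rightarrow> complex) \<Rightarrow> bool"
  where "linf_rel f g \<longleftrightarrow> ess_bdd f \<and> ess_bdd g \<and> (AE t in unit_M. f t = g t)"

quotient_type linf = "real \<Rightarrow> complex" / partial: linf_rel
proof (rule part_equivpI)
  have "ess_bdd (\<lambda>t. 0)"
    by (auto simp: ess_bdd_def)
  then show "\<exists>f. linf_rel f f"
    by (auto simp: linf_rel_def)
  show "symp linf_rel"
    by (auto simp: symp_def linf_rel_def elim: eventually_mono)
  show "transp linf_rel"
    unfolding transp_def linf_rel_def by (auto elim: eventually_elim2)
qed

text \<open>The class of a function; meaningful only if the function is essentially bounded.\<close>
abbreviation to_linf :: "(real \<Rightarrow> complex) \<Rightarrow> linf"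
  where "to_linf \<equiv> abs_linf"

lemma ess_bdd_add: "ess_bdd f \<Longrightarrow> ess_bdd g \<Longrightarrow> ess_bdd (\<lambda>t. f t + g t)"
proof -
  assume f: "ess_bdd f" and g: "ess_bdd g"
  obtain M N where M: "AE t in unit_M. norm (f t) \<le> M" and N: "AE t in unit_M. norm (g t) \<le> N"
    using f g by (auto simp: ess_bdd_def)
  have "AE t in unit_M. norm (f t + g t) \<le> M + N"
    using M N by eventually_elim (rule norm_triangle_mono)
  then show ?thesis
    using f g by (auto simp: ess_bdd_def)
qed

lemma ess_bdd_cmult: "ess_bdd f \<Longrightarrow> ess_bdd (\<lambda>t. c * f t)"
proof -
  assume f: "ess_bdd f"
  obtain M where M: "AE t in unit_M. norm (f t) \<le> M"
    using f by (auto simp: ess_bdd_def)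
  have "AE t in unit_M. norm (c * f t) \<le> norm c * M"
    using M by eventually_elim (simp add: norm_mult mult_left_mono)
  then show ?thesis
    using f by (auto simp: ess_bdd_def)
qed

lemma ess_bdd_nonneg:
  assumes "ess_bdd f"
  shows "{M. 0 \<le> M \<and> (AE t in unit_M. norm (f t) \<le> M)} \<noteq> {}"
proof -
  obtain M where M: "AE t in unit_M. norm (f t) \<le> M"
    using assms by (auto simp: ess_bdd_def)
  have "AE t in unit_M. norm (f t) \<le> \<bar>M\<bar>"
    using M by eventually_elim auto
  then have "\<bar>M\<bar> \<in> {M. 0 \<le> M \<and> (AE t in unit_M. norm (f t) \<le> M)}"
    by simp
  then show ?thesis
    by blast
qed

lemma ess_norm_AE:
  assumes "ess_bdd f"
  shows "AE t in unit_M. norm (f t) \<le> ess_norm f"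
proof -
  let ?S = "{M. 0 \<le> M \<and> (AE t in unit_M. norm (f t) \<le> M)}"
  have "AE t in unit_M. norm (f t) < ess_norm f + 1 / real (Suc k)" for k
  proof -
    have "Inf ?S < ess_norm f + 1 / real (Suc k)"
      by (simp add: ess_norm_def)
    then obtain M where "M \<in> ?S" and M: "M < ess_norm f + 1 / real (Suc k)"
      using cInf_lessD[OF ess_bdd_nonneg[OF assms]] by blast
    then have "AE t in unit_M. norm (f t) \<le> M"
      by simp
    then show ?thesis
      by eventually_elim (use M in auto)
  qed
  then have "AE t in unit_M. \<forall>k. norm (f t) < ess_norm f + 1 / real (Suc k)"
    unfolding AE_all_countable by blast
  then show ?thesis
  proof eventually_elim
    case (elim t)
    show ?case
    proof (rule field_le_epsilon)
      fix e :: real assume "0 < e"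
      then obtain k where "1 / real (Suc k) < e"
        using nat_approx_posE by blast
      then show "norm (f t) \<le> ess_norm f + e"
        using elim[rule_format, of k] by linarith
    qed
  qed
qed

lemma ess_norm_le:
  assumes "0 \<le> M" "AE t in unit_M. norm (f t) \<le> M"
  shows "ess_norm f \<le> M"
  unfolding ess_norm_def using assms by (intro cInf_lower bdd_belowI[of _ 0]) auto

lemma ess_norm_nonneg: "ess_bdd f \<Longrightarrow> 0 \<le> ess_norm f"
  unfolding ess_norm_def by (rule cInf_greatest[OF ess_bdd_nonneg]) auto

lemma ess_norm_cong:
  assumes "AE t in unit_M. f t = g t"
  shows "ess_norm f = ess_norm g"
proof -
  have "(AE t in unit_M. norm (f t) \<le> M) \<longleftrightarrow> (AE t in unit_M. norm (g t) \<le> M)" for M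
  proof
    assume "AE t in unit_M. norm (f t) \<le> M"
    with assms show "AE t in unit_M. norm (g t) \<le> M" by eventually_elim auto
  next
    assume "AE t in unit_M. norm (g t) \<le> M"
    with assms show "AE t in unit_M. norm (f t) \<le> M" by eventually_elim auto
  qed
  then show ?thesis
    by (simp add: ess_norm_def)
qed

lift_definition scaleC :: "complex \<Rightarrow> linf \<Rightarrow> linf"  (infixr "*\<^sub>C" 75)
  is "\<lambda>c f t. c * f t"
  by (auto simp: linf_rel_def ess_bdd_cmult)

instantiation linf :: real_normed_vector
begin

lift_definition zero_linf :: linf is "\<lambda>t. 0"
  by (auto simp: linf_rel_def ess_bdd_def)

lift_definition plus_linf :: "linf \<Rightarrow> linf \<Rightarrow> linf" is "\<lambda>f g t. f t + g t"
  unfolding linf_rel_def by (auto intro: ess_bdd_add elim: eventually_elim2)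

definition "uminus x = (-1) *\<^sub>C x" for x :: linf

definition "x - y = x + - y" for x y :: linf

definition "c *\<^sub>R x = complex_of_real c *\<^sub>C x" for x :: linf

lift_definition norm_linf :: "linf \<Rightarrow> real" is ess_norm
  by (auto simp: linf_rel_def intro: ess_norm_cong)

definition "sgn x = inverse (norm x) *\<^sub>R x" for x :: linf

definition "dist x y = norm (x - y)" for x y :: linf

definition [code del]:
  "(uniformity :: (linf \<times> linf) filter) = (INF e\<in>{0 <..}. principal {(x, y). dist x y < e})"

definition [code del]:
  "open (U :: linf set) \<longleftrightarrow> (\<forall>x\<in>U. eventually (\<lambda>(x', y). x' = x \<longrightarrow> y \<in> U) uniformity)"

instance
proof
  fix x y z :: linf and a b :: real
  show "x + y + z = x + (y + z)"
    by transfer (auto simp: linf_rel_def ess_bdd_add algebra_simps)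
  show "x + y = y + x"
    by transfer (auto simp: linf_rel_def ess_bdd_add algebra_simps)
  show "0 + x = x"
    by transfer (auto simp: linf_rel_def)
  show "- x + x = 0"
    unfolding uminus_linf_def by transfer (auto simp: linf_rel_def ess_bdd_def)
  show "x - y = x + - y"
    by (rule minus_linf_def)
  show "a *\<^sub>R (x + y) = a *\<^sub>R x + a *\<^sub>R y"
    unfolding scaleR_linf_def
    by transfer (auto simp: linf_rel_def ess_bdd_add ess_bdd_cmult distrib_left distrib_right)
  show "(a + b) *\<^sub>R x = a *\<^sub>R x + b *\<^sub>R x"
    unfolding scaleR_linf_def
    by transfer (auto simp: linf_rel_def ess_bdd_add ess_bdd_cmult distrib_left distrib_right)
  show "a *\<^sub>R b *\<^sub>R x = (a * b) *\<^sub>R x"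
    unfolding scaleR_linf_def
    by transfer (auto simp: linf_rel_def ess_bdd_cmult mult.assoc)
  show "1 *\<^sub>R x = x"
    unfolding scaleR_linf_def by transfer (auto simp: linf_rel_def)
  show "sgn x = inverse (norm x) *\<^sub>R x"
    by (rule sgn_linf_def)
  show "dist x y = norm (x - y)"
    by (rule dist_linf_def)
  show "(uniformity :: (linf \<times> linf) filter) = (INF e\<in>{0 <..}. principal {(x, y). dist x y < e})"
    by (rule uniformity_linf_def)
  show "open U \<longleftrightarrow> (\<forall>x\<in>U. \<forall>\<^sub>F (x', y) in uniformity. x' = x \<longrightarrow> y \<in> U)" for U :: "linf set"
    by (rule open_linf_def)
  show "norm x = 0 \<longleftrightarrow> x = 0"
  proof transfer
    fix f assume "linf_rel f f"
    then have f: "ess_bdd f" by (simp add: linf_rel_def)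
    show "ess_norm f = 0 \<longleftrightarrow> linf_rel f (\<lambda>t. 0)"
    proof
      assume "ess_norm f = 0"
      then have "AE t in unit_M. f t = 0"
        using ess_norm_AE[OF f] by simp
      then show "linf_rel f (\<lambda>t. 0)"
        using f by (auto simp: linf_rel_def ess_bdd_def)
    next
      assume "linf_rel f (\<lambda>t. 0)"
      then have "AE t in unit_M. norm (f t) \<le> 0"
        by (auto simp: linf_rel_def)
      then show "ess_norm f = 0"
        using ess_norm_le[of 0 f] ess_norm_nonneg[OF f] by linarith
    qed
  qed
  show "norm (x + y) \<le> norm x + norm y"
  proof transfer
    fix f g assume "linf_rel f f" "linf_rel g g"
    then have f: "ess_bdd f" and g: "ess_bdd g" by (simp_all add: linf_rel_def)
    have "AE t in unit_M. norm (f t + g t) \<le> ess_norm f + ess_norm g"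
      using ess_norm_AE[OF f] ess_norm_AE[OF g] by eventually_elim (rule norm_triangle_mono)
    then show "ess_norm (\<lambda>t. f t + g t) \<le> ess_norm f + ess_norm g"
      using ess_norm_nonneg[OF f] ess_norm_nonneg[OF g] by (intro ess_norm_le) auto
  qed
  show "norm (a *\<^sub>R x) = \<bar>a\<bar> * norm x"
    unfolding scaleR_linf_def
  proof transfer
    fix f and a :: real assume "linf_rel f f"
    then have f: "ess_bdd f" by (simp add: linf_rel_def)
    have le: "ess_norm (\<lambda>t. c * g t) \<le> norm c * ess_norm g" if g: "ess_bdd g" for c g
    proof (rule ess_norm_le)
      show "AE t in unit_M. norm (c * g t) \<le> norm c * ess_norm g"
        using ess_norm_AE[OF g] by eventually_elim (simp add: norm_mult mult_left_mono)
    qed (use ess_norm_nonneg[OF g] in simp)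
    show "ess_norm (\<lambda>t. complex_of_real a * f t) = \<bar>a\<bar> * ess_norm f"
    proof (cases "a = 0")
      case True
      then show ?thesis
        using le[OF f, of 0] ess_norm_nonneg[OF ess_bdd_cmult[OF f, of 0]] by simp
    next
      case False
      have "ess_norm f \<le> norm (inverse (complex_of_real a)) * ess_norm (\<lambda>t. complex_of_real a * f t)"
        using le[OF ess_bdd_cmult[OF f, of "complex_of_real a"], of "inverse (complex_of_real a)"] False
        by (simp add: mult.assoc[symmetric])
      then have "ess_norm f \<le> ess_norm (\<lambda>t. complex_of_real a * f t) / \<bar>a\<bar>"
        by (simp add: norm_inverse divide_inverse mult.commute)
      then have "\<bar>a\<bar> * ess_norm f \<le> ess_norm (\<lambda>t. complex_of_real a * f t)"
        using False by (simp add: pos_le_divide_eq mult.commute)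
      then show ?thesis
        using le[OF f, of "complex_of_real a"] by simp
    qed
  qed
qed

end

lemma norm_abs_linf: "ess_bdd f \<Longrightarrow> norm (to_linf f) = ess_norm f"
  by (rule norm_linf.abs_eq) (simp add: linf_rel_def)

lemma diff_abs_linf:
  assumes "ess_bdd f" "ess_bdd g"
  shows "to_linf f - to_linf g = to_linf (\<lambda>t. f t - g t)"
proof -
  have g': "ess_bdd (\<lambda>t. (-1) * g t)"
    using assms(2) by (rule ess_bdd_cmult)
  have "to_linf f - to_linf g = to_linf f + to_linf (\<lambda>t. (-1) * g t)"
    unfolding minus_linf_def uminus_linf_def
    using assms(2) by (subst scaleC.abs_eq) (simp_all add: linf_rel_def)
  also have "\<dots> = to_linf (\<lambda>t. f t + (-1) * g t)"
    using assms(1) g' by (intro plus_linf.abs_eq) (simp_all add: linf_rel_def)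
  finally show ?thesis
    by simp
qed

lemma ess_bdd_diff: "ess_bdd f \<Longrightarrow> ess_bdd g \<Longrightarrow> ess_bdd (\<lambda>t. f t - g t)"
  using ess_bdd_add[OF _ ess_bdd_cmult[of g "-1"], of f] by simp

instance linf :: banach
proof
  fix X :: "nat \<Rightarrow> linf"
  assume "Cauchy X"
  define f where "f n = rep_linf (X n)" for n
  have rel: "linf_rel (f n) (f n)" and X: "X n = to_linf (f n)" for n
    using Quotient_rep_reflp[OF Quotient_linf] Quotient_abs_rep[OF Quotient_linf]
    by (simp_all add: f_def)
  have f: "ess_bdd (f n)" for n
    using rel by (simp add: linf_rel_def)
  have "AE t in unit_M. norm (f m t - f n t) \<le> norm (X m - X n)" for m n
    using ess_norm_AE[OF ess_bdd_diff[OF f f]]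
    by (simp add: X diff_abs_linf f norm_abs_linf ess_bdd_diff)
  then have ae: "AE t in unit_M. \<forall>m n. norm (f m t - f n t) \<le> norm (X m - X n)"
    unfolding AE_all_countable by blast
  define g where "g t = lim (\<lambda>n. f n t)" for t
  have lim: "AE t in unit_M. (\<lambda>n. f n t) \<longlonglongrightarrow> g t"
    using ae
  proof eventually_elim
    case (elim t)
    have "Cauchy (\<lambda>n. f n t)"
    proof (rule metric_CauchyI)
      fix e :: real assume "0 < e"
      then obtain N where "\<forall>m\<ge>N. \<forall>n\<ge>N. dist (X m) (X n) < e"
        using \<open>Cauchy X\<close> metric_CauchyD by blast
      then have "\<forall>m\<ge>N. \<forall>n\<ge>N. dist (f m t) (f n t) < e"
        using elim unfolding dist_norm by (meson le_less_trans)
      then show "\<exists>N. \<forall>m\<ge>N. \<forall>n\<ge>N. dist (f m t) (f n t) < e" ..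
    qed
    then show ?case
      by (simp add: g_def Cauchy_convergent convergent_LIMSEQ_iff[symmetric])
  qed
  have close: "\<exists>N. \<forall>n\<ge>N. AE t in unit_M. norm (f n t - g t) \<le> e" if "0 < e" for e
  proof -
    obtain N where N: "\<forall>m\<ge>N. \<forall>n\<ge>N. dist (X m) (X n) < e"
      using \<open>Cauchy X\<close> \<open>0 < e\<close> metric_CauchyD by blast
    have "AE t in unit_M. norm (f n t - g t) \<le> e" if "N \<le> n" for n
      using ae lim
    proof eventually_elim
      case (elim t)
      have "(\<lambda>m. norm (f n t - f m t)) \<longlonglongrightarrow> norm (f n t - g t)"
        by (intro tendsto_intros elim)
      moreover have "\<forall>m\<ge>N. norm (f n t - f m t) \<le> e"
        using elim(1) N that unfolding dist_norm by (meson le_less_trans less_imp_le)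
      ultimately show ?case
        using LIMSEQ_le_const2 by blast
    qed
    then show ?thesis by blast
  qed
  have "g \<in> borel_measurable unit_M"
    unfolding g_def using f by (intro borel_measurable_lim_metric) (auto simp: ess_bdd_def)
  moreover have "\<exists>M. AE t in unit_M. norm (g t) \<le> M"
  proof -
    obtain N where "AE t in unit_M. norm (f N t - g t) \<le> 1"
      using close[of 1] by auto
    then have "AE t in unit_M. norm (g t) \<le> ess_norm (f N) + 1"
      using ess_norm_AE[OF f[of N]]
    proof eventually_elim
      case (elim t)
      then show ?case
        using norm_triangle_ineq2[of "g t" "f N t"] by (simp add: norm_minus_commute)
    qed
    then show ?thesis ..
  qed
  ultimately have g: "ess_bdd g"
    by (simp add: ess_bdd_def)
  have "X \<longlonglongrightarrow> to_linf g"
  proof (rule metric_LIMSEQ_I)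
    fix e :: real assume "0 < e"
    then obtain N where N: "\<forall>n\<ge>N. AE t in unit_M. norm (f n t - g t) \<le> e / 2"
      using close[of "e / 2"] by auto
    have "dist (X n) (to_linf g) < e" if "N \<le> n" for n
    proof -
      have "dist (X n) (to_linf g) = ess_norm (\<lambda>t. f n t - g t)"
        by (simp add: dist_norm X diff_abs_linf f g norm_abs_linf ess_bdd_diff)
      also have "\<dots> \<le> e / 2"
        using N that \<open>0 < e\<close> by (intro ess_norm_le) auto
      finally show ?thesis
        using \<open>0 < e\<close> by simp
    qed
    then show "\<exists>N. \<forall>n\<ge>N. dist (X n) (to_linf g) < e" by blast
  qed
  then show "convergent X"
    by (rule convergentI)
qed

interpretation linf: vector_space scaleC
proof
  fix a b :: complex and x y :: linf
  show "a *\<^sub>C (x + y) = a *\<^sub>C x + a *\<^sub>C y"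
    by transfer (auto simp: linf_rel_def ess_bdd_add ess_bdd_cmult distrib_left distrib_right)
  show "(a + b) *\<^sub>C x = a *\<^sub>C x + b *\<^sub>C x"
    by transfer (auto simp: linf_rel_def ess_bdd_add ess_bdd_cmult distrib_left distrib_right)
  show "a *\<^sub>C b *\<^sub>C x = (a * b) *\<^sub>C x"
    by transfer (auto simp: linf_rel_def ess_bdd_cmult mult.assoc)
  show "1 *\<^sub>C x = x"
    by transfer (auto simp: linf_rel_def)
qed

text \<open>
  Continuous functions as an isometrically embedded subspace: a class contains at most one
  function that is continuous on the unit interval (up to values off the interval), and there
  the essential supremum norm is the supremum norm.
\<close>

definition C01 :: "linf set"
  where "C01 = to_linf ` {f. continuous_on {0..1} f}"


section \<open>Curves and line integrals\<close>

definition rectifiable :: "(real \<Rightarrow> complex) \<Rightarrow> bool"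
  where "rectifiable \<gamma> \<longleftrightarrow>
    (\<exists>L. \<forall>d. d division_of {0..1} \<longrightarrow> (\<Sum>k\<in>d. norm (\<gamma> (Sup k) - \<gamma> (Inf k))) \<le> L)"

definition pos_oriented_jordan_curve :: "(real \<Rightarrow> complex) \<Rightarrow> bool"
  where "pos_oriented_jordan_curve \<gamma> \<longleftrightarrow>
    simple_path \<gamma> \<and> pathfinish \<gamma> = pathstart \<gamma> \<and> rectifiable \<gamma> \<and>
    (\<forall>w\<in>inside (path_image \<gamma>). winding_number \<gamma> w = 1)"

text \<open>
  The library's \<open>contour_integral\<close> needs scalar integrands and is of use only for piecewise
  continuously differentiable paths. For rectifiable curves and integrands with values in the
  function space, the line integral is the limit of the Stieltjes sums over tagged divisions;
  for continuous integrands it agrees with the Riemann-Stieltjes integral.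
\<close>

definition line_integral :: "(real \<Rightarrow> complex) \<Rightarrow> (complex \<Rightarrow> linf) \<Rightarrow> linf"
  where "line_integral \<gamma> g =
    Lim (division_filter {0..1}) (\<lambda>p. \<Sum>(t, k)\<in>p. (\<gamma> (Sup k) - \<gamma> (Inf k)) *\<^sub>C g (\<gamma> t))"


section \<open>Spectral notions\<close>

text \<open>
  The set \<open>S\<close> is the (closed, complex) subspace on which the operator \<open>T\<close> is considered: \<open>C01\<close>
  for continuous functions and \<open>UNIV\<close> for all of the function space.
\<close>

definition eigenvalue :: "linf set \<Rightarrow> (linf \<Rightarrow> linf) \<Rightarrow> complex \<Rightarrow> bool"
  where "eigenvalue S T \<mu> \<longleftrightarrow> (\<exists>x\<in>S. x \<noteq> 0 \<and> T x = \<mu> *\<^sub>C x)"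

definition resolvent_set :: "linf set \<Rightarrow> (linf \<Rightarrow> linf) \<Rightarrow> complex set"
  where "resolvent_set S T =
    {z. bij_betw (\<lambda>x. T x - z *\<^sub>C x) S S \<and>
        (\<exists>M. \<forall>x\<in>S. norm x \<le> M * norm (T x - z *\<^sub>C x))}"

definition spectrum :: "linf set \<Rightarrow> (linf \<Rightarrow> linf) \<Rightarrow> complex set"
  where "spectrum S T = - resolvent_set S T"

definition resolvent :: "linf set \<Rightarrow> (linf \<Rightarrow> linf) \<Rightarrow> complex \<Rightarrow> linf \<Rightarrow> linf"
  where "resolvent S T z = inv_into S (\<lambda>x. T x - z *\<^sub>C x)"

text \<open>The operator-valued contour integral of the resolvent, evaluated at a vector \<open>x\<close>.\<close>
definition spectral_projection ::
    "linf set \<Rightarrow> (linf \<Rightarrow> linf) \<Rightarrow> (real \<Rightarrow> complex) \<Rightarrow> linf \<Rightarrow> linf"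
  where "spectral_projection S T \<gamma> x =
    (- (1 / (2 * complex_of_real pi * \<i>))) *\<^sub>C line_integral \<gamma> (\<lambda>z. resolvent S T z x)"

text \<open>
  Simplicity of the eigenvalue that \<open>\<gamma>\<close> separates from the rest of the spectrum: its algebraic
  multiplicity, the complex rank of the associated spectral projection, is one.
\<close>
definition simple_eigenvalue ::
    "linf set \<Rightarrow> (linf \<Rightarrow> linf) \<Rightarrow> (real \<Rightarrow> complex) \<Rightarrow> complex \<Rightarrow> bool"
  where "simple_eigenvalue S T \<gamma> \<mu> \<longleftrightarrow>
    eigenvalue S T \<mu> \<and> linf.dim (spectral_projection S T \<gamma> ` S) = 1"


section \<open>The integral operator\<close>

text \<open>
  \<open>D \<alpha> \<beta>\<close> is the partial derivative of order \<open>\<alpha>\<close> in \<open>s\<close> and \<open>\<beta>\<close> in \<open>t\<close>, one-sided at the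
  boundary. The first three conditions say that \<open>\<kappa>\<close> is \<open>m\<close> times continuously differentiable on
  the square; the last three that the partial derivatives of order \<open>m + 1\<close>, taken first in \<open>t\<close>
  and then in \<open>s\<close>, exist and that all derivatives are bounded.
\<close>

definition smooth_kernel :: "nat \<Rightarrow> (real \<Rightarrow> real \<Rightarrow> real) \<Rightarrow> bool"
  where "smooth_kernel m \<kappa> \<longleftrightarrow> (\<exists>D :: nat \<Rightarrow> nat \<Rightarrow> real \<Rightarrow> real \<Rightarrow> real.
    (\<forall>s\<in>{0..1}. \<forall>t\<in>{0..1}. D 0 0 s t = \<kappa> s t) \<and>
    (\<forall>\<alpha> \<beta>. \<alpha> + \<beta> < m \<longrightarrow> (\<forall>s\<in>{0..1}. \<forall>t\<in>{0..1}.
       ((\<lambda>u. D \<alpha> \<beta> u t) has_real_derivative D (Suc \<alpha>) \<beta> s t) (at s within {0..1}) \<and>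
       ((\<lambda>u. D \<alpha> \<beta> s u) has_real_derivative D \<alpha> (Suc \<beta>) s t) (at t within {0..1}))) \<and>
    (\<forall>\<alpha> \<beta>. \<alpha> + \<beta> \<le> m \<longrightarrow> continuous_on ({0..1} \<times> {0..1}) (\<lambda>(s, t). D \<alpha> \<beta> s t)) \<and>
    (\<forall>\<alpha> \<beta>. \<alpha> + \<beta> = m \<longrightarrow> (\<forall>s\<in>{0..1}. \<forall>t\<in>{0..1}.
       ((\<lambda>u. D \<alpha> \<beta> u t) has_real_derivative D (Suc \<alpha>) \<beta> s t) (at s within {0..1}))) \<and>
    (\<forall>s\<in>{0..1}. \<forall>t\<in>{0..1}.
       ((\<lambda>u. D 0 m s u) has_real_derivative D 0 (Suc m) s t) (at t within {0..1})) \<and>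
    (\<exists>C. \<forall>\<alpha> \<beta>. \<alpha> + \<beta> \<le> Suc m \<longrightarrow> (\<forall>s\<in>{0..1}. \<forall>t\<in>{0..1}. \<bar>D \<alpha> \<beta> s t\<bar> \<le> C)))"

text \<open>The operator as a map from classes to genuine (for smooth kernels, continuous) functions.\<close>
lift_definition kernel_fun :: "(real \<Rightarrow> real \<Rightarrow> real) \<Rightarrow> linf \<Rightarrow> real \<Rightarrow> complex"
  is "\<lambda>\<kappa> x s. integral {0..1} (\<lambda>t. complex_of_real (\<kappa> s t) * x t)"
proof (rule ext)
  fix \<kappa> :: "real \<Rightarrow> real \<Rightarrow> real" and f g :: "real \<Rightarrow> complex" and s
  assume "linf_rel f g"
  then have "AE t in unit_M. f t = g t"
    by (simp add: linf_rel_def)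
  then have "AE t in lebesgue. t \<in> {0..1} \<longrightarrow> f t = g t"
    by (subst (asm) AE_restrict_space_iff) auto
  then have neg: "negligible {t. \<not> (t \<in> {0..1} \<longrightarrow> f t = g t)}"
    by (simp add: completion.AE_iff_null_sets negligible_iff_null_sets)
  show "integral {0..1} (\<lambda>t. complex_of_real (\<kappa> s t) * f t) =
        integral {0..1} (\<lambda>t. complex_of_real (\<kappa> s t) * g t)"
    by (rule integral_spike[OF neg]) auto
qed

definition fredholm :: "(real \<Rightarrow> real \<Rightarrow> real) \<Rightarrow> linf \<Rightarrow> linf"
  where "fredholm \<kappa> x = to_linf (kernel_fun \<kappa> x)"


section \<open>Interpolatory projection\<close>

definition node :: "nat \<Rightarrow> nat \<Rightarrow> nat \<Rightarrow> nat \<Rightarrow> real"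
  where "node r n j i =
    (if r = 0 then ((real j - 1) / real n + real j / real n) / 2
     else (real j - 1) / real n + real i * (1 / real n) / (2 * real r))"

definition interp_poly :: "nat \<Rightarrow> nat \<Rightarrow> nat \<Rightarrow> (real \<Rightarrow> complex) \<Rightarrow> complex poly"
  where "interp_poly r n j x =
    (THE p. degree p \<le> 2 * r \<and>
       (\<forall>i\<le>2 * r. poly p (complex_of_real (node r n j i)) = x (node r n j i)))"

text \<open>
  The index \<open>j = nat \<lceil>n s\<rceil>\<close> satisfies \<open>(j - 1) / n < s \<le> j / n\<close>. The breakpoints, where two
  adjacent polynomials may disagree if \<open>r = 0\<close>, form a null set.
\<close>
definition interp_proj :: "nat \<Rightarrow> nat \<Rightarrow> (real \<Rightarrow> complex) \<Rightarrow> linf"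
  where "interp_proj r n x =
    to_linf (\<lambda>s. poly (interp_poly r n (nat \<lceil>real n * s\<rceil>) x) (complex_of_real s))"

definition colloc :: "nat \<Rightarrow> nat \<Rightarrow> (real \<Rightarrow> real \<Rightarrow> real) \<Rightarrow> linf \<Rightarrow> linf"
  where "colloc r n \<kappa> = interp_proj r n \<circ> kernel_fun \<kappa>"

end

theory Submission
  imports Defs "HOL-Complex_Analysis.Riemann_Mapping"
begin

text \<open>
  If \<open>T x - \<mu> x = y\<close> with \<open>\<mu>\<close> inside \<open>\<Gamma>\<close>, then \<open>x = R(z) y + (\<mu> - z) R(z) x\<close> on \<open>\<Gamma>\<close>; dividing by
  \<open>z - \<mu>\<close> and integrating shows that \<open>x - E x\<close> is a contour integral of \<open>R(z) y / (z - \<mu>)\<close>, hence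
  is bounded by a multiple of the residual \<open>y\<close>. Only the winding number of \<open>\<Gamma>\<close> enters, no Cauchy
  theorem for operator-valued functions. For the collocation eigenfunction the residual is the
  interpolation error \<open>(I - Q\<^sub>n) K \<psi>\<close>, of order \<open>2 r + 1\<close>. For the iterated eigenfunction it is a
  multiple of \<open>K (I - Q\<^sub>n) K \<psi>\<close>, which gains one order because the nodal polynomial is odd about the
  midpoint of each panel. Finally \<open>E (K \<phi> - \<mu> \<phi>) = (\<lambda> - \<mu>) E \<phi>\<close> on the one-dimensional range of
  \<open>E\<close> turns the residual bound for the iterated eigenfunction into the eigenvalue bound.
\<close>

section \<open>Stieltjes line integrals\<close>

text \<open>The residual bound helps only if its constant is independent of n, yet it contains the
  distance from \<open>ev\<^sub>C n\<close> to the curve. That distance is extracted from the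
  residual itself: \<open>\<psi>\<^sub>C n\<close> has norm 1 and is almost an eigenvector of the
  integral operator for \<open>ev\<^sub>C n\<close>, so a curve point too close to
  \<open>ev\<^sub>C n\<close> would contradict the uniform resolvent bound on the curve. Two copies
  of the spectral projection occur: \<open>\<psi>\<^sub>C n\<close> can jump at breakpoints when r =
  0 and is treated in the whole space, while \<open>\<psi>\<^sub>S n\<close> is continuous and is
  treated in \<open>C01\<close>. Simplicity is assumed on \<open>C01\<close>, so the eigenvalue
  bound is read off at \<open>\<psi>\<^sub>S n\<close>. This requires a lower bound for the norm of
  its projection, which holds because \<open>\<psi>\<^sub>S n\<close> is close to the unit vector
  \<open>\<psi>\<^sub>C n\<close>. That 0 lies outside the curve serves twice: it bounds the factor
  1 / \<open>ev\<^sub>C n\<close>, and it carries the resolvent set from \<open>C01\<close> over to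
  the whole space.\<close>

definition variation_bound :: "(real \<Rightarrow> 'a::real_normed_vector) \<Rightarrow> (real \<Rightarrow> real) \<Rightarrow> bool"
  where "variation_bound \<gamma> V \<longleftrightarrow> (\<forall>a b. 0 \<le> a \<longrightarrow> a \<le> b \<longrightarrow> b \<le> 1 \<longrightarrow> norm (\<gamma> b - \<gamma> a) \<le> V b - V a)"

lemma variation_boundD:
  "variation_bound \<gamma> V \<Longrightarrow> 0 \<le> a \<Longrightarrow> a \<le> b \<Longrightarrow> b \<le> 1 \<Longrightarrow> norm (\<gamma> b - \<gamma> a) \<le> V b - V a"
  by (simp add: variation_bound_def)

lemma division_of_extend:
  fixes \<gamma> :: "real \<Rightarrow> 'a::real_normed_vector"
  assumes d: "d division_of {0..a}" and ab: "0 \<le> a" "a < b"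
  shows "insert {a..b} d division_of {0..b}"
    and "(\<Sum>k\<in>insert {a..b} d. norm (\<gamma> (Sup k) - \<gamma> (Inf k)))
      = (\<Sum>k\<in>d. norm (\<gamma> (Sup k) - \<gamma> (Inf k))) + norm (\<gamma> b - \<gamma> a)"
proof -
  have "{{a..b}} division_of {a..b}"
    using division_of_self[of a b] ab by simp
  then have "d \<union> {{a..b}} division_of {0..a} \<union> {a..b}"
    by (intro division_disjoint_union[OF d]) auto
  moreover have "{0..a} \<union> {a..b} = {0..b}"
    using ab by auto
  ultimately show "insert {a..b} d division_of {0..b}"
    by simp
  have "{a..b} \<notin> d"
  proof
    assume "{a..b} \<in> d"
    then have "{a..b} \<subseteq> {0..a}"
      using d by (rule division_ofD(2)[rotated])
    then show False using ab by auto
  qed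
  then show "(\<Sum>k\<in>insert {a..b} d. norm (\<gamma> (Sup k) - \<gamma> (Inf k)))
      = (\<Sum>k\<in>d. norm (\<gamma> (Sup k) - \<gamma> (Inf k))) + norm (\<gamma> b - \<gamma> a)"
    using division_of_finite[OF d] ab by simp
qed

text \<open>\<open>V t\<close> is the variation of the curve up to t, a supremum over divisions of
  {0..t}. Appending the piece {a..b} to a division of {0..a} makes it superadditive. Increments of
  \<open>V\<close> telescope over a division, so every later estimate of a sum ends in the single
  number \<open>V 1 - V 0\<close>.\<close>

lemma rectifiable_variation_bound:
  assumes "rectifiable \<gamma>"
  obtains V where "variation_bound \<gamma> V"
proof -
  obtain L where L: "\<And>d. d division_of {0..1} \<Longrightarrow> (\<Sum>k\<in>d. norm (\<gamma> (Sup k) - \<gamma> (Inf k))) \<le> L"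
    using assms by (auto simp: rectifiable_def)
  define v where "v d = (\<Sum>k\<in>d. norm (\<gamma> (Sup k) - \<gamma> (Inf k)))" for d
  define V where "V t = (SUP d\<in>{d. d division_of {0..t}}. v d)" for t
  have ne: "{d. d division_of {0..t}} \<noteq> {}" if "0 \<le> t" for t :: real
    using division_of_self[of 0 t] that by auto
  have le: "v d \<le> L" if d: "d division_of {0..t}" and t: "0 \<le> t" "t \<le> 1" for d t
  proof (cases "t = 1")
    case True
    then show ?thesis using L d by (simp add: v_def)
  next
    case False
    then have "t < 1" using t by simp
    note e = division_of_extend[OF d t(1) this]
    show ?thesis
      using L[OF e(1)] e(2)[of \<gamma>] norm_ge_zero[of "\<gamma> 1 - \<gamma> t"] unfolding v_def by linarith
  qed
  have bdd: "bdd_above (v ` {d. d division_of {0..t}})" if "0 \<le> t" "t \<le> 1" for t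
  proof (rule bdd_aboveI2)
    fix d assume "d \<in> {d. d division_of {0..t}}"
    then show "v d \<le> L" using le that by simp
  qed
  have "norm (\<gamma> b - \<gamma> a) \<le> V b - V a" if ab: "0 \<le> a" "a \<le> b" "b \<le> 1" for a b
  proof (cases "a = b")
    case False
    then have lt: "a < b" using ab by simp
    have "V a \<le> V b - norm (\<gamma> b - \<gamma> a)"
      unfolding V_def[of a]
    proof (rule cSUP_least[OF ne])
      fix d assume "d \<in> {d. d division_of {0..a}}"
      then have d: "d division_of {0..a}" by simp
      note e = division_of_extend[OF d ab(1) lt]
      have "v (insert {a..b} d) \<le> V b"
        unfolding V_def using e(1) ab by (intro cSUP_upper bdd) auto
      then show "v d \<le> V b - norm (\<gamma> b - \<gamma> a)"
        using e(2)[of \<gamma>] by (simp add: v_def)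
    qed (use ab in simp)
    then show ?thesis by simp
  qed simp
  then show ?thesis
    by (intro that[of V]) (simp add: variation_bound_def)
qed

lemma norm_scaleC_le: "norm (c *\<^sub>C x) \<le> norm c * norm x"
proof transfer
  fix c f assume "linf_rel f f"
  then have f: "ess_bdd f" by (simp add: linf_rel_def)
  have "AE t in unit_M. norm (c * f t) \<le> norm c * ess_norm f"
    using ess_norm_AE[OF f] by eventually_elim (simp add: norm_mult mult_left_mono)
  then show "ess_norm (\<lambda>t. c * f t) \<le> norm c * ess_norm f"
    by (intro ess_norm_le) (simp_all add: ess_norm_nonneg f)
qed

lemma norm_scaleC: "norm (c *\<^sub>C x) = norm c * norm x"
proof (cases "c = 0")
  case False
  have "norm x = norm (inverse c *\<^sub>C c *\<^sub>C x)"
    using False by simp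
  also have "\<dots> \<le> inverse (norm c) * norm (c *\<^sub>C x)"
    using norm_scaleC_le[of "inverse c" "c *\<^sub>C x"] by (simp only: norm_inverse)
  finally have "norm c * norm x \<le> norm (c *\<^sub>C x)"
    using False by (simp add: field_simps)
  then show ?thesis
    using norm_scaleC_le by (rule antisym[rotated])
qed simp

text \<open>The instance of \<open>real_normed_vector\<close> speaks of real scalars; this supplies
  sums, limits and continuity for complex ones.\<close>

interpretation scaleC: bounded_bilinear scaleC
proof
  fix a b :: complex and x y :: linf and r :: real
  show "(a + b) *\<^sub>C x = a *\<^sub>C x + b *\<^sub>C x" "a *\<^sub>C (x + y) = a *\<^sub>C x + a *\<^sub>C y"
    by (simp_all add: linf.scale_left_distrib linf.scale_right_distrib)
  show "(r *\<^sub>R a) *\<^sub>C x = r *\<^sub>R a *\<^sub>C x" "a *\<^sub>C r *\<^sub>R x = r *\<^sub>R a *\<^sub>C x"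
    by (simp_all add: scaleR_linf_def scaleR_conv_of_real mult.commute)
  show "\<exists>K. \<forall>a x. norm (a *\<^sub>C x) \<le> norm a * norm x * K"
    by (intro exI[of _ 1]) (simp add: norm_scaleC)
qed

lemma tagged_division_unit_elim:
  assumes "p tagged_division_of {0..1::real}" "(t, k) \<in> p"
  obtains a b where "k = {a..b}" "0 \<le> a" "a \<le> t" "t \<le> b" "b \<le> 1"
proof -
  note D = tagged_division_ofD[OF assms(1)]
  obtain a b where "k = {a..b}"
    using D(4)[OF assms(2)] by (auto simp: cbox_interval)
  then show ?thesis
    using that[of a b] D(2,3)[OF assms(2)] by (auto)
qed

section \<open>Convergence of Stieltjes sums\<close>

definition stieltjes_sum :: "(real \<Rightarrow> complex) \<Rightarrow> (real \<Rightarrow> linf) \<Rightarrow> (real \<times> real set) set \<Rightarrow> linf"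
  where "stieltjes_sum \<gamma> G p = (\<Sum>(t, k)\<in>p. (\<gamma> (Sup k) - \<gamma> (Inf k)) *\<^sub>C G t)"

lemma norm_stieltjes_sum_le:
  assumes p: "p tagged_division_of {0..1}" and V: "variation_bound \<gamma> V"
    and B: "\<And>t. t \<in> {0..1} \<Longrightarrow> norm (G t) \<le> B"
  shows "norm (stieltjes_sum \<gamma> G p) \<le> (V 1 - V 0) * B"
proof -
  have B0: "0 \<le> B"
    using order_trans[OF norm_ge_zero B[of 0]] by simp
  have "norm (stieltjes_sum \<gamma> G p) \<le> (\<Sum>(t, k)\<in>p. (V (Sup k) - V (Inf k)) * B)"
    unfolding stieltjes_sum_def
  proof (rule sum_norm_le)
    fix i assume "i \<in> p"
    then obtain t k where i: "i = (t, k)" "(t, k) \<in> p" by (cases i) auto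
    obtain a b where k: "k = {a..b}" "0 \<le> a" "a \<le> t" "t \<le> b" "b \<le> 1"
      by (rule tagged_division_unit_elim[OF p i(2)])
    have Vab: "norm (\<gamma> b - \<gamma> a) \<le> V b - V a"
      using k by (intro variation_boundD[OF V]) auto
    have "norm (\<gamma> b - \<gamma> a) * norm (G t) \<le> (V b - V a) * B"
      using k B[of t] Vab order_trans[OF norm_ge_zero Vab] by (intro mult_mono) auto
    then show "norm (case i of (t, k) \<Rightarrow> (\<gamma> (Sup k) - \<gamma> (Inf k)) *\<^sub>C G t)
        \<le> (case i of (t, k) \<Rightarrow> (V (Sup k) - V (Inf k)) * B)"
      using k i by (simp add: norm_scaleC)
  qed
  also have "\<dots> = (\<Sum>(t, k)\<in>p. V (Sup k) - V (Inf k)) * B"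
    by (simp add: sum_distrib_right case_prod_beta)
  also have "(\<Sum>(t, k)\<in>p. V (Sup k) - V (Inf k)) = V 1 - V 0"
    by (rule additive_tagged_division_1[OF _ p]) simp
  finally show ?thesis .
qed

definition clip :: "real set \<Rightarrow> real \<Rightarrow> real"
  where "clip k x = min (Sup k) (max (Inf k) x)"

text \<open>\<open>clip k\<close> maps each point to the nearest point of the interval k, so the
  clipped function is constant outside k. Its increments over the pieces of q telescope to the
  increment over k alone.\<close>

lemma sum_clip_increments:
  fixes \<gamma> :: "real \<Rightarrow> 'a::real_normed_vector"
  assumes p: "p tagged_division_of {0..1}" "(t, k) \<in> p" and q: "q tagged_division_of {0..1}"
  shows "(\<Sum>(t', k')\<in>q. \<gamma> (clip k (Sup k')) - \<gamma> (clip k (Inf k'))) = \<gamma> (Sup k) - \<gamma> (Inf k)"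
proof -
  obtain a b where k: "k = {a..b}" "0 \<le> a" "a \<le> t" "t \<le> b" "b \<le> 1"
    by (rule tagged_division_unit_elim[OF p])
  have "(\<Sum>(t', k')\<in>q. \<gamma> (clip k (Sup k')) - \<gamma> (clip k (Inf k'))) = \<gamma> (clip k 1) - \<gamma> (clip k 0)"
    using additive_tagged_division_1[OF _ q, of "\<lambda>x. \<gamma> (clip k x)"] by simp
  then show ?thesis
    using k by (simp add: clip_def)
qed

text \<open>Clipping to the pieces of one division refines the other, so that the two sums
  are compared on a common refinement without constructing it.\<close>

lemma stieltjes_sum_diff_le:
  assumes p: "p tagged_division_of {0..1}" and q: "q tagged_division_of {0..1}"
    and V: "variation_bound \<gamma> V" and e: "0 \<le> e"
    and close: "\<And>t k t' k'. (t, k) \<in> p \<Longrightarrow> (t', k') \<in> q \<Longrightarrow> k \<inter> k' \<noteq> {} \<Longrightarrow> norm (G t - G t') \<le> e"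
  shows "norm (stieltjes_sum \<gamma> G p - stieltjes_sum \<gamma> G q) \<le> (V 1 - V 0) * e"
proof -
  \<comment> \<open>The increment of \<gamma> over the intersection of k and k', and 0 if they share
    at most a point; hence it is symmetric in the two intervals.\<close>
  define c where "c k k' = \<gamma> (clip k (Sup k')) - \<gamma> (clip k (Inf k'))" for k k'
  have c_sym: "c k k' = c k' k" if H: "(t, k) \<in> p" "(t', k') \<in> q" for t k t' k'
  proof -
    obtain a b where k: "k = {a..b}" "0 \<le> a" "a \<le> t" "t \<le> b" "b \<le> 1"
      by (rule tagged_division_unit_elim[OF p H(1)])
    obtain a' b' where k': "k' = {a'..b'}" "0 \<le> a'" "a' \<le> t'" "t' \<le> b'" "b' \<le> 1"
      by (rule tagged_division_unit_elim[OF q H(2)])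
    have ab: "a \<le> b" "a' \<le> b'" using k k' by auto
    consider "b \<le> a'" | "b' \<le> a" | "a' < b" "a < b'" by linarith
    then show ?thesis
    proof cases
      case 1
      then have "min b (max a b') = b" "min b (max a a') = b" "min b' (max a' b) = a'" "min b' (max a' a) = a'"
        using ab by (simp_all add: min_absorb1 min_absorb2 max_absorb1 le_max_iff_disj)
      then show ?thesis using k k' ab by (simp add: c_def clip_def)
    next
      case 2
      then have "min b (max a b') = a" "min b (max a a') = a" "min b' (max a' b) = b'" "min b' (max a' a) = b'"
        using ab by (simp_all add: min_absorb1 min_absorb2 max_absorb1 le_max_iff_disj)
      then show ?thesis using k k' ab by (simp add: c_def clip_def)
    next
      case 3
      then have "min b (max a b') = min b' (max a' b)"
        by (simp add: max_absorb2 min.commute)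
      moreover have "min b (max a a') = min b' (max a' a)"
        using ab 3 by (simp add: min_absorb2 max.commute)
      ultimately show ?thesis using k k' ab by (simp add: c_def clip_def)
    qed
  qed
  have "stieltjes_sum \<gamma> G p = (\<Sum>x\<in>p. (\<Sum>y\<in>q. c (snd x) (snd y)) *\<^sub>C G (fst x))"
    unfolding stieltjes_sum_def using sum_clip_increments[OF p _ q, of _ _ \<gamma>]
    by (intro sum.cong) (auto simp: c_def case_prod_beta)
  then have Sp: "stieltjes_sum \<gamma> G p = (\<Sum>x\<in>p. \<Sum>y\<in>q. c (snd x) (snd y) *\<^sub>C G (fst x))"
    by (simp add: scaleC.sum_left)
  have "stieltjes_sum \<gamma> G q = (\<Sum>y\<in>q. (\<Sum>x\<in>p. c (snd y) (snd x)) *\<^sub>C G (fst y))"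
    unfolding stieltjes_sum_def using sum_clip_increments[OF q _ p, of _ _ \<gamma>]
    by (intro sum.cong) (auto simp: c_def case_prod_beta)
  also have "\<dots> = (\<Sum>y\<in>q. \<Sum>x\<in>p. c (snd y) (snd x) *\<^sub>C G (fst y))"
    by (simp add: scaleC.sum_left)
  also have "\<dots> = (\<Sum>y\<in>q. \<Sum>x\<in>p. c (snd x) (snd y) *\<^sub>C G (fst y))"
  proof (intro sum.cong refl)
    fix x y assume "x \<in> p" "y \<in> q"
    then have "c (snd y) (snd x) = c (snd x) (snd y)"
      using c_sym[of "fst x" "snd x" "fst y" "snd y"] by simp
    then show "c (snd y) (snd x) *\<^sub>C G (fst y) = c (snd x) (snd y) *\<^sub>C G (fst y)"
      by simp
  qed
  finally have "stieltjes_sum \<gamma> G q = (\<Sum>x\<in>p. \<Sum>y\<in>q. c (snd x) (snd y) *\<^sub>C G (fst y))"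
    by (simp only: sum.swap[of _ p q])
  then have "norm (stieltjes_sum \<gamma> G p - stieltjes_sum \<gamma> G q)
      = norm (\<Sum>x\<in>p. \<Sum>y\<in>q. c (snd x) (snd y) *\<^sub>C (G (fst x) - G (fst y)))"
    by (simp add: Sp sum_subtractf scaleC.diff_right)
  also have "\<dots> \<le> (\<Sum>x\<in>p. \<Sum>y\<in>q. (V (clip (snd x) (Sup (snd y))) - V (clip (snd x) (Inf (snd y)))) * e)"
  proof (intro sum_norm_le)
    fix x y assume x: "x \<in> p" and y: "y \<in> q"
    have x': "(fst x, snd x) \<in> p" and y': "(fst y, snd y) \<in> q" using x y by auto
    obtain a b where k: "snd x = {a..b}" "0 \<le> a" "a \<le> fst x" "fst x \<le> b" "b \<le> 1"
      by (rule tagged_division_unit_elim[OF p x'])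
    obtain a' b' where k': "snd y = {a'..b'}" "0 \<le> a'" "a' \<le> fst y" "fst y \<le> b'" "b' \<le> 1"
      by (rule tagged_division_unit_elim[OF q y'])
    let ?u = "clip (snd x) (Sup (snd y))" and ?v = "clip (snd x) (Inf (snd y))"
    have uv: "0 \<le> ?v" "?v \<le> ?u" "?u \<le> 1"
      using k k' by (auto simp: clip_def)
    have cV: "norm (c (snd x) (snd y)) \<le> V ?u - V ?v"
      unfolding c_def using uv by (rule variation_boundD[OF V])
    have "norm (c (snd x) (snd y)) * norm (G (fst x) - G (fst y)) \<le> (V ?u - V ?v) * e"
    proof (cases "snd x \<inter> snd y = {}")
      case False
      show ?thesis
        using cV close[OF x' y' False] order_trans[OF norm_ge_zero cV] by (intro mult_mono) auto
    next
      case True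
      \<comment> \<open>Both ends of one piece clip to the same end of the other, so the term
        vanishes and closeness of the tags is required only for pieces that meet.\<close>
      have "b < a' \<or> b' < a"
      proof (rule ccontr)
        assume "\<not> (b < a' \<or> b' < a)"
        then have "max a a' \<in> snd x \<inter> snd y" using k k' by auto
        then show False using True by auto
      qed
      then have "?u = ?v" using k k' by (auto simp: clip_def)
      then show ?thesis by (simp add: c_def)
    qed
    then show "norm (c (snd x) (snd y) *\<^sub>C (G (fst x) - G (fst y))) \<le> (V ?u - V ?v) * e"
      by (simp add: norm_scaleC)
  qed
  also have "\<dots> = (\<Sum>x\<in>p. (V (Sup (snd x)) - V (Inf (snd x))) * e)"
    using sum_clip_increments[OF p _ q, of _ _ V]
    by (intro sum.cong) (auto simp: sum_distrib_right[symmetric] case_prod_beta)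
  also have "\<dots> = (V 1 - V 0) * e"
    using additive_tagged_division_1[OF _ p, of V] by (simp add: sum_distrib_right[symmetric] case_prod_beta)
  finally show ?thesis .
qed

lemma variation_bound_nonneg: "variation_bound \<gamma> V \<Longrightarrow> 0 \<le> V 1 - V 0"
  using variation_boundD[of \<gamma> V 0 1] norm_ge_zero[of "\<gamma> 1 - \<gamma> 0"] by linarith

text \<open>Uniform continuity makes the sums Cauchy along the filter. Completeness is then applied
  to a sequence of ever finer divisions, and the Cauchy estimate carries its limit over to the
  filter.\<close>

lemma stieltjes_sum_converges:
  assumes V: "variation_bound \<gamma> V" and G: "continuous_on {0..1} G"
  obtains l where "(stieltjes_sum \<gamma> G \<longlongrightarrow> l) (division_filter {0..1})"
proof -
  \<comment> \<open>The added 1 keeps the divisor positive when \<open>V 1 - V 0\<close> is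
    0.\<close>
  let ?L = "V 1 - V 0 + 1"
  have L: "0 < ?L" using variation_bound_nonneg[OF V] by simp
  have uc: "uniformly_continuous_on {0..1} G"
    by (rule compact_uniformly_continuous[OF G]) simp
  have "\<exists>d>0. \<forall>(p :: (real \<times> real set) set) q. p tagged_division_of {0..1} \<and> (\<lambda>x. ball x d) fine p \<and>
      q tagged_division_of {0..1} \<and> (\<lambda>x. ball x d) fine q \<longrightarrow>
      norm (stieltjes_sum \<gamma> G p - stieltjes_sum \<gamma> G q) < e" if e: "0 < e" for e
  proof -
    have eL: "0 < e / ?L" using e L by simp
    obtain d where d: "0 < d"
      "\<And>t t'. t \<in> {0..1} \<Longrightarrow> t' \<in> {0..1} \<Longrightarrow> dist t' t < d \<Longrightarrow> dist (G t') (G t) < e / ?L"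
      by (rule uniformly_continuous_onE[OF uc eL]) (rule that)
    show ?thesis
    \<comment> \<open>Two tags are compared through a common point of their pieces, so each piece
      may use up half of d.\<close>
    proof (intro exI[of _ "d / 2"] conjI allI impI)
      fix p q :: "(real \<times> real set) set"
      assume H: "p tagged_division_of {0..1} \<and> (\<lambda>x. ball x (d/2)) fine p \<and>
        q tagged_division_of {0..1} \<and> (\<lambda>x. ball x (d/2)) fine q"
      have "norm (stieltjes_sum \<gamma> G p - stieltjes_sum \<gamma> G q) \<le> (V 1 - V 0) * (e / ?L)"
      proof (rule stieltjes_sum_diff_le[OF _ _ V])
        fix t k t' k' assume tk: "(t, k) \<in> p" "(t', k') \<in> q" "k \<inter> k' \<noteq> {}"
        then obtain s where s: "s \<in> k" "s \<in> k'" by auto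
        have "k \<subseteq> ball t (d/2)" "k' \<subseteq> ball t' (d/2)"
          using H tk by (auto simp: fine_def)
        then have "dist t s < d / 2" "dist t' s < d / 2"
          using s by auto
        then have "dist t t' < d"
          using dist_triangle_half_l[of t s d t'] by (simp add: dist_commute)
        moreover have "t \<in> {0..1}" "t' \<in> {0..1}"
          using H tk by (meson tagged_division_ofD(2,3) subsetD)+
        ultimately show "norm (G t - G t') \<le> e / ?L"
          using d(2)[of t' t] by (simp add: dist_norm)
      qed (use H e L in auto)
      also have "\<dots> < ?L * (e / ?L)"
        using e L by (intro mult_strict_right_mono) auto
      finally show "norm (stieltjes_sum \<gamma> G p - stieltjes_sum \<gamma> G q) < e"
        using L by simp
    qed (use d in simp)
  qed
  then obtain d where d: "\<And>e. 0 < e \<Longrightarrow> 0 < d e" and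
    cl: "\<And>e p q. 0 < e \<Longrightarrow> p tagged_division_of {0..1} \<Longrightarrow> (\<lambda>x. ball x (d e)) fine p \<Longrightarrow>
      q tagged_division_of {0..1} \<Longrightarrow> (\<lambda>x. ball x (d e)) fine q \<Longrightarrow>
      norm (stieltjes_sum \<gamma> G p - stieltjes_sum \<gamma> G q) < e"
    by metis
  \<comment> \<open>The minimum makes the n-th division fine for all tolerances 1 / (m + 1) with m
    at most n, not just for the last one.\<close>
  define \<delta> where "\<delta> n = Min ((\<lambda>m. d (1 / real (Suc m))) ` {..n})" for n
  have \<delta>: "0 < \<delta> n" for n
    unfolding \<delta>_def using d by (subst Min_gr_iff) auto
  have \<delta>_le: "\<delta> n \<le> d (1 / real (Suc m))" if "m \<le> n" for m n
    unfolding \<delta>_def using that by (intro Min_le) auto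
  have "\<exists>p. p tagged_division_of {0..1::real} \<and> (\<lambda>x. ball x (\<delta> n)) fine p" for n
  proof -
    obtain p where "p tagged_division_of {0..1::real}" "(\<lambda>x. ball x (\<delta> n)) fine p"
      by (rule fine_division_exists_real[OF gauge_ball[OF \<delta>[of n]]])
    then show ?thesis by (intro exI[of _ p] conjI)
  qed
  then have "\<exists>p. \<forall>n. p n tagged_division_of {0..1::real} \<and> (\<lambda>x. ball x (\<delta> n)) fine p n"
    by (intro choice allI)
  then obtain p where p: "\<And>n. p n tagged_division_of {0..1::real}"
      "\<And>n. (\<lambda>x. ball x (\<delta> n)) fine p n"
    by blast
  have pf: "(\<lambda>x. ball x (d (1 / real (Suc m)))) fine p n" if "m \<le> n" for m n
    using p(2)[of n] subset_ball[OF \<delta>_le[OF that]] unfolding fine_def by blast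
  have "Cauchy (\<lambda>n. stieltjes_sum \<gamma> G (p n))"
  proof (rule metric_CauchyI)
    fix e :: real assume "0 < e"
    then obtain m where m: "1 / real (Suc m) < e" using nat_approx_posE by blast
    have "dist (stieltjes_sum \<gamma> G (p i)) (stieltjes_sum \<gamma> G (p j)) < e" if "m \<le> i" "m \<le> j" for i j
      using cl[OF _ p(1) pf[OF that(1)] p(1) pf[OF that(2)]] m by (simp add: dist_norm)
    then show "\<exists>M. \<forall>m\<ge>M. \<forall>n\<ge>M. dist (stieltjes_sum \<gamma> G (p m)) (stieltjes_sum \<gamma> G (p n)) < e"
      by blast
  qed
  then obtain l where l: "(\<lambda>n. stieltjes_sum \<gamma> G (p n)) \<longlonglongrightarrow> l"
    using Cauchy_convergent convergent_def by blast
  have "(stieltjes_sum \<gamma> G \<longlongrightarrow> l) (division_filter {0..1})"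
  proof (rule tendstoI)
    fix e :: real assume e: "0 < e"
    then obtain m where m: "1 / real (Suc m) < e / 2" using nat_approx_posE[of "e/2"] by auto
    have "eventually (\<lambda>n. dist (stieltjes_sum \<gamma> G (p n)) l < e / 2) sequentially"
      using tendstoD[OF l, of "e/2"] e by simp
    then obtain N where N: "\<And>n. N \<le> n \<Longrightarrow> dist (stieltjes_sum \<gamma> G (p n)) l < e / 2"
      by (auto simp: eventually_sequentially)
    let ?n = "max m N"
    have "dist (stieltjes_sum \<gamma> G q) l < e"
      if "q tagged_division_of {0..1}" "(\<lambda>x. ball x (d (1 / real (Suc m)))) fine q" for q
    proof (rule dist_triangle_half_r)
      show "dist (stieltjes_sum \<gamma> G (p ?n)) (stieltjes_sum \<gamma> G q) < e / 2"
        using cl[OF _ p(1) pf[of m ?n] that] m by (simp add: dist_norm)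
      show "dist (stieltjes_sum \<gamma> G (p ?n)) l < e / 2"
        using N by simp
    qed
    then show "eventually (\<lambda>q. dist (stieltjes_sum \<gamma> G q) l < e) (division_filter {0..1})"
      unfolding eventually_division_filter using d[of "1 / real (Suc m)"]
      by (intro exI[of _ "\<lambda>x. ball x (d (1 / real (Suc m)))"]) auto
  qed
  then show ?thesis by (rule that)
qed

section \<open>Line integrals along rectifiable curves, and winding numbers\<close>

lemma division_filter_unit_neq_bot: "division_filter {0..1::real} \<noteq> bot"
  using division_filter_not_empty[of 0 "1::real"] by simp

lemma line_integral_eqI:
  assumes "(stieltjes_sum \<gamma> (g \<circ> \<gamma>) \<longlongrightarrow> l) (division_filter {0..1})"
  shows "line_integral \<gamma> g = l"
  using tendsto_Lim[OF division_filter_unit_neq_bot assms]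
  by (simp add: line_integral_def stieltjes_sum_def[abs_def])

lemma line_integral_tendsto:
  assumes "path \<gamma>" "rectifiable \<gamma>" "continuous_on (path_image \<gamma>) g"
  shows "(stieltjes_sum \<gamma> (g \<circ> \<gamma>) \<longlongrightarrow> line_integral \<gamma> g) (division_filter {0..1})"
proof -
  obtain V where "variation_bound \<gamma> V" by (rule rectifiable_variation_bound[OF assms(2)])
  moreover have "continuous_on {0..1} (g \<circ> \<gamma>)"
    using assms(1,3) by (intro continuous_on_compose) (auto simp: path_def path_image_def)
  ultimately obtain l where "(stieltjes_sum \<gamma> (g \<circ> \<gamma>) \<longlongrightarrow> l) (division_filter {0..1})"
    by (rule stieltjes_sum_converges)
  then show ?thesis
    using line_integral_eqI by blast
qed

lemma norm_line_integral_le: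
  assumes "path \<gamma>" "rectifiable \<gamma>" "continuous_on (path_image \<gamma>) g"
    and V: "variation_bound \<gamma> V"
    and B: "\<And>z. z \<in> path_image \<gamma> \<Longrightarrow> norm (g z) \<le> B"
  shows "norm (line_integral \<gamma> g) \<le> (V 1 - V 0) * B"
proof (rule tendsto_upperbound[OF _ _ division_filter_unit_neq_bot])
  show "((\<lambda>p. norm (stieltjes_sum \<gamma> (g \<circ> \<gamma>) p)) \<longlongrightarrow> norm (line_integral \<gamma> g)) (division_filter {0..1})"
    by (intro tendsto_norm line_integral_tendsto assms)
  show "\<forall>\<^sub>F p in division_filter {0..1}. norm (stieltjes_sum \<gamma> (g \<circ> \<gamma>) p) \<le> (V 1 - V 0) * B"
    using eventually_division_filter_tagged_division[of "{0..1::real}"]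
  proof eventually_elim
    case (elim p)
    show ?case
      by (rule norm_stieltjes_sum_le[OF elim V]) (simp add: path_image_def B)
  qed
qed

text \<open>The function exp z - z has derivative exp z - 1, of norm at most 2 e on the ball of
  radius e, which gives the second-order estimate. For e at most 1/4 that error is at most half of
  |u - v|, so the estimate can be inverted.\<close>

lemma norm_exp_diff_le:
  fixes u v :: complex
  assumes "norm u \<le> e" "norm v \<le> e" "e \<le> 1/4"
  shows "norm (exp u - exp v - (u - v)) \<le> 2 * e * norm (u - v)"
    and "norm (u - v) \<le> 2 * norm (exp u - exp v)"
proof -
  have *: "norm ((exp u - u) - (exp v - v)) \<le> 2 * e * norm (u - v)"
  proof (rule field_differentiable_bound[where S = "cball 0 e" and f' = "\<lambda>z. exp z - 1"])
    fix z :: complex assume "z \<in> cball 0 e"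
    then have z: "norm z \<le> e" by simp
    show "((\<lambda>z. exp z - z) has_field_derivative exp z - 1) (at z within cball 0 e)"
      by (intro DERIV_diff has_field_derivative_at_within[OF DERIV_exp] DERIV_ident)
    have "norm (exp z - exp 0) \<le> 2 * norm (z - 0)"
    proof (rule field_differentiable_bound[where S = "cball 0 (1/2)" and f' = exp])
      fix y :: complex assume "y \<in> cball 0 (1/2)"
      then show "norm (exp y) \<le> 2"
        by (intro exp_bound_half) simp
      show "(exp has_field_derivative exp y) (at y within cball 0 (1/2))"
        by (rule has_field_derivative_at_within[OF DERIV_exp])
    qed (use z assms(3) in auto)
    then have "norm (exp z - 1) \<le> 2 * norm z"
      by simp
    then show "norm (exp z - 1) \<le> 2 * e" using z by simp
  qed (use assms in auto)
  then show 1: "norm (exp u - exp v - (u - v)) \<le> 2 * e * norm (u - v)"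
    by (simp add: algebra_simps)
  have "norm (u - v) \<le> norm (exp u - exp v) + norm (exp u - exp v - (u - v))"
    by (metis norm_minus_commute norm_triangle_sub)
  moreover have "2 * e * norm (u - v) \<le> 1/2 * norm (u - v)"
    using assms(3) by (intro mult_right_mono) auto
  ultimately show "norm (u - v) \<le> 2 * norm (exp u - exp v)"
    using 1 by linarith
qed

text \<open>A continuous logarithm along the curve turns the sums into telescoping ones up to a
  second-order error.\<close>

lemma stieltjes_winding_number:
  assumes \<gamma>: "path \<gamma>" "rectifiable \<gamma>" and w: "w \<notin> path_image \<gamma>"
  shows "((\<lambda>p. \<Sum>(t, k)\<in>p. (\<gamma> (Sup k) - \<gamma> (Inf k)) / (\<gamma> t - w))
    \<longlongrightarrow> 2 * of_real pi * \<i> * winding_number \<gamma> w) (division_filter {0..1})"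
proof -
  obtain V where V: "variation_bound \<gamma> V" by (rule rectifiable_variation_bound[OF \<gamma>(2)])
  obtain q where q: "path q" "pathfinish q - pathstart q = 2 * of_real pi * \<i> * winding_number \<gamma> w"
    "\<And>t. t \<in> {0..1} \<Longrightarrow> \<gamma> t = w + exp (q t)"
    by (rule winding_number_as_continuous_log[OF \<gamma>(1) w]) (rule that; simp)
  obtain \<rho> where \<rho>: "0 < \<rho>" "\<And>z. z \<in> path_image \<gamma> \<Longrightarrow> \<rho> \<le> dist w z"
    using separate_point_closed[OF closed_path_image[OF \<gamma>(1)] w] by blast
  let ?L = "V 1 - V 0"
  have L: "0 \<le> ?L" by (rule variation_bound_nonneg[OF V])
  show ?thesis
  proof (rule tendstoI)
    fix \<epsilon> :: real assume \<epsilon>: "0 < \<epsilon>"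
    \<comment> \<open>Chosen so that 4 c / \<rho> times \<open>?L + 1\<close> equals \<epsilon> / 2
      at the end.\<close>
    define c where "c = \<epsilon> * \<rho> / (8 * (?L + 1))"
    define e where "e = min (1/4) c"
    have c: "0 < c" unfolding c_def using \<epsilon> \<rho>(1) L by (intro divide_pos_pos mult_pos_pos) auto
    then have e1: "0 < e" by (simp add: e_def)
    have e2: "e \<le> 1/4" unfolding e_def by (rule min.cobounded1)
    have uc: "uniformly_continuous_on {0..1} q"
      using q(1) by (intro compact_uniformly_continuous) (simp_all add: path_def)
    obtain d where d: "0 < d"
      "\<And>t t'. t \<in> {0..1} \<Longrightarrow> t' \<in> {0..1} \<Longrightarrow> dist t' t < d \<Longrightarrow> dist (q t') (q t) < e"
      by (rule uniformly_continuous_onE[OF uc e1]) (rule that)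
    have "dist (\<Sum>(t, k)\<in>p. (\<gamma> (Sup k) - \<gamma> (Inf k)) / (\<gamma> t - w))
        (2 * of_real pi * \<i> * winding_number \<gamma> w) < \<epsilon>"
      if p: "p tagged_division_of {0..1}" and fine: "(\<lambda>x. ball x d) fine p" for p
    proof -
      have tele: "2 * of_real pi * \<i> * winding_number \<gamma> w = (\<Sum>(t, k)\<in>p. q (Sup k) - q (Inf k))"
        using additive_tagged_division_1[OF _ p, of q] q(2) by (simp add: pathfinish_def pathstart_def)
      have "norm ((\<Sum>(t, k)\<in>p. (\<gamma> (Sup k) - \<gamma> (Inf k)) / (\<gamma> t - w)) - (\<Sum>(t, k)\<in>p. q (Sup k) - q (Inf k)))
        = norm (\<Sum>x\<in>p. (\<gamma> (Sup (snd x)) - \<gamma> (Inf (snd x))) / (\<gamma> (fst x) - w) - (q (Sup (snd x)) - q (Inf (snd x))))"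
        by (simp add: sum_subtractf case_prod_beta)
      also have "\<dots> \<le> (\<Sum>x\<in>p. 4 * e / \<rho> * (V (Sup (snd x)) - V (Inf (snd x))))"
      proof (rule sum_norm_le)
        fix x assume "x \<in> p"
        then have x': "(fst x, snd x) \<in> p" by simp
        obtain a b where k: "snd x = {a..b}" "0 \<le> a" "a \<le> fst x" "fst x \<le> b" "b \<le> 1"
          by (rule tagged_division_unit_elim[OF p x'])
        let ?t = "fst x"
        let ?u = "q b - q ?t" and ?v = "q a - q ?t"
        have "snd x \<subseteq> ball ?t d" by (rule fineD[OF fine x'])
        moreover have "a \<in> snd x" "b \<in> snd x" using k by auto
        ultimately have "a \<in> ball ?t d" "b \<in> ball ?t d" by (blast intro: subsetD)+
        then have uv: "norm ?u \<le> e" "norm ?v \<le> e"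
          using d(2)[of ?t b] d(2)[of ?t a] k by (auto simp: dist_norm norm_minus_commute intro!: less_imp_le)
        note est = norm_exp_diff_le[OF uv e2]
        \<comment> \<open>Division by \<gamma> t - w = exp (q t) centres the logarithm at the tag,
          where both exponents have norm at most e.\<close>
        have ex: "(\<gamma> b - \<gamma> a) / (\<gamma> ?t - w) = exp ?u - exp ?v"
          using q(3)[of a] q(3)[of b] q(3)[of ?t] k by (simp add: exp_diff diff_divide_distrib)
        have Vab: "norm (\<gamma> b - \<gamma> a) \<le> V b - V a"
          using k by (intro variation_boundD[OF V]) auto
        have "\<rho> \<le> norm (\<gamma> ?t - w)"
          using \<rho>(2)[of "\<gamma> ?t"] k by (auto simp: path_image_def dist_norm norm_minus_commute)
        then have "norm ((\<gamma> b - \<gamma> a) / (\<gamma> ?t - w)) \<le> (V b - V a) / \<rho>"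
          unfolding norm_divide using Vab \<rho>(1) order_trans[OF norm_ge_zero Vab]
          by (intro frac_le) auto
        then have "norm (exp ?u - exp ?v) \<le> (V b - V a) / \<rho>"
          by (simp add: ex)
        then have "norm (?u - ?v) \<le> 2 * ((V b - V a) / \<rho>)"
          using est(2) by linarith
        then have "2 * e * norm (?u - ?v) \<le> 2 * e * (2 * ((V b - V a) / \<rho>))"
          using e1 by (intro mult_left_mono) auto
        then have "norm (exp ?u - exp ?v - (?u - ?v)) \<le> 4 * e / \<rho> * (V b - V a)"
          using est(1) by (simp add: mult_ac)
        then show "norm ((\<gamma> (Sup (snd x)) - \<gamma> (Inf (snd x))) / (\<gamma> ?t - w) - (q (Sup (snd x)) - q (Inf (snd x))))
          \<le> 4 * e / \<rho> * (V (Sup (snd x)) - V (Inf (snd x)))"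
          using k by (simp add: ex)
      qed
      also have "\<dots> = 4 * e / \<rho> * ?L"
        using additive_tagged_division_1[OF _ p, of V]
        by (simp only: sum_distrib_left[symmetric]) (simp add: case_prod_beta)
      also have "\<dots> \<le> 4 * c / \<rho> * (?L + 1)"
        using \<rho>(1) L c by (intro mult_mono divide_right_mono mult_left_mono) (simp_all add: e_def)
      also have "\<dots> = \<epsilon> / 2"
      proof -
        have "4 * (\<epsilon> * \<rho> / (8 * l)) / \<rho> * l = \<epsilon> / 2" if "0 < l" for l
          using that \<rho>(1) by simp
        then show ?thesis
          unfolding c_def using L by (simp only: add_nonneg_pos zero_less_one)
      qed
      finally show ?thesis
        using \<epsilon> by (simp add: tele dist_norm)
    qed
    then show "eventually (\<lambda>p. dist (\<Sum>(t, k)\<in>p. (\<gamma> (Sup k) - \<gamma> (Inf k)) / (\<gamma> t - w))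
        (2 * of_real pi * \<i> * winding_number \<gamma> w) < \<epsilon>) (division_filter {0..1})"
      unfolding eventually_division_filter using d(1)
      by (intro exI[of _ "\<lambda>x. ball x d"]) auto
  qed
qed

lemma line_integral_winding_number:
  assumes \<gamma>: "path \<gamma>" "rectifiable \<gamma>" and w: "w \<notin> path_image \<gamma>"
  shows "line_integral \<gamma> (\<lambda>z. (1 / (z - w)) *\<^sub>C x) = (2 * of_real pi * \<i> * winding_number \<gamma> w) *\<^sub>C x"
proof (rule line_integral_eqI)
  have "stieltjes_sum \<gamma> ((\<lambda>z. (1 / (z - w)) *\<^sub>C x) \<circ> \<gamma>)
      = (\<lambda>p. (\<Sum>(t, k)\<in>p. (\<gamma> (Sup k) - \<gamma> (Inf k)) / (\<gamma> t - w)) *\<^sub>C x)"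
    by (rule ext) (simp add: stieltjes_sum_def scaleC.sum_left case_prod_beta)
  then show "(stieltjes_sum \<gamma> ((\<lambda>z. (1 / (z - w)) *\<^sub>C x) \<circ> \<gamma>)
      \<longlongrightarrow> (2 * of_real pi * \<i> * winding_number \<gamma> w) *\<^sub>C x) (division_filter {0..1})"
    using scaleC.tendsto[OF stieltjes_winding_number[OF assms] tendsto_const[of x]] by simp
qed

section \<open>Linearity of the line integral\<close>

lemma stieltjes_sum_cong:
  assumes "p tagged_division_of {0..1}" "\<And>t. t \<in> {0..1} \<Longrightarrow> F t = G t"
  shows "stieltjes_sum \<gamma> F p = stieltjes_sum \<gamma> G p"
  unfolding stieltjes_sum_def
proof (intro sum.cong refl)
  fix x assume "x \<in> p"
  then obtain t k where x: "x = (t, k)" "(t, k) \<in> p" by (cases x) auto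
  obtain a b where "k = {a..b}" "0 \<le> a" "a \<le> t" "t \<le> b" "b \<le> 1"
    by (rule tagged_division_unit_elim[OF assms(1) x(2)])
  then show "(case x of (t, k) \<Rightarrow> (\<gamma> (Sup k) - \<gamma> (Inf k)) *\<^sub>C F t) =
      (case x of (t, k) \<Rightarrow> (\<gamma> (Sup k) - \<gamma> (Inf k)) *\<^sub>C G t)"
    using assms(2)[of t] x(1) by simp
qed

text \<open>Agreement on the curve suffices because p is eventually a tagged division, and its tags
  lie in the unit interval.\<close>

lemma line_integral_cong:
  assumes "path \<gamma>" "rectifiable \<gamma>" "continuous_on (path_image \<gamma>) f"
    and "\<And>z. z \<in> path_image \<gamma> \<Longrightarrow> f z = g z"
  shows "line_integral \<gamma> f = line_integral \<gamma> g"
proof (rule line_integral_eqI[symmetric])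
  have "\<forall>\<^sub>F p in division_filter {0..1}. stieltjes_sum \<gamma> (f \<circ> \<gamma>) p = stieltjes_sum \<gamma> (g \<circ> \<gamma>) p"
    using eventually_division_filter_tagged_division[of "{0..1::real}"]
  proof eventually_elim
    case (elim p)
    show ?case
      by (rule stieltjes_sum_cong[OF elim]) (simp add: path_image_def assms(4))
  qed
  then show "(stieltjes_sum \<gamma> (g \<circ> \<gamma>) \<longlongrightarrow> line_integral \<gamma> f) (division_filter {0..1})"
    using line_integral_tendsto[OF assms(1-3)] tendsto_cong by blast
qed

lemma line_integral_add:
  assumes "path \<gamma>" "rectifiable \<gamma>" "continuous_on (path_image \<gamma>) f" "continuous_on (path_image \<gamma>) g"
  shows "line_integral \<gamma> (\<lambda>z. f z + g z) = line_integral \<gamma> f + line_integral \<gamma> g"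
proof (rule line_integral_eqI)
  have "stieltjes_sum \<gamma> ((\<lambda>z. f z + g z) \<circ> \<gamma>)
      = (\<lambda>p. stieltjes_sum \<gamma> (f \<circ> \<gamma>) p + stieltjes_sum \<gamma> (g \<circ> \<gamma>) p)"
    by (rule ext) (simp add: stieltjes_sum_def scaleC.add_right sum.distrib case_prod_beta)
  then show "(stieltjes_sum \<gamma> ((\<lambda>z. f z + g z) \<circ> \<gamma>) \<longlongrightarrow> line_integral \<gamma> f + line_integral \<gamma> g)
      (division_filter {0..1})"
    using tendsto_add[OF line_integral_tendsto[OF assms(1-3)] line_integral_tendsto[OF assms(1,2,4)]] by simp
qed

text \<open>\<open>bounded_linear\<close> is linearity over the reals, whereas the weights in the
  sums are complex increments; this is what \<open>hom\<close> is for.\<close>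

lemma line_integral_linear:
  assumes "path \<gamma>" "rectifiable \<gamma>" "continuous_on (path_image \<gamma>) f"
    and T: "bounded_linear T" and hom: "\<And>c x. T (c *\<^sub>C x) = c *\<^sub>C T x"
  shows "line_integral \<gamma> (\<lambda>z. T (f z)) = T (line_integral \<gamma> f)"
proof (rule line_integral_eqI)
  have "stieltjes_sum \<gamma> ((\<lambda>z. T (f z)) \<circ> \<gamma>) = (\<lambda>p. T (stieltjes_sum \<gamma> (f \<circ> \<gamma>) p))"
    by (rule ext) (simp add: stieltjes_sum_def linear_sum[OF bounded_linear.linear[OF T]] hom case_prod_beta)
  then show "(stieltjes_sum \<gamma> ((\<lambda>z. T (f z)) \<circ> \<gamma>) \<longlongrightarrow> T (line_integral \<gamma> f)) (division_filter {0..1})"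
    using bounded_linear.tendsto[OF T line_integral_tendsto[OF assms(1-3)]] by simp
qed

section \<open>Spectral projections\<close>

text \<open>Instantiated with \<open>C01\<close> and with \<open>UNIV\<close>. The operator acts
  boundedly on the whole space in both cases; only its resolvent is tied to S.\<close>

locale resolvent_curve =
  fixes S :: "linf set" and T :: "linf \<Rightarrow> linf" and \<gamma> :: "real \<Rightarrow> complex"
  assumes subspace: "linf.subspace S"
    and maps: "x \<in> S \<Longrightarrow> T x \<in> S"
    and bounded_linear: "bounded_linear T"
    and homogeneous: "T (c *\<^sub>C x) = c *\<^sub>C T x"
    and path: "path \<gamma>"
    and rectifiable: "rectifiable \<gamma>"
    and in_resolvent_set: "path_image \<gamma> \<subseteq> resolvent_set S T"
begin

abbreviation "R \<equiv> resolvent S T"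
abbreviation "E \<equiv> spectral_projection S T \<gamma>"

lemmas T_add = linear_add[OF bounded_linear.linear[OF bounded_linear]]
  and T_diff = linear_diff[OF bounded_linear.linear[OF bounded_linear]]
lemmas S_closed = linf.subspace_add[OF subspace] linf.subspace_diff[OF subspace]
  linf.subspace_scale[OF subspace] maps

section \<open>The resolvent on the curve\<close>

lemma bij: "z \<in> path_image \<gamma> \<Longrightarrow> bij_betw (\<lambda>x. T x - z *\<^sub>C x) S S"
  using in_resolvent_set by (auto simp: resolvent_set_def)

lemma R_in: "z \<in> path_image \<gamma> \<Longrightarrow> x \<in> S \<Longrightarrow> R z x \<in> S"
  using bij[of z] unfolding resolvent_def by (metis bij_betw_imp_surj_on inv_into_into)

lemma R_right: "z \<in> path_image \<gamma> \<Longrightarrow> x \<in> S \<Longrightarrow> T (R z x) - z *\<^sub>C R z x = x"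
  using bij_betw_inv_into_right[OF bij[of z], of x] unfolding resolvent_def by simp

lemma R_left: "z \<in> path_image \<gamma> \<Longrightarrow> x \<in> S \<Longrightarrow> R z (T x - z *\<^sub>C x) = x"
  using bij_betw_inv_into_left[OF bij[of z], of x] unfolding resolvent_def by simp

lemma R_eqI: "z \<in> path_image \<gamma> \<Longrightarrow> y \<in> S \<Longrightarrow> T y - z *\<^sub>C y = x \<Longrightarrow> R z x = y"
  using R_left by blast

lemma R_add:
  assumes "z \<in> path_image \<gamma>" "x \<in> S" "y \<in> S"
  shows "R z (x + y) = R z x + R z y"
proof (rule R_eqI)
  show "T (R z x + R z y) - z *\<^sub>C (R z x + R z y) = x + y"
    using R_right[OF assms(1,2)] R_right[OF assms(1,3)]
    by (simp add: T_add scaleC.add_right algebra_simps)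
qed (use assms in \<open>simp_all add: R_in S_closed\<close>)

lemma R_scale:
  assumes "z \<in> path_image \<gamma>" "x \<in> S"
  shows "R z (c *\<^sub>C x) = c *\<^sub>C R z x"
proof (rule R_eqI)
  have "T (c *\<^sub>C R z x) - z *\<^sub>C c *\<^sub>C R z x = c *\<^sub>C (T (R z x) - z *\<^sub>C R z x)"
    by (simp add: homogeneous scaleC.diff_right mult.commute)
  then show "T (c *\<^sub>C R z x) - z *\<^sub>C c *\<^sub>C R z x = c *\<^sub>C x"
    using R_right[OF assms] by simp
qed (use assms in \<open>simp_all add: R_in S_closed\<close>)

lemma R_commutes:
  assumes "z \<in> path_image \<gamma>" "x \<in> S"
  shows "R z (T x) = T (R z x)"
proof (rule R_eqI)
  have "T (T (R z x)) - z *\<^sub>C T (R z x) = T (T (R z x) - z *\<^sub>C R z x)"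
    by (simp add: homogeneous T_diff)
  then show "T (T (R z x)) - z *\<^sub>C T (R z x) = T x"
    using R_right[OF assms] by simp
qed (use assms in \<open>simp_all add: R_in S_closed\<close>)

text \<open>Compactness of the curve. A bound with constant \<open>M w\<close> at w persists with
  constant 2 \<open>M w\<close> on the ball of radius 1 / (2 \<open>M w\<close>), since the
  perturbation (z - w) x then costs at most half of the norm of x. Finitely many such balls cover
  the curve.\<close>

lemma uniform_bound:
  obtains M where "0 < M" "\<And>z x. z \<in> path_image \<gamma> \<Longrightarrow> x \<in> S \<Longrightarrow> norm x \<le> M * norm (T x - z *\<^sub>C x)"
proof -
  have "\<exists>M>0. \<forall>x\<in>S. norm x \<le> M * norm (T x - w *\<^sub>C x)" if w: "w \<in> path_image \<gamma>" for w
  proof -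
    obtain M where M: "\<And>x. x \<in> S \<Longrightarrow> norm x \<le> M * norm (T x - w *\<^sub>C x)"
      using in_resolvent_set w unfolding resolvent_set_def by blast
    have "norm x \<le> (\<bar>M\<bar> + 1) * norm (T x - w *\<^sub>C x)" if "x \<in> S" for x
      using M[OF that] by (rule order_trans) (intro mult_right_mono, auto)
    then show ?thesis by (intro exI[of _ "\<bar>M\<bar> + 1"]) auto
  qed
  then obtain M where M: "\<And>w. w \<in> path_image \<gamma> \<Longrightarrow> 0 < M w"
    "\<And>w x. w \<in> path_image \<gamma> \<Longrightarrow> x \<in> S \<Longrightarrow> norm x \<le> M w * norm (T x - w *\<^sub>C x)"
    by metis
  obtain W where W: "W \<subseteq> path_image \<gamma>" "finite W" "path_image \<gamma> \<subseteq> (\<Union>w\<in>W. ball w (1 / (2 * M w)))"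
  proof (rule compactE_image[OF compact_path_image[OF path], of "path_image \<gamma>" "\<lambda>w. ball w (1 / (2 * M w))"])
    show "path_image \<gamma> \<subseteq> (\<Union>w\<in>path_image \<gamma>. ball w (1 / (2 * M w)))"
      using M(1) by (auto intro!: bexI centre_in_ball[THEN iffD2])
  qed auto
  define B where "B = Max (insert 1 ((\<lambda>w. 2 * M w) ` W))"
  have B: "1 \<le> B" "\<And>w. w \<in> W \<Longrightarrow> 2 * M w \<le> B"
    unfolding B_def using W(2) by (auto intro: Max_ge)
  show ?thesis
  proof (rule that[of B])
    fix z x assume z: "z \<in> path_image \<gamma>" and x: "x \<in> S"
    then obtain w where w: "w \<in> W" "z \<in> ball w (1 / (2 * M w))"
      using W(3) by blast
    then have w': "w \<in> path_image \<gamma>" and Mw: "0 < M w"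
      using W(1) M(1) by auto
    have "norm (z - w) * norm x \<le> 1 / (2 * M w) * norm x"
      using w(2) by (intro mult_right_mono) (simp_all add: dist_norm norm_minus_commute less_imp_le)
    then have zw: "M w * (norm (z - w) * norm x) \<le> norm x / 2"
      using Mw by (simp add: field_simps)
    have "T x - w *\<^sub>C x = (T x - z *\<^sub>C x) + (z - w) *\<^sub>C x"
      by (simp add: scaleC.diff_left)
    then have "norm (T x - w *\<^sub>C x) \<le> norm (T x - z *\<^sub>C x) + norm (z - w) * norm x"
      by (metis norm_triangle_ineq norm_scaleC)
    then have "M w * norm (T x - w *\<^sub>C x) \<le> M w * (norm (T x - z *\<^sub>C x) + norm (z - w) * norm x)"
      using Mw by (intro mult_left_mono) auto
    then have "norm x \<le> 2 * M w * norm (T x - z *\<^sub>C x)"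
      using M(2)[OF w' x] zw by (simp add: distrib_left)
    also have "\<dots> \<le> B * norm (T x - z *\<^sub>C x)"
      using B(2)[OF w(1)] by (intro mult_right_mono) auto
    finally show "norm x \<le> B * norm (T x - z *\<^sub>C x)" .
  qed (use B in simp)
qed

lemma R_bound:
  obtains M where "0 < M" "\<And>z x. z \<in> path_image \<gamma> \<Longrightarrow> x \<in> S \<Longrightarrow> norm (R z x) \<le> M * norm x"
proof -
  obtain M where M: "0 < M" "\<And>z x. z \<in> path_image \<gamma> \<Longrightarrow> x \<in> S \<Longrightarrow> norm x \<le> M * norm (T x - z *\<^sub>C x)"
    by (rule uniform_bound) (rule that)
  have "norm (R z x) \<le> M * norm x" if "z \<in> path_image \<gamma>" "x \<in> S" for z x
    using M(2)[OF that(1) R_in[OF that]] R_right[OF that] by simp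
  then show ?thesis using M(1) that by blast
qed

text \<open>The first resolvent identity R(z) x - R(w) x = (z - w) R(z) R(w) x, together with the
  uniform bound, gives a Lipschitz estimate.\<close>

lemma R_continuous:
  assumes x: "x \<in> S"
  shows "continuous_on (path_image \<gamma>) (\<lambda>z. R z x)"
proof -
  obtain M where M: "0 < M" "\<And>z x. z \<in> path_image \<gamma> \<Longrightarrow> x \<in> S \<Longrightarrow> norm (R z x) \<le> M * norm x"
    by (rule R_bound) (rule that)
  have "dist (R z x) (R w x) \<le> (M * (M * norm x)) * dist z w"
    if z: "z \<in> path_image \<gamma>" and w: "w \<in> path_image \<gamma>" for z w
  proof -
    have wS: "(z - w) *\<^sub>C R w x \<in> S"
      using x w by (simp add: S_closed R_in)
    have "T (R z x - R w x) - z *\<^sub>C (R z x - R w x)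
        = (T (R z x) - z *\<^sub>C R z x) - (T (R w x) - w *\<^sub>C R w x) + (z - w) *\<^sub>C R w x"
      by (simp add: T_diff scaleC.diff_left scaleC.diff_right)
    also have "\<dots> = (z - w) *\<^sub>C R w x"
      using R_right[OF z x] R_right[OF w x] by simp
    finally have "R z ((z - w) *\<^sub>C R w x) = R z x - R w x"
      using x z w by (intro R_eqI) (simp_all add: S_closed R_in)
    then have "norm (R z x - R w x) \<le> M * (norm (z - w) * norm (R w x))"
      using M(2)[OF z wS] by (simp add: norm_scaleC)
    also have "\<dots> \<le> M * (norm (z - w) * (M * norm x))"
      using M(1) M(2)[OF w x] by (intro mult_left_mono) auto
    finally show ?thesis by (simp add: dist_norm mult_ac)
  qed
  then have "(M * (M * norm x))-lipschitz_on (path_image \<gamma>) (\<lambda>z. R z x)"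
    using M(1) by (intro lipschitz_onI) auto
  then show ?thesis
    by (rule lipschitz_on_continuous_on)
qed

section \<open>The spectral projection as a bounded linear map\<close>

lemma E_eq: "E x = (- (1 / (2 * complex_of_real pi * \<i>))) *\<^sub>C line_integral \<gamma> (\<lambda>z. R z x)"
  by (simp add: spectral_projection_def)

lemma E_add: "x \<in> S \<Longrightarrow> y \<in> S \<Longrightarrow> E (x + y) = E x + E y"
proof -
  assume x: "x \<in> S" and y: "y \<in> S"
  have "line_integral \<gamma> (\<lambda>z. R z (x + y)) = line_integral \<gamma> (\<lambda>z. R z x + R z y)"
    using x y by (intro line_integral_cong[OF path rectifiable R_continuous]) (simp_all add: S_closed R_add)
  then show ?thesis
    using line_integral_add[OF path rectifiable R_continuous[OF x] R_continuous[OF y]]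
    by (simp add: E_eq scaleC.add_right)
qed

lemma E_scale: "x \<in> S \<Longrightarrow> E (c *\<^sub>C x) = c *\<^sub>C E x"
proof -
  assume x: "x \<in> S"
  have "line_integral \<gamma> (\<lambda>z. R z (c *\<^sub>C x)) = line_integral \<gamma> (\<lambda>z. c *\<^sub>C R z x)"
    using x by (intro line_integral_cong[OF path rectifiable R_continuous]) (simp_all add: S_closed R_scale)
  also have "\<dots> = c *\<^sub>C line_integral \<gamma> (\<lambda>z. R z x)"
    by (rule line_integral_linear[OF path rectifiable R_continuous[OF x] scaleC.bounded_linear_right])
       (simp add: mult.commute)
  finally show ?thesis
    by (simp add: E_eq mult.commute)
qed

lemma E_commutes: "x \<in> S \<Longrightarrow> E (T x) = T (E x)"
proof -
  assume x: "x \<in> S"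
  have "line_integral \<gamma> (\<lambda>z. R z (T x)) = line_integral \<gamma> (\<lambda>z. T (R z x))"
    using x by (intro line_integral_cong[OF path rectifiable R_continuous]) (simp_all add: S_closed R_commutes)
  also have "\<dots> = T (line_integral \<gamma> (\<lambda>z. R z x))"
    by (rule line_integral_linear[OF path rectifiable R_continuous[OF x] bounded_linear homogeneous])
  finally show ?thesis
    by (simp only: E_eq homogeneous)
qed

lemma E_diff_scale:
  assumes "x \<in> S"
  shows "E (T x - c *\<^sub>C x) = T (E x) - c *\<^sub>C E x"
proof -
  have "E (T x + (- c) *\<^sub>C x) = E (T x) + E ((- c) *\<^sub>C x)"
    by (rule E_add) (simp_all only: S_closed assms)
  then show ?thesis
    using assms E_scale[OF assms, of "- c"] by (simp add: E_commutes scaleC.minus_left)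
qed

lemma E_bound:
  obtains C where "0 < C" "\<And>x. x \<in> S \<Longrightarrow> norm (E x) \<le> C * norm x"
proof -
  obtain M where M: "0 < M" "\<And>z x. z \<in> path_image \<gamma> \<Longrightarrow> x \<in> S \<Longrightarrow> norm (R z x) \<le> M * norm x"
    by (rule R_bound) (rule that)
  obtain V where V: "variation_bound \<gamma> V" by (rule rectifiable_variation_bound[OF rectifiable])
  let ?a = "norm (- (1 / (2 * complex_of_real pi * \<i>)))"
  have "norm (E x) \<le> (?a * ((V 1 - V 0) * M) + 1) * norm x" if x: "x \<in> S" for x
  proof -
    have "norm (line_integral \<gamma> (\<lambda>z. R z x)) \<le> (V 1 - V 0) * (M * norm x)"
      by (rule norm_line_integral_le[OF path rectifiable R_continuous[OF x] V]) (simp add: M(2) x)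
    then have "norm (E x) \<le> ?a * ((V 1 - V 0) * (M * norm x))"
      unfolding E_eq norm_scaleC by (intro mult_left_mono) auto
    then show ?thesis
      using norm_ge_zero[of x] by (simp only: distrib_right mult_1 mult.assoc)
  qed
  moreover have "0 < ?a * ((V 1 - V 0) * M) + 1"
    using M(1) variation_bound_nonneg[OF V] by (intro add_nonneg_pos mult_nonneg_nonneg) auto
  ultimately show ?thesis using that by blast
qed

text \<open>The constant is chosen before x, \<mu> and d: the bound depends on \<mu> only through
  its distance to the curve. This uniformity lets \<mu> vary with n later.\<close>

lemma E_almost_fixes:
  obtains C where "0 < C"
    "\<And>x \<mu> d. x \<in> S \<Longrightarrow> winding_number \<gamma> \<mu> = 1 \<Longrightarrow> 0 < d \<Longrightarrow>
      \<forall>z\<in>path_image \<gamma>. d \<le> norm (z - \<mu>) \<Longrightarrow>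
      norm (x - E x) \<le> C / d * norm (T x - \<mu> *\<^sub>C x)"
proof -
  obtain M where M: "0 < M" "\<And>z x. z \<in> path_image \<gamma> \<Longrightarrow> x \<in> S \<Longrightarrow> norm (R z x) \<le> M * norm x"
    by (rule R_bound) (rule that)
  obtain V where V: "variation_bound \<gamma> V" by (rule rectifiable_variation_bound[OF rectifiable])
  let ?b = "1 / (2 * complex_of_real pi * \<i>)"
  show ?thesis
  proof (rule that[of "norm ?b * ((V 1 - V 0) * M) + 1"])
    show "0 < norm ?b * ((V 1 - V 0) * M) + 1"
      using M(1) variation_bound_nonneg[OF V] by (intro add_nonneg_pos mult_nonneg_nonneg) auto
    fix x \<mu> d
    assume x: "x \<in> S" and wn: "winding_number \<gamma> \<mu> = 1" and d: "0 < d"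
      and "\<forall>z\<in>path_image \<gamma>. d \<le> norm (z - \<mu>)"
    then have far: "\<And>z. z \<in> path_image \<gamma> \<Longrightarrow> d \<le> norm (z - \<mu>)"
      by blast
    define y where "y = T x - \<mu> *\<^sub>C x"
    have y: "y \<in> S" using x by (simp add: y_def S_closed)
    have \<mu>: "\<mu> \<notin> path_image \<gamma>" using far[of \<mu>] d by auto
    have R: "R z x = (1 / (z - \<mu>)) *\<^sub>C R z y + (1 / (z - \<mu>)) *\<^sub>C ((-1) *\<^sub>C x)" if z: "z \<in> path_image \<gamma>" for z
    proof -
      have "T x - z *\<^sub>C x = y + (-(z - \<mu>)) *\<^sub>C x"
        by (simp add: y_def scaleC.diff_left)
      then have "x = R z y + (-(z - \<mu>)) *\<^sub>C R z x"
        using R_left[OF z x] R_add[OF z y, of "(-(z - \<mu>)) *\<^sub>C x"] R_scale[OF z x] S_closed(3)[OF x]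
        by (metis)
      then have "R z y + (-1) *\<^sub>C x = (z - \<mu>) *\<^sub>C R z x"
        by (simp add: scaleC.minus_left algebra_simps)
      moreover have "z \<noteq> \<mu>" using z \<mu> by auto
      ultimately have "R z x = (1 / (z - \<mu>)) *\<^sub>C (R z y + (-1) *\<^sub>C x)"
        by simp
      then show ?thesis by (simp only: scaleC.add_right)
    qed
    have c1: "continuous_on (path_image \<gamma>) (\<lambda>z. (1 / (z - \<mu>)) *\<^sub>C R z y)"
      using \<mu> by (intro scaleC.continuous_on R_continuous[OF y] continuous_intros) auto
    have c2: "continuous_on (path_image \<gamma>) (\<lambda>z. (1 / (z - \<mu>)) *\<^sub>C (-1) *\<^sub>C x)"
      using \<mu> by (intro scaleC.continuous_on continuous_intros) auto
    have "line_integral \<gamma> (\<lambda>z. R z x)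
        = line_integral \<gamma> (\<lambda>z. (1 / (z - \<mu>)) *\<^sub>C R z y + (1 / (z - \<mu>)) *\<^sub>C (-1) *\<^sub>C x)"
      by (rule line_integral_cong[OF path rectifiable R_continuous[OF x] R])
    \<comment> \<open>Winding number 1 turns the second integral into -2 pi i x, and the factor in
      front of the contour integral turns that into x.\<close>
    also have "\<dots> = line_integral \<gamma> (\<lambda>z. (1 / (z - \<mu>)) *\<^sub>C R z y) + (2 * of_real pi * \<i>) *\<^sub>C ((-1) *\<^sub>C x)"
      unfolding line_integral_add[OF path rectifiable c1 c2]
        line_integral_winding_number[OF path rectifiable \<mu>] wn by simp
    finally have "E x = (- ?b) *\<^sub>C line_integral \<gamma> (\<lambda>z. (1 / (z - \<mu>)) *\<^sub>C R z y) + x"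
      unfolding E_eq by (simp add: scaleC.diff_right)
    then have "norm (x - E x) = norm ?b * norm (line_integral \<gamma> (\<lambda>z. (1 / (z - \<mu>)) *\<^sub>C R z y))"
      by (simp add: norm_scaleC scaleC.minus_left)
    also have "\<dots> \<le> norm ?b * ((V 1 - V 0) * (1 / d * (M * norm y)))"
    proof (intro mult_left_mono norm_line_integral_le[OF path rectifiable c1 V])
      fix z assume z: "z \<in> path_image \<gamma>"
      have "norm (1 / (z - \<mu>)) \<le> 1 / d"
        using far[OF z] d by (simp add: norm_divide frac_le)
      then show "norm ((1 / (z - \<mu>)) *\<^sub>C R z y) \<le> 1 / d * (M * norm y)"
        unfolding norm_scaleC using M(2)[OF z y] d by (intro mult_mono) auto
    qed simp
    also have "\<dots> = norm ?b * ((V 1 - V 0) * M) / d * norm y"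
      by simp
    also have "\<dots> \<le> (norm ?b * ((V 1 - V 0) * M) + 1) / d * norm y"
      using d by (intro mult_right_mono divide_right_mono) auto
    finally show "norm (x - E x) \<le> (norm ?b * ((V 1 - V 0) * M) + 1) / d * norm (T x - \<mu> *\<^sub>C x)"
      by (simp add: y_def)
  qed
qed

section \<open>Eigenvectors and the range of the spectral projection\<close>

lemma separated_from_curve:
  assumes "\<mu> \<notin> path_image \<gamma>"
  obtains d where "0 < d" "\<And>z. z \<in> path_image \<gamma> \<Longrightarrow> d \<le> norm (z - \<mu>)"
proof -
  obtain d where "0 < d" "\<And>z. z \<in> path_image \<gamma> \<Longrightarrow> d \<le> dist \<mu> z"
    using separate_point_closed[OF closed_path_image[OF path] assms] by blast
  then show ?thesis
    by (intro that[of d]) (simp_all add: dist_norm norm_minus_commute)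
qed

text \<open>The case of residual 0 in \<open>E_almost_fixes\<close>.\<close>

lemma E_eigenvector:
  assumes "x \<in> S" "T x = \<mu> *\<^sub>C x" "\<mu> \<notin> path_image \<gamma>" "winding_number \<gamma> \<mu> = 1"
  shows "E x = x"
proof -
  obtain d where d: "0 < d" "\<And>z. z \<in> path_image \<gamma> \<Longrightarrow> d \<le> norm (z - \<mu>)"
    by (rule separated_from_curve[OF assms(3)]) (rule that)
  have "\<forall>z\<in>path_image \<gamma>. d \<le> norm (z - \<mu>)"
    using d(2) by blast
  then have "\<exists>C. norm (x - E x) \<le> C / d * norm (T x - \<mu> *\<^sub>C x)"
    using E_almost_fixes assms(1,4) d(1) by metis
  then show ?thesis by (simp add: assms(2))
qed

text \<open>The range of \<open>E\<close> is spanned by one vector v, and T v is again in the range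
  because \<open>E\<close> commutes with T. So T acts on the range as a scalar k. The eigenvector e
  is its own projection and hence lies in the range, which forces k = \<mu>.\<close>

lemma simple_eigenvalue_range:
  assumes simple: "simple_eigenvalue S T \<gamma> \<mu>"
    and \<mu>: "\<mu> \<notin> path_image \<gamma>" "winding_number \<gamma> \<mu> = 1"
    and x: "x \<in> S"
  shows "T (E x) = \<mu> *\<^sub>C E x"
proof -
  have "linf.dim (E ` S) = 1" "eigenvalue S T \<mu>"
    using simple by (auto simp: simple_eigenvalue_def)
  then obtain B e where B: "B \<subseteq> E ` S" "linf.independent B" "E ` S \<subseteq> linf.span B" "card B = 1"
    and e: "e \<in> S" "e \<noteq> 0" "T e = \<mu> *\<^sub>C e"
    using linf.basis_exists[of "E ` S"] by (metis eigenvalue_def)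
  obtain v where v: "B = {v}" using B(4) card_1_singletonE by blast
  have span: "\<exists>k. E x = k *\<^sub>C v" if "x \<in> S" for x
    using B(3) that unfolding v linf.span_singleton by blast
  obtain u where u: "u \<in> S" "v = E u" using B(1) v by auto
  obtain k where k: "T v = k *\<^sub>C v"
    using span[of "T u"] u by (auto simp: E_commutes maps)
  have T_E: "T (E x) = k *\<^sub>C E x" if "x \<in> S" for x
    using span[OF that] k by (auto simp: homogeneous mult.commute)
  have "\<mu> *\<^sub>C e = k *\<^sub>C e"
    using T_E[OF e(1)] E_eigenvector[OF e(1,3) \<mu>] e(3) by simp
  then have "k = \<mu>" using e(2) by simp
  then show ?thesis using T_E[OF x] by simp
qed

end

section \<open>The integral operator on essentially bounded functions\<close>

lemma ess_bdd_rep: "ess_bdd (rep_linf x)" and to_linf_rep: "to_linf (rep_linf x) = x"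
  using Quotient_rep_reflp[OF Quotient_linf, of x] Quotient_abs_rep[OF Quotient_linf, of x]
  by (simp_all add: linf_rel_def)

lemma norm_to_linf_le:
  assumes "ess_bdd f" "0 \<le> M" "AE t in unit_M. norm (f t) \<le> M"
  shows "norm (to_linf f) \<le> M"
  using assms by (simp add: norm_abs_linf ess_norm_le)

lemma to_linf_cong:
  assumes "ess_bdd f" "\<And>t. t \<in> {0..1} \<Longrightarrow> f t = g t"
  shows "to_linf f = to_linf g"
proof -
  have "g \<in> borel_measurable unit_M \<longleftrightarrow> f \<in> borel_measurable unit_M"
    by (rule measurable_cong) (simp add: assms(2))
  moreover have "AE t in unit_M. f t = g t"
    by (rule AE_I2) (simp add: assms(2))
  moreover have "AE t in unit_M. norm (g t) \<le> ess_norm f"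
    using ess_norm_AE[OF assms(1)] \<open>AE t in unit_M. f t = g t\<close> by eventually_elim simp
  ultimately have "linf_rel f g"
    using assms(1) unfolding linf_rel_def ess_bdd_def by blast
  then show ?thesis
    using Quotient_rel_abs[OF Quotient_linf] by blast
qed

lemma ess_bdd_continuous:
  assumes "continuous_on {0..1} f"
  shows "ess_bdd f"
proof -
  have "compact (f ` {0..1})"
    by (rule compact_continuous_image[OF assms]) simp
  then obtain M where "\<And>t. t \<in> {0..1} \<Longrightarrow> norm (f t) \<le> M"
    by (metis bounded_iff compact_imp_bounded imageI)
  then have "AE t in unit_M. norm (f t) \<le> M"
    by (intro AE_I2) simp
  then show ?thesis
    using continuous_imp_measurable_on_sets_lebesgue[OF assms] by (auto simp: ess_bdd_def)
qed

lemma ess_bdd_mult: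
  assumes "ess_bdd f" "ess_bdd g"
  shows "ess_bdd (\<lambda>t. f t * g t)"
proof -
  have "AE t in unit_M. norm (f t * g t) \<le> ess_norm f * ess_norm g"
    using ess_norm_AE[OF assms(1)] ess_norm_AE[OF assms(2)]
    by eventually_elim (simp add: norm_mult mult_mono' )
  then show ?thesis
    using assms by (auto simp: ess_bdd_def)
qed

text \<open>\<open>kernel_fun\<close> uses the gauge integral, while the bounds hold almost
  everywhere. The Lebesgue integral over the unit interval, of total measure 1, connects the
  two.\<close>

lemma ess_bdd_integral:
  assumes f: "ess_bdd f"
  shows "f integrable_on {0..1}"
    and "AE t in unit_M. norm (f t) \<le> M \<Longrightarrow> norm (integral {0..1} f) \<le> M"
proof -
  interpret finite_measure unit_M
    by (rule finite_measure_lebesgue_on) simp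
  have int: "integrable unit_M f"
    using f ess_norm_AE[OF f] by (intro integrable_const_bound[of f "ess_norm f"]) (simp_all add: ess_bdd_def)
  have has: "(f has_integral integral\<^sup>L unit_M f) {0..1}"
    by (rule has_integral_integral_lebesgue_on[OF int]) simp
  then show "f integrable_on {0..1}"
    by blast
  assume M: "AE t in unit_M. norm (f t) \<le> M"
  have "norm (integral\<^sup>L unit_M f) \<le> (\<integral>t. norm (f t) \<partial>unit_M)"
    by (rule integral_norm_bound)
  also have "\<dots> \<le> (\<integral>t. M \<partial>unit_M)"
    using M int by (intro integral_mono_AE) auto
  also have "\<dots> = M"
    by (simp add: measure_restrict_space)
  finally show "norm (integral {0..1} f) \<le> M"
    using integral_unique[OF has] by simp
qed

text \<open>Integration of x against the weight k. Taking \<open>kernel_fun\<close> of a kernel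
  constant in its first variable reuses its well-definedness on classes; the evaluation point 0 is
  arbitrary.\<close>

definition pairing :: "(real \<Rightarrow> real) \<Rightarrow> linf \<Rightarrow> complex"
  where "pairing k x = kernel_fun (\<lambda>_. k) x 0"

lemma kernel_fun_to_linf:
  "ess_bdd f \<Longrightarrow> kernel_fun \<kappa> (to_linf f) s = integral {0..1} (\<lambda>t. complex_of_real (\<kappa> s t) * f t)"
  by (simp add: kernel_fun.abs_eq linf_rel_def)

lemma pairing_to_linf:
  "ess_bdd f \<Longrightarrow> pairing k (to_linf f) = integral {0..1} (\<lambda>t. complex_of_real (k t) * f t)"
  by (simp add: pairing_def kernel_fun_to_linf)

lemma pairing_eq: "pairing k x = integral {0..1} (\<lambda>t. complex_of_real (k t) * rep_linf x t)"
  using pairing_to_linf[OF ess_bdd_rep, of k x] by (simp add: to_linf_rep)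

lemma kernel_fun_eq_pairing: "kernel_fun \<kappa> x s = pairing (\<kappa> s) x"
  using kernel_fun_to_linf[OF ess_bdd_rep, of \<kappa> x s] by (simp add: to_linf_rep pairing_eq)

lemma ess_bdd_of_real:
  "continuous_on {0..1} k \<Longrightarrow> ess_bdd (\<lambda>t. complex_of_real (k t))"
  by (intro ess_bdd_continuous continuous_on_of_real)

lemma pairing_integrable:
  "continuous_on {0..1} k \<Longrightarrow> (\<lambda>t. complex_of_real (k t) * rep_linf x t) integrable_on {0..1}"
  by (intro ess_bdd_integral ess_bdd_mult ess_bdd_of_real ess_bdd_rep)

lemma pairing_add_right:
  assumes "continuous_on {0..1} k"
  shows "pairing k (x + y) = pairing k x + pairing k y"
proof -
  have "x + y = to_linf (\<lambda>t. rep_linf x t + rep_linf y t)"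
    using plus_linf.abs_eq[of "rep_linf x" "rep_linf y"]
    by (simp add: to_linf_rep linf_rel_def ess_bdd_rep)
  then have "pairing k (x + y) = integral {0..1} (\<lambda>t. complex_of_real (k t) * (rep_linf x t + rep_linf y t))"
    by (simp only: pairing_to_linf ess_bdd_add ess_bdd_rep)
  then show ?thesis
    using integral_add[OF pairing_integrable[OF assms, of x] pairing_integrable[OF assms, of y]]
    by (simp add: pairing_eq[of k x] pairing_eq[of k y] distrib_left)
qed

lemma pairing_scale_right: "pairing k (c *\<^sub>C x) = c * pairing k x"
proof -
  have "c *\<^sub>C x = to_linf (\<lambda>t. c * rep_linf x t)"
    using scaleC.abs_eq[of "rep_linf x" c] by (simp add: to_linf_rep linf_rel_def ess_bdd_rep)
  then have "pairing k (c *\<^sub>C x) = integral {0..1} (\<lambda>t. complex_of_real (k t) * (c * rep_linf x t))"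
    by (simp only: pairing_to_linf ess_bdd_cmult ess_bdd_rep)
  then show ?thesis
    by (simp add: pairing_eq[of k x] mult.left_commute)
qed

lemma pairing_add_left:
  assumes "continuous_on {0..1} k" "continuous_on {0..1} l"
  shows "pairing (\<lambda>t. k t + l t) x = pairing k x + pairing l x"
  using integral_add[OF pairing_integrable[OF assms(1), of x] pairing_integrable[OF assms(2), of x]]
  by (simp add: pairing_eq distrib_right)

lemma pairing_scale_left: "pairing (\<lambda>t. a * k t) x = complex_of_real a * pairing k x"
  by (simp add: pairing_eq mult.assoc)

lemma pairing_diff_left:
  assumes "continuous_on {0..1} k" "continuous_on {0..1} l"
  shows "pairing (\<lambda>t. k t - l t) x = pairing k x - pairing l x"
  using integral_diff[OF pairing_integrable[OF assms(1), of x] pairing_integrable[OF assms(2), of x]]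
  by (simp add: pairing_eq left_diff_distrib)

lemma pairing_sum_left:
  assumes "finite I" "\<And>i. i \<in> I \<Longrightarrow> continuous_on {0..1} (k i)"
  shows "pairing (\<lambda>t. \<Sum>i\<in>I. k i t) x = (\<Sum>i\<in>I. pairing (k i) x)"
  using assms
proof (induction I rule: finite_induct)
  case empty
  then show ?case by (simp add: pairing_eq)
next
  case (insert i I)
  then show ?case
    using pairing_add_left[of "k i" "\<lambda>t. \<Sum>i\<in>I. k i t" x] by (simp add: continuous_on_sum)
qed

lemma norm_pairing_le:
  assumes k: "continuous_on {0..1} k" and B: "\<And>t. t \<in> {0..1} \<Longrightarrow> \<bar>k t\<bar> \<le> B"
  shows "norm (pairing k x) \<le> B * norm x"
proof -
  have B0: "0 \<le> B" using B[of 0] by simp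
  have "AE t in unit_M. t \<in> {0..1}" by (rule AE_I2) simp
  then have "AE t in unit_M. norm (complex_of_real (k t) * rep_linf x t) \<le> B * ess_norm (rep_linf x)"
    using ess_norm_AE[OF ess_bdd_rep[of x]]
    by eventually_elim (use B B0 in \<open>simp add: norm_mult mult_mono'\<close>)
  then have "norm (pairing k x) \<le> B * ess_norm (rep_linf x)"
    unfolding pairing_eq
    by (intro ess_bdd_integral ess_bdd_mult ess_bdd_of_real ess_bdd_rep k)
  then show ?thesis
    using norm_abs_linf[OF ess_bdd_rep, of x] by (simp add: to_linf_rep)
qed

lemma pairing_cong: "(\<And>t. t \<in> {0..1} \<Longrightarrow> k t = l t) \<Longrightarrow> pairing k x = pairing l x"
  unfolding pairing_eq by (intro integral_cong) simp

text \<open>\<open>D k\<close> is the partial derivative of order \<open>k\<close> of the kernel in its first variable.\<close>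

locale differentiable_kernel =
  fixes m :: nat and \<kappa> :: "real \<Rightarrow> real \<Rightarrow> real" and D :: "nat \<Rightarrow> real \<Rightarrow> real \<Rightarrow> real" and C :: real
  assumes D_0: "s \<in> {0..1} \<Longrightarrow> t \<in> {0..1} \<Longrightarrow> D 0 s t = \<kappa> s t"
    and D_deriv: "k \<le> m \<Longrightarrow> s \<in> {0..1} \<Longrightarrow> t \<in> {0..1} \<Longrightarrow>
      ((\<lambda>u. D k u t) has_real_derivative D (Suc k) s t) (at s within {0..1})"
    and D_cont: "k \<le> Suc m \<Longrightarrow> s \<in> {0..1} \<Longrightarrow> continuous_on {0..1} (D k s)"
    and D_bound: "k \<le> Suc m \<Longrightarrow> s \<in> {0..1} \<Longrightarrow> t \<in> {0..1} \<Longrightarrow> \<bar>D k s t\<bar> \<le> C"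
    and kernel_Lipschitz: "s \<in> {0..1} \<Longrightarrow> t \<in> {0..1} \<Longrightarrow> u \<in> {0..1} \<Longrightarrow> \<bar>\<kappa> s t - \<kappa> s u\<bar> \<le> C * \<bar>t - u\<bar>"

text \<open>The error analysis works with derivatives in s up to order \<open>Suc m\<close> and a
  Lipschitz bound in t. The latter is the mean value inequality applied with the derivative
  \<open>D 0 1\<close>.\<close>

lemma smooth_kernel_differentiable:
  assumes "smooth_kernel (Suc m) \<kappa>"
  obtains D C where "differentiable_kernel m \<kappa> D C"
  using assms unfolding smooth_kernel_def
proof (elim exE conjE)
  fix D :: "nat \<Rightarrow> nat \<Rightarrow> real \<Rightarrow> real \<Rightarrow> real" and C
  assume H: "\<forall>s\<in>{0..1}. \<forall>t\<in>{0..1}. D 0 0 s t = \<kappa> s t"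
    "\<forall>\<alpha> \<beta>. \<alpha> + \<beta> < Suc m \<longrightarrow> (\<forall>s\<in>{0..1}. \<forall>t\<in>{0..1}.
       ((\<lambda>u. D \<alpha> \<beta> u t) has_real_derivative D (Suc \<alpha>) \<beta> s t) (at s within {0..1}) \<and>
       ((\<lambda>u. D \<alpha> \<beta> s u) has_real_derivative D \<alpha> (Suc \<beta>) s t) (at t within {0..1}))"
    "\<forall>\<alpha> \<beta>. \<alpha> + \<beta> \<le> Suc m \<longrightarrow> continuous_on ({0..1} \<times> {0..1}) (\<lambda>(s, t). D \<alpha> \<beta> s t)"
    "\<forall>\<alpha> \<beta>. \<alpha> + \<beta> \<le> Suc (Suc m) \<longrightarrow> (\<forall>s\<in>{0..1}. \<forall>t\<in>{0..1}. \<bar>D \<alpha> \<beta> s t\<bar> \<le> C)"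
  have D:
    "\<And>s t. s \<in> {0..1} \<Longrightarrow> t \<in> {0..1} \<Longrightarrow> D 0 0 s t = \<kappa> s t"
    "\<And>\<alpha> \<beta> s t. \<alpha> + \<beta> < Suc m \<Longrightarrow> s \<in> {0..1} \<Longrightarrow> t \<in> {0..1} \<Longrightarrow>
       ((\<lambda>u. D \<alpha> \<beta> u t) has_real_derivative D (Suc \<alpha>) \<beta> s t) (at s within {0..1})"
    "\<And>\<alpha> \<beta> s t. \<alpha> + \<beta> < Suc m \<Longrightarrow> s \<in> {0..1} \<Longrightarrow> t \<in> {0..1} \<Longrightarrow>
       ((\<lambda>u. D \<alpha> \<beta> s u) has_real_derivative D \<alpha> (Suc \<beta>) s t) (at t within {0..1})"
    "\<And>\<alpha> \<beta>. \<alpha> + \<beta> \<le> Suc m \<Longrightarrow> continuous_on ({0..1} \<times> {0..1}) (\<lambda>(s, t). D \<alpha> \<beta> s t)"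
    "\<And>\<alpha> \<beta> s t. \<alpha> + \<beta> \<le> Suc (Suc m) \<Longrightarrow> s \<in> {0..1} \<Longrightarrow> t \<in> {0..1} \<Longrightarrow> \<bar>D \<alpha> \<beta> s t\<bar> \<le> C"
    by (simp_all only: H)
  have "differentiable_kernel m \<kappa> (\<lambda>k. D k 0) C"
  proof
    fix k :: nat and s t u :: real
    show "s \<in> {0..1} \<Longrightarrow> t \<in> {0..1} \<Longrightarrow> D 0 0 s t = \<kappa> s t"
      by (rule D(1))
    show "k \<le> m \<Longrightarrow> s \<in> {0..1} \<Longrightarrow> t \<in> {0..1} \<Longrightarrow>
      ((\<lambda>u. D k 0 u t) has_real_derivative D (Suc k) 0 s t) (at s within {0..1})"
      by (rule D(2)) simp_all
    show "continuous_on {0..1} (D k 0 s)" if "k \<le> Suc m" "s \<in> {0..1}"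
    proof -
      have "continuous_on {0..1} ((\<lambda>(s, t). D k 0 s t) \<circ> (\<lambda>t. (s, t)))"
        by (intro continuous_on_compose continuous_intros continuous_on_subset[OF D(4)]) (use that in auto)
      then show ?thesis by (simp add: comp_def)
    qed
    show "k \<le> Suc m \<Longrightarrow> s \<in> {0..1} \<Longrightarrow> t \<in> {0..1} \<Longrightarrow> \<bar>D k 0 s t\<bar> \<le> C"
      by (rule D(5)) simp_all
    assume stu: "s \<in> {0..1}" "t \<in> {0..1}" "u \<in> {0..1}"
    have "norm (D 0 0 s t - D 0 0 s u) \<le> C * norm (t - u)"
    proof (rule field_differentiable_bound[where S = "{0..1}" and f' = "D 0 1 s"])
      show "convex {0..1::real}" by simp
      show "((D 0 0 s) has_field_derivative D 0 1 s z) (at z within {0..1})" if "z \<in> {0..1}" for z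
        using D(3)[of 0 0 s z] stu(1) that by simp
      show "norm (D 0 1 s z) \<le> C" if "z \<in> {0..1}" for z
        using D(5)[of 0 1 s z] stu(1) that by simp
    qed (use stu in auto)
    then show "\<bar>\<kappa> s t - \<kappa> s u\<bar> \<le> C * \<bar>t - u\<bar>"
      using D(1) stu by simp
  qed
  then show ?thesis by (rule that)
qed

context differentiable_kernel
begin

section \<open>Smoothing properties of the integral operator\<close>

lemma C_nonneg: "0 \<le> C"
  using D_bound[of 0 0 0] by auto

lemma kernel_fun_eq: "s \<in> {0..1} \<Longrightarrow> kernel_fun \<kappa> x s = pairing (D 0 s) x"
  unfolding kernel_fun_eq_pairing by (rule pairing_cong) (simp add: D_0)

text \<open>The kernel is expanded in s for each fixed t, and the expansion is then paired with x.
  This avoids differentiation under the integral sign, and the remainder is bounded uniformly in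
  t.\<close>

lemma kernel_fun_Taylor:
  assumes s: "s \<in> {0..1}" and c: "c \<in> {0..1}"
  shows "norm (kernel_fun \<kappa> x s - (\<Sum>i\<le>m. pairing (D i c) x / fact i * complex_of_real (s - c) ^ i))
    \<le> C * norm x * \<bar>s - c\<bar> ^ Suc m"
proof -
  have cont: "continuous_on {0..1} (\<lambda>t. (s - c) ^ i / fact i * D i c t)" if "i \<le> m" for i
    using that c by (intro continuous_intros D_cont) auto
  have sum_eq: "pairing (\<lambda>t. \<Sum>i\<le>m. (s - c) ^ i / fact i * D i c t) x
      = (\<Sum>i\<le>m. pairing (D i c) x / fact i * complex_of_real (s - c) ^ i)"
  proof -
    have "pairing (\<lambda>t. \<Sum>i\<le>m. (s - c) ^ i / fact i * D i c t) x
        = (\<Sum>i\<le>m. pairing (\<lambda>t. (s - c) ^ i / fact i * D i c t) x)"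
      using cont by (intro pairing_sum_left) auto
    also have "\<dots> = (\<Sum>i\<le>m. complex_of_real ((s - c) ^ i / fact i) * pairing (D i c) x)"
      by (simp only: pairing_scale_left)
    finally show ?thesis
      by (simp add: mult.commute)
  qed
  have "norm (pairing (\<lambda>t. D 0 s t - (\<Sum>i\<le>m. (s - c) ^ i / fact i * D i c t)) x)
      \<le> C * \<bar>s - c\<bar> ^ Suc m * norm x"
  proof (rule norm_pairing_le)
    show "continuous_on {0..1} (\<lambda>t. D 0 s t - (\<Sum>i\<le>m. (s - c) ^ i / fact i * D i c t))"
      using cont s by (intro continuous_on_diff continuous_on_sum D_cont) auto
    fix t :: real assume t: "t \<in> {0..1}"
    have "norm (D 0 s t - (\<Sum>i\<le>m. D i c t * (s - c) ^ i / fact i)) \<le> C * norm (s - c) ^ Suc m / fact m"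
      by (rule field_Taylor[where S = "{0..1}" and f = "\<lambda>i s. D i s t"])
        (use D_deriv D_bound s c t in auto)
    also have "\<dots> \<le> C * norm (s - c) ^ Suc m / 1"
      using C_nonneg by (intro divide_left_mono mult_nonneg_nonneg) (auto simp: fact_ge_1)
    finally show "\<bar>D 0 s t - (\<Sum>i\<le>m. (s - c) ^ i / fact i * D i c t)\<bar> \<le> C * \<bar>s - c\<bar> ^ Suc m"
      by (simp add: mult.commute)
  qed
  moreover have "pairing (\<lambda>t. D 0 s t - (\<Sum>i\<le>m. (s - c) ^ i / fact i * D i c t)) x
      = pairing (D 0 s) x - pairing (\<lambda>t. \<Sum>i\<le>m. (s - c) ^ i / fact i * D i c t) x"
    using cont s by (intro pairing_diff_left continuous_on_sum D_cont) auto
  ultimately show ?thesis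
    unfolding kernel_fun_eq[OF s] sum_eq[symmetric] by (simp only: mult_ac)
qed

lemma kernel_cont: "s \<in> {0..1} \<Longrightarrow> continuous_on {0..1} (\<kappa> s)"
proof -
  assume s: "s \<in> {0..1}"
  have "continuous_on {0..1} (D 0 s) \<longleftrightarrow> continuous_on {0..1} (\<kappa> s)"
    by (rule continuous_on_cong) (use D_0 s in auto)
  then show ?thesis using D_cont[of 0 s] s by simp
qed

lemma kernel_bound: "s \<in> {0..1} \<Longrightarrow> t \<in> {0..1} \<Longrightarrow> \<bar>\<kappa> s t\<bar> \<le> C"
  using D_bound[of 0 s t] by (simp add: D_0)

lemma norm_kernel_fun_le: "s \<in> {0..1} \<Longrightarrow> norm (kernel_fun \<kappa> x s) \<le> C * norm x"
  unfolding kernel_fun_eq_pairing by (rule norm_pairing_le[OF kernel_cont]) (auto simp: kernel_bound)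

text \<open>The image is Lipschitz even if x is only essentially bounded; this is why point values
  of K x at the nodes make sense for discontinuous x.\<close>

lemma kernel_fun_cont: "continuous_on {0..1} (kernel_fun \<kappa> x)"
proof -
  have "dist (kernel_fun \<kappa> x s) (kernel_fun \<kappa> x u) \<le> (C * norm x) * dist s u"
    if s: "s \<in> {0..1}" and u: "u \<in> {0..1}" for s u
  proof -
    have "norm (pairing (\<lambda>t. D 0 s t - D 0 u t) x) \<le> (C * \<bar>s - u\<bar>) * norm x"
    proof (rule norm_pairing_le)
      show "continuous_on {0..1} (\<lambda>t. D 0 s t - D 0 u t)"
        using s u by (intro continuous_on_diff D_cont) auto
      fix t :: real assume t: "t \<in> {0..1}"
      have "norm (D 0 s t - D 0 u t) \<le> C * norm (s - u)"
        by (rule field_differentiable_bound[where S = "{0..1}" and f = "\<lambda>s. D 0 s t" and f' = "\<lambda>s. D 1 s t"])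
          (use D_deriv[of 0] D_bound[of 1] s u t in auto)
      then show "\<bar>D 0 s t - D 0 u t\<bar> \<le> C * \<bar>s - u\<bar>" by simp
    qed
    then show ?thesis
      using s u D_cont[of 0] by (simp add: pairing_diff_left kernel_fun_eq dist_norm mult_ac)
  qed
  then have "(C * norm x)-lipschitz_on {0..1} (kernel_fun \<kappa> x)"
    using C_nonneg by (intro lipschitz_onI) auto
  then show ?thesis by (rule lipschitz_on_continuous_on)
qed

lemma ess_bdd_kernel_fun: "ess_bdd (kernel_fun \<kappa> x)"
  by (rule ess_bdd_continuous[OF kernel_fun_cont])

lemma fredholm_in_C01: "fredholm \<kappa> x \<in> C01"
  unfolding C01_def fredholm_def using kernel_fun_cont by blast

lemma fredholm_add: "fredholm \<kappa> (x + y) = fredholm \<kappa> x + fredholm \<kappa> y"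
proof -
  have "fredholm \<kappa> x + fredholm \<kappa> y = to_linf (\<lambda>s. kernel_fun \<kappa> x s + kernel_fun \<kappa> y s)"
    unfolding fredholm_def by (rule plus_linf.abs_eq) (simp_all add: linf_rel_def ess_bdd_kernel_fun)
  also have "\<dots> = fredholm \<kappa> (x + y)"
    unfolding fredholm_def
    by (rule to_linf_cong[OF ess_bdd_add[OF ess_bdd_kernel_fun ess_bdd_kernel_fun]])
      (simp add: kernel_fun_eq_pairing pairing_add_right kernel_cont)
  finally show ?thesis by simp
qed

lemma fredholm_scale: "fredholm \<kappa> (c *\<^sub>C x) = c *\<^sub>C fredholm \<kappa> x"
proof -
  have "c *\<^sub>C fredholm \<kappa> x = to_linf (\<lambda>s. c * kernel_fun \<kappa> x s)"
    unfolding fredholm_def by (rule scaleC.abs_eq) (simp add: linf_rel_def ess_bdd_kernel_fun)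
  then show ?thesis
    by (simp add: fredholm_def kernel_fun_eq_pairing[abs_def] pairing_scale_right)
qed

lemma norm_fredholm_le: "norm (fredholm \<kappa> x) \<le> C * norm x"
  unfolding fredholm_def
proof (rule norm_to_linf_le[OF ess_bdd_kernel_fun])
  show "AE t in unit_M. norm (kernel_fun \<kappa> x t) \<le> C * norm x"
    by (rule AE_I2) (simp add: norm_kernel_fun_le)
qed (simp add: C_nonneg)

lemma bounded_linear_fredholm: "bounded_linear (fredholm \<kappa>)"
proof (rule bounded_linear_intro[where K = C])
  show "fredholm \<kappa> (r *\<^sub>R x) = r *\<^sub>R fredholm \<kappa> x" for r x
    by (simp add: scaleR_linf_def fredholm_scale)
qed (simp_all add: fredholm_add norm_fredholm_le mult.commute)

end

lemma subspace_C01: "linf.subspace C01"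
proof (rule linf.subspaceI)
  show "0 \<in> C01"
    unfolding C01_def zero_linf_def by (rule image_eqI[of _ _ "\<lambda>t. 0"]) auto
  fix x y c assume "x \<in> C01"
  then obtain f where f: "continuous_on {0..1} f" "x = to_linf f" by (auto simp: C01_def)
  have "c *\<^sub>C x = to_linf (\<lambda>t. c * f t)"
    unfolding f(2) by (rule scaleC.abs_eq) (simp add: linf_rel_def ess_bdd_continuous f)
  moreover have "continuous_on {0..1} (\<lambda>t. c * f t)" by (intro continuous_intros f)
  ultimately show "c *\<^sub>C x \<in> C01"
    unfolding C01_def by blast
  assume "y \<in> C01"
  then obtain g where g: "continuous_on {0..1} g" "y = to_linf g" by (auto simp: C01_def)
  have "x + y = to_linf (\<lambda>t. f t + g t)"
    unfolding f(2) g(2) by (rule plus_linf.abs_eq) (simp_all add: linf_rel_def ess_bdd_continuous f g)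
  moreover have "continuous_on {0..1} (\<lambda>t. f t + g t)" by (intro continuous_intros f g)
  ultimately show "x + y \<in> C01"
    unfolding C01_def by blast
qed

section \<open>Piecewise polynomial interpolation\<close>

definition lagrange_poly :: "nat \<Rightarrow> (nat \<Rightarrow> complex) \<Rightarrow> (nat \<Rightarrow> complex) \<Rightarrow> complex poly"
  where "lagrange_poly N a y =
    (\<Sum>i\<le>N. smult (y i / (\<Prod>k\<in>{..N}-{i}. a i - a k)) (\<Prod>k\<in>{..N}-{i}. [:- a k, 1:]))"

lemma poly_lagrange_poly:
  "poly (lagrange_poly N a y) s = (\<Sum>i\<le>N. y i * (\<Prod>k\<in>{..N}-{i}. (s - a k) / (a i - a k)))"
  by (simp add: lagrange_poly_def poly_sum poly_prod prod_dividef)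

lemma degree_lagrange_poly: "degree (lagrange_poly N a y) \<le> N"
  unfolding lagrange_poly_def
proof (rule degree_sum_le)
  fix i assume i: "i \<in> {..N}"
  have "degree (\<Prod>k\<in>{..N}-{i}. [:- a k, 1:]) \<le> (\<Sum>k\<in>{..N}-{i}. degree [:- a k, 1:])"
    using degree_prod_sum_le[of "{..N}-{i}" "\<lambda>k. [:- a k, 1:]"] by (simp add: comp_def)
  also have "\<dots> = N"
    using i by simp
  finally show "degree (smult (y i / (\<Prod>k\<in>{..N}-{i}. a i - a k)) (\<Prod>k\<in>{..N}-{i}. [:- a k, 1:])) \<le> N"
    using degree_smult_le order_trans by blast
qed simp

lemma poly_lagrange_poly_node:
  assumes "inj_on a {..N}" "i \<le> N"
  shows "poly (lagrange_poly N a y) (a i) = y i"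
proof -
  have "(\<Prod>k\<in>{..N}-{l}. (a i - a k) / (a l - a k)) = (if l = i then 1 else 0)" if l: "l \<le> N" for l
  proof (cases "l = i")
    case True
    have "(a i - a k) / (a i - a k) = 1" if "k \<in> {..N}-{i}" for k
      using inj_onD[OF assms(1), of i k] assms(2) that by auto
    then show ?thesis using True by simp
  next
    case False
    then have "i \<in> {..N}-{l}" "(a i - a i) / (a l - a i) = 0" using assms(2) by auto
    then have "(\<Prod>k\<in>{..N}-{l}. (a i - a k) / (a l - a k)) = 0"
      by (meson finite_Diff finite_atMost prod_zero)
    then show ?thesis using False by simp
  qed
  then have "poly (lagrange_poly N a y) (a i) = (\<Sum>l\<le>N. if l = i then y l else 0)"
    unfolding poly_lagrange_poly by (intro sum.cong) auto
  then show ?thesis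
    using assms(2) by simp
qed

lemma interpolation_unique:
  fixes p q :: "complex poly"
  assumes "inj_on a {..N}" "degree p \<le> N" "degree q \<le> N"
    and "\<And>i. i \<le> N \<Longrightarrow> poly p (a i) = poly q (a i)"
  shows "p = q"
proof (rule poly_eqI_degree)
  show "poly p x = poly q x" if "x \<in> a ` {..N}" for x
    using that assms(4) by auto
qed (use assms(2,3) card_image[OF assms(1)] in simp_all)

text \<open>Each factor of a cardinal polynomial is at most h / (h / d) = d. The scale h cancels, so
  the bound is the same for all panel widths.\<close>

lemma norm_lagrange_poly_le:
  assumes near: "\<And>k. k \<le> N \<Longrightarrow> norm (s - a k) \<le> h"
    and apart: "\<And>i k. i \<le> N \<Longrightarrow> k \<le> N \<Longrightarrow> i \<noteq> k \<Longrightarrow> h / d \<le> norm (a i - a k)"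
    and B: "\<And>i. i \<le> N \<Longrightarrow> norm (y i) \<le> B" and h: "0 < h" and d: "0 < d"
  shows "norm (poly (lagrange_poly N a y) s) \<le> real (Suc N) * d ^ N * B"
proof -
  have "norm (poly (lagrange_poly N a y) s) \<le> (\<Sum>i\<le>N. B * d ^ N)"
    unfolding poly_lagrange_poly
  proof (rule sum_norm_le)
    fix i assume "i \<in> {..N}"
    then have i: "i \<le> N" by simp
    have "norm (\<Prod>k\<in>{..N}-{i}. (s - a k) / (a i - a k)) = (\<Prod>k\<in>{..N}-{i}. norm ((s - a k) / (a i - a k)))"
      by (rule prod_norm[symmetric])
    also have "\<dots> \<le> (\<Prod>k\<in>{..N}-{i}. d)"
    proof (rule prod_mono, rule conjI)
      fix k assume k: "k \<in> {..N}-{i}"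
      have "norm ((s - a k) / (a i - a k)) \<le> h / (h / d)"
        unfolding norm_divide using near[of k] apart[of i k] k i h d by (intro frac_le) auto
      then show "norm ((s - a k) / (a i - a k)) \<le> d"
        using h by simp
    qed simp
    also have "\<dots> = d ^ N"
      using i by simp
    finally show "norm (y i * (\<Prod>k\<in>{..N}-{i}. (s - a k) / (a i - a k))) \<le> B * d ^ N"
      unfolding norm_mult using order_trans[OF norm_ge_zero B[OF i]] by (intro mult_mono B i) auto
  qed
  then show ?thesis by (simp add: mult_ac)
qed

lemma degree_diff_monic:
  fixes p q :: "complex poly"
  assumes "degree p = Suc N" "degree q = Suc N" "lead_coeff p = 1" "lead_coeff q = 1"
  shows "degree (p - q) \<le> N"
proof (rule degree_le, intro allI impI)
  fix i assume "N < i"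
  then consider "i = Suc N" | "Suc N < i" by linarith
  then show "coeff (p - q) i = 0"
    using assms by cases (simp_all add: coeff_eq_0)
qed

section \<open>Geometry of panels and nodes\<close>

definition midpoint_of :: "nat \<Rightarrow> nat \<Rightarrow> real"
  where "midpoint_of n j = (real j - 1 / 2) / real n"

text \<open>The position of a node relative to the midpoint, in units of the panel width. Symmetry
  and separation are thereby settled on one reference panel, and r = 0 fits the same formula
  \<open>node_eq\<close>.\<close>

definition node_offset :: "nat \<Rightarrow> nat \<Rightarrow> real"
  where "node_offset r i = (if r = 0 then 0 else real i / (2 * real r) - 1 / 2)"

lemma node_eq: "node r n j i = midpoint_of n j + node_offset r i / real n"
  by (simp add: node_def midpoint_of_def node_offset_def add_divide_distrib diff_divide_distrib)

lemma node_offset_bound: "i \<le> 2 * r \<Longrightarrow> \<bar>node_offset r i\<bar> \<le> 1 / 2"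
proof (cases "r = 0")
  case False
  assume "i \<le> 2 * r"
  then have "real i / (2 * real r) \<le> 1"
    using False by (simp add: divide_le_eq_1)
  moreover have "0 \<le> real i / (2 * real r)"
    by simp
  ultimately have "\<bar>real i / (2 * real r) - 1 / 2\<bar> \<le> 1 / 2"
    by linarith
  then show ?thesis
    using False unfolding node_offset_def by simp
qed (simp add: node_offset_def)

lemma node_offset_reflect: "i \<le> 2 * r \<Longrightarrow> node_offset r (2 * r - i) = - node_offset r i"
  unfolding node_offset_def by (simp add: of_nat_diff diff_divide_distrib)

text \<open>Neighbouring offsets differ by 1 / (2 r). The weaker denominator 2 r + 1 is positive for
  r = 0 too, as \<open>norm_lagrange_poly_le\<close> demands of its constant d.\<close>

lemma node_offset_apart:
  assumes "i \<le> 2 * r" "k \<le> 2 * r" "i \<noteq> k"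
  shows "1 / real (2 * r + 1) \<le> \<bar>node_offset r i - node_offset r k\<bar>"
proof -
  have r: "0 < r" using assms by auto
  have "1 \<le> \<bar>real i - real k\<bar>" using assms(3) by linarith
  then have "1 / (2 * real r) \<le> \<bar>real i - real k\<bar> / (2 * real r)"
    by (intro divide_right_mono) auto
  also have "\<dots> = \<bar>node_offset r i - node_offset r k\<bar>"
    using r by (simp add: node_offset_def diff_divide_distrib[symmetric] abs_divide)
  finally show ?thesis
    using r order_trans[OF divide_left_mono[of "2 * real r" "real (2 * r + 1)" 1]] by simp
qed

definition panel :: "nat \<Rightarrow> nat \<Rightarrow> real set"
  where "panel n j = {(real j - 1) / real n..real j / real n}"

lemma panel_eq: "panel n j = {midpoint_of n j - 1 / (2 * real n)..midpoint_of n j + 1 / (2 * real n)}"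
  by (simp add: panel_def midpoint_of_def diff_divide_distrib)

lemma panel_subset: "j \<in> {1..n} \<Longrightarrow> panel n j \<subseteq> {0..1}"
proof -
  assume j: "j \<in> {1..n}"
  then have "0 \<le> (real j - 1) / real n" "real j / real n \<le> 1"
    by auto
  then show ?thesis
    unfolding panel_def by auto
qed

lemma midpoint_in_panel: "0 < n \<Longrightarrow> midpoint_of n j \<in> panel n j"
  by (simp add: panel_eq)

lemma node_in_panel: "i \<le> 2 * r \<Longrightarrow> node r n j i \<in> panel n j"
proof -
  assume "i \<le> 2 * r"
  then have "\<bar>node_offset r i\<bar> / real n \<le> 1 / 2 / real n"
    by (intro divide_right_mono node_offset_bound) auto
  then have "\<bar>node_offset r i / real n\<bar> \<le> 1 / (2 * real n)"
    by simp
  then show ?thesis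
    unfolding panel_eq node_eq atLeastAtMost_iff by linarith
qed

lemma panel_dist: "s \<in> panel n j \<Longrightarrow> t \<in> panel n j \<Longrightarrow> \<bar>s - t\<bar> \<le> 1 / real n"
  by (simp add: panel_eq abs_le_iff)

lemma nodes_apart:
  assumes "0 < n" "i \<le> 2 * r" "k \<le> 2 * r" "i \<noteq> k"
  shows "(1 / real n) / real (2 * r + 1) \<le> \<bar>node r n j i - node r n j k\<bar>"
proof -
  have "1 / real (2 * r + 1) / real n \<le> \<bar>node_offset r i - node_offset r k\<bar> / real n"
    using node_offset_apart[OF assms(2-4)] by (intro divide_right_mono) auto
  also have "\<dots> = \<bar>node r n j i - node r n j k\<bar>"
    using assms(1) by (simp add: node_eq diff_divide_distrib[symmetric] abs_divide)
  finally show ?thesis by (simp add: mult.commute)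
qed

lemma nodes_inj: "0 < n \<Longrightarrow> inj_on (\<lambda>i. complex_of_real (node r n j i)) {..2 * r}"
proof (rule inj_onI, rule ccontr)
  fix i k assume n: "0 < n" and ik: "i \<in> {..2 * r}" "k \<in> {..2 * r}" "i \<noteq> k"
    "complex_of_real (node r n j i) = complex_of_real (node r n j k)"
  then have "(1 / real n) / real (2 * r + 1) \<le> 0"
    using nodes_apart[OF n, of i r k j] by simp
  moreover have "0 < (1 / real n) / real (2 * r + 1)"
    using n by simp
  ultimately show False by linarith
qed

section \<open>Interpolation on one panel\<close>

lemma interp_poly_eqI:
  assumes "0 < n" "degree p \<le> 2 * r"
    "\<And>i. i \<le> 2 * r \<Longrightarrow> poly p (complex_of_real (node r n j i)) = x (node r n j i)"
  shows "interp_poly r n j x = p"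
  unfolding interp_poly_def
proof (rule the_equality)
  fix q assume "degree q \<le> 2 * r \<and> (\<forall>i\<le>2 * r. poly q (complex_of_real (node r n j i)) = x (node r n j i))"
  then show "q = p"
    using assms by (intro interpolation_unique[OF nodes_inj[OF assms(1), of r j]]) auto
qed (use assms in auto)

lemma interp_poly_lagrange:
  "0 < n \<Longrightarrow> interp_poly r n j x =
    lagrange_poly (2 * r) (\<lambda>i. complex_of_real (node r n j i)) (\<lambda>i. x (node r n j i))"
  by (intro interp_poly_eqI degree_lagrange_poly poly_lagrange_poly_node nodes_inj)

text \<open>An upper bound for the Lebesgue constant of the nodes on a panel: 2 r + 1 cardinal
  polynomials, each a product of 2 r quotients of size at most 2 r + 1.\<close>

definition lebesgue_const :: "nat \<Rightarrow> real"
  where "lebesgue_const r = real (2 * r + 1) * real (2 * r + 1) ^ (2 * r)"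

lemma lebesgue_const_nonneg: "0 \<le> lebesgue_const r"
  by (simp add: lebesgue_const_def)

lemma norm_interp_poly_le:
  assumes n: "0 < n" and s: "s \<in> panel n j"
    and B: "\<And>t. t \<in> panel n j \<Longrightarrow> norm (x t) \<le> B"
  shows "norm (poly (interp_poly r n j x) (complex_of_real s)) \<le> lebesgue_const r * B"
proof -
  have "norm (poly (interp_poly r n j x) (complex_of_real s)) \<le> real (Suc (2 * r)) * real (2 * r + 1) ^ (2 * r) * B"
    unfolding interp_poly_lagrange[OF n]
  proof (rule norm_lagrange_poly_le[where h = "1 / real n"])
    show "norm (complex_of_real s - complex_of_real (node r n j k)) \<le> 1 / real n" if "k \<le> 2 * r" for k
      using panel_dist[OF s node_in_panel[OF that]] by (simp flip: of_real_diff)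
    show "1 / real n / real (2 * r + 1) \<le> norm (complex_of_real (node r n j i) - complex_of_real (node r n j k))"
      if "i \<le> 2 * r" "k \<le> 2 * r" "i \<noteq> k" for i k
      using nodes_apart[OF n that, of j] by (simp only: norm_of_real flip: of_real_diff)
  qed (use n B node_in_panel in auto)
  then show ?thesis by (simp add: lebesgue_const_def)
qed

section \<open>The nodal polynomial\<close>

definition nodal_poly :: "nat \<Rightarrow> nat \<Rightarrow> nat \<Rightarrow> complex poly"
  where "nodal_poly r n j = (\<Prod>i\<le>2 * r. [:- complex_of_real (node r n j i), 1:])"

lemma degree_nodal_poly: "degree (nodal_poly r n j) = Suc (2 * r)"
  unfolding nodal_poly_def by (subst degree_prod_eq_sum_degree) auto

lemma lead_coeff_nodal_poly: "lead_coeff (nodal_poly r n j) = 1"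
  unfolding nodal_poly_def lead_coeff_prod by simp

lemma poly_nodal_poly:
  "poly (nodal_poly r n j) (complex_of_real t) = complex_of_real (\<Prod>i\<le>2 * r. t - node r n j i)"
  by (simp add: nodal_poly_def poly_prod)

lemma norm_nodal_poly_le:
  assumes "t \<in> panel n j"
  shows "norm (poly (nodal_poly r n j) (complex_of_real t)) \<le> (1 / real n) ^ (2 * r + 1)"
proof -
  have "\<bar>\<Prod>i\<le>2 * r. t - node r n j i\<bar> \<le> (\<Prod>i\<le>2 * r. 1 / real n)"
    unfolding abs_prod using panel_dist[OF assms node_in_panel] by (intro prod_mono) auto
  then show ?thesis
    unfolding poly_nodal_poly norm_of_real by simp
qed

lemma prod_reflect: "(\<Prod>i\<le>N. f (N - i)) = (\<Prod>i\<le>N. f i)" for f :: "nat \<Rightarrow> real"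
  by (rule prod.reindex_bij_witness[of _ "\<lambda>i. N - i" "\<lambda>i. N - i"]) auto

lemma integral_odd:
  fixes g :: "real \<Rightarrow> complex"
  assumes "\<And>t. g (c - t) = - g (c + t)"
  shows "integral {c - d..c + d} g = 0"
proof -
  let ?G = "\<lambda>t. g (t + c)"
  have shift: "integral {c - d..c + d} g = integral {- d..d} ?G"
    using integral_shift_real_ivl[of "c - d" c "c + d" g] by simp
  have "integral {- d..d} ?G = integral {- d..d} (\<lambda>t. ?G (- t))"
    using Henstock_Kurzweil_Integration.integral_reflect_real[of d "-d" ?G] by simp
  also have "\<dots> = integral {- d..d} (\<lambda>t. - ?G t)"
    using assms by (simp add: add.commute)
  also have "\<dots> = - integral {- d..d} ?G"
    by (rule integral_neg)
  finally have "2 * integral {- d..d} ?G = 0"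
    by simp
  then show ?thesis using shift by simp
qed

text \<open>The nodes are symmetric about the midpoint and odd in number.\<close>

lemma integral_nodal_poly:
  "integral (panel n j) (\<lambda>t. poly (nodal_poly r n j) (complex_of_real t)) = 0"
  unfolding panel_eq
proof (rule integral_odd)
  fix t
  let ?c = "midpoint_of n j"
  have "(\<Prod>i\<le>2 * r. (?c - t) - node r n j i) = (\<Prod>i\<le>2 * r. - ((?c + t) - node r n j (2 * r - i)))"
    by (rule prod.cong) (simp_all add: node_eq node_offset_reflect)
  also have "\<dots> = (\<Prod>i\<le>2 * r. - ((?c + t) - node r n j i))"
    by (rule prod_reflect)
  also have "\<dots> = - (\<Prod>i\<le>2 * r. (?c + t) - node r n j i)"
    using prod_uminus[of "\<lambda>i. (?c + t) - node r n j i" "{..2 * r}"] by simp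
  finally show "poly (nodal_poly r n j) (complex_of_real (?c - t)) = - poly (nodal_poly r n j) (complex_of_real (?c + t))"
    unfolding poly_nodal_poly by simp
qed

section \<open>Splitting the unit interval into panels\<close>

lemma integral_panels:
  fixes g :: "real \<Rightarrow> complex"
  assumes g: "g integrable_on {0..1}" and n: "0 < n"
  shows "integral {0..1} g = (\<Sum>j\<in>{1..n}. integral (panel n j) g)"
proof -
  have "integral {0..real k / real n} g = (\<Sum>j\<in>{1..k}. integral (panel n j) g)" if "k \<le> n" for k
    using that
  proof (induction k)
    case (Suc k)
    have sub: "real (Suc k) / real n \<le> 1" using Suc.prems n by simp
    have "integral {0..real k / real n} g + integral {real k / real n..real (Suc k) / real n} g
        = integral {0..real (Suc k) / real n} g"
      by (rule Henstock_Kurzweil_Integration.integral_combine) (use sub in \<open>auto intro!: divide_right_mono integrable_on_subinterval[OF g]\<close>)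
    then show ?case
      using Suc by (simp add: panel_def)
  qed simp
  from this[of n] show ?thesis using n by simp
qed

text \<open>At s = 0 the formula yields the index 0, which belongs to no panel; hence the strict
  inequality, which costs only a null set.\<close>

lemma panel_index:
  assumes "0 < n" "0 < s" "s \<le> 1"
  shows "nat \<lceil>real n * s\<rceil> \<in> {1..n}" "s \<in> panel n (nat \<lceil>real n * s\<rceil>)"
proof -
  have pos: "0 < \<lceil>real n * s\<rceil>" using assms by simp
  have "\<lceil>real n * s\<rceil> \<le> int n"
    using assms mult_left_mono[of s 1 "real n"] by (simp add: ceiling_le_iff)
  then show "nat \<lceil>real n * s\<rceil> \<in> {1..n}" 
    unfolding atLeastAtMost_iff using pos by linarith
  have "real (nat \<lceil>real n * s\<rceil>) = of_int \<lceil>real n * s\<rceil>" using pos by simp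
  then show "s \<in> panel n (nat \<lceil>real n * s\<rceil>)"
    using ceiling_correct[of "real n * s"] assms(1)
    by (simp add: panel_def divide_le_eq pos_le_divide_eq mult.commute)
qed

text \<open>The formula assigns a breakpoint to the panel on its left, so the left end of panel j
  has to be excluded.\<close>

lemma panel_index_eq:
  assumes "0 < n" "j \<in> {1..n}" "s \<in> panel n j" "s \<noteq> (real j - 1) / real n"
  shows "nat \<lceil>real n * s\<rceil> = j"
proof -
  have s: "(real j - 1) / real n < s" "s \<le> real j / real n"
    using assms(3,4) by (auto simp: panel_def)
  have "\<lceil>real n * s\<rceil> = int j"
  proof (rule ceiling_unique)
    show "of_int (int j) - 1 < real n * s" "real n * s \<le> of_int (int j)"
      using s assms(1) by (simp_all add: field_simps)
  qed
  then show ?thesis by simp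
qed

section \<open>The interpolation error\<close>

locale collocation = differentiable_kernel "2 * r + 1" \<kappa> D C
  for r :: nat and \<kappa> D C +
  fixes n :: nat
  assumes n_pos: "0 < n"
begin

text \<open>With j fixed the error is continuous on the closed panel, ends included. In
  \<open>interp_error\<close> the index changes with s and the values can jump at
  breakpoints.\<close>

definition panel_error :: "linf \<Rightarrow> nat \<Rightarrow> real \<Rightarrow> complex"
  where "panel_error x j s =
    kernel_fun \<kappa> x s - poly (interp_poly r n j (kernel_fun \<kappa> x)) (complex_of_real s)"

text \<open>Taylor expansion to degree \<open>2 r + 1\<close> at the midpoint: the part of degree at most \<open>2 r\<close> is
  reproduced, the next term contributes a multiple of the nodal polynomial.\<close>

lemma panel_error_expansion:
  assumes j: "j \<in> {1..n}"
  obtains a where "norm a \<le> C * norm x"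
    "\<And>s. s \<in> panel n j \<Longrightarrow> norm (panel_error x j s - a * poly (nodal_poly r n j) (complex_of_real s))
      \<le> (1 + lebesgue_const r) * (C * norm x * (1 / real n) ^ (2 * r + 2))"
proof -
  let ?c = "midpoint_of n j" and ?f = "kernel_fun \<kappa> x" and ?\<Omega> = "nodal_poly r n j"
  have c: "?c \<in> panel n j" "?c \<in> {0..1}"
    using midpoint_in_panel[OF n_pos] panel_subset[OF j] by blast+
  define b where "b i = pairing (D i ?c) x / fact i" for i
  define a where "a = b (2 * r + 1)"
  have a: "norm a \<le> C * norm x"
  proof -
    have "norm (pairing (D (2 * r + 1) ?c) x) \<le> C * norm x"
      using c(2) by (intro norm_pairing_le D_cont D_bound) auto
    moreover have "norm a \<le> norm (pairing (D (2 * r + 1) ?c) x) / 1"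
      unfolding a_def b_def norm_divide norm_fact by (rule divide_left_mono[OF fact_ge_1]) auto
    ultimately show ?thesis by simp
  qed
  define T where "T = (\<Sum>i\<le>2 * r + 1. smult (b i) ([:- complex_of_real ?c, 1:] ^ i))"
  \<comment> \<open>The nodal polynomial is monic of degree 2 r + 1, so subtracting a times it
    removes the top term of T and leaves the values at the nodes unchanged.\<close>
  define P where "P = T - smult a ?\<Omega>"
  define \<rho> where "\<rho> s = ?f s - poly T (complex_of_real s)" for s
  have "P = (\<Sum>i\<le>2 * r. smult (b i) ([:- complex_of_real ?c, 1:] ^ i))
      + smult a ([:- complex_of_real ?c, 1:] ^ (2 * r + 1) - ?\<Omega>)"
    by (simp add: P_def T_def a_def smult_diff_right)
  moreover have "degree (\<Sum>i\<le>2 * r. smult (b i) ([:- complex_of_real ?c, 1:] ^ i)) \<le> 2 * r"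
    by (intro degree_sum_le order_trans[OF degree_smult_le]) (auto simp: degree_linear_power)
  moreover have "degree (smult a ([:- complex_of_real ?c, 1:] ^ (2 * r + 1) - ?\<Omega>)) \<le> 2 * r"
  proof (rule order_trans[OF degree_smult_le], rule degree_diff_monic)
    show "degree ([:- complex_of_real ?c, 1:] ^ (2 * r + 1)) = Suc (2 * r)"
      by (simp only: degree_linear_power)
    show "lead_coeff ([:- complex_of_real ?c, 1:] ^ (2 * r + 1)) = 1"
      by (simp only: lead_coeff_power) simp
  qed (rule degree_nodal_poly lead_coeff_nodal_poly)+
  ultimately have degP: "degree P \<le> 2 * r"
    by (simp only: degree_add_le)
  \<comment> \<open>At the nodes the function equals T + \<rho> and T equals P. Since P has degree
    at most 2 r, it is reproduced, and only the remainder \<rho> is really interpolated.\<close>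
  have interp: "interp_poly r n j ?f = P + interp_poly r n j \<rho>"
  proof (rule interp_poly_eqI[OF n_pos])
    show "degree (P + interp_poly r n j \<rho>) \<le> 2 * r"
      unfolding interp_poly_lagrange[OF n_pos] by (rule degree_add_le[OF degP degree_lagrange_poly])
    fix i assume i: "i \<le> 2 * r"
    have "poly ?\<Omega> (complex_of_real (node r n j i)) = 0"
      unfolding nodal_poly_def poly_prod using i by (intro prod_zero) auto
    moreover have "poly (interp_poly r n j \<rho>) (complex_of_real (node r n j i)) = \<rho> (node r n j i)"
      unfolding interp_poly_lagrange[OF n_pos] by (rule poly_lagrange_poly_node[OF nodes_inj[OF n_pos] i])
    ultimately show "poly (P + interp_poly r n j \<rho>) (complex_of_real (node r n j i)) = ?f (node r n j i)"
      by (simp add: P_def \<rho>_def)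
  qed
  have \<rho>: "norm (\<rho> s) \<le> C * norm x * (1 / real n) ^ (2 * r + 2)" if s: "s \<in> panel n j" for s
  proof -
    have T: "poly T (complex_of_real s)
        = (\<Sum>i\<le>2 * r + 1. pairing (D i ?c) x / fact i * complex_of_real (s - ?c) ^ i)"
      unfolding T_def poly_sum b_def by (rule sum.cong) simp_all
    have "norm (\<rho> s) \<le> C * norm x * \<bar>s - ?c\<bar> ^ Suc (2 * r + 1)"
      unfolding \<rho>_def T using s panel_subset[OF j] c(2) by (intro kernel_fun_Taylor) auto
    also have "\<dots> \<le> C * norm x * (1 / real n) ^ Suc (2 * r + 1)"
      using C_nonneg panel_dist[OF s c(1)] by (intro mult_left_mono power_mono) auto
    finally show ?thesis by simp
  qed
  have "norm (panel_error x j s - a * poly ?\<Omega> (complex_of_real s))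
      \<le> (1 + lebesgue_const r) * (C * norm x * (1 / real n) ^ (2 * r + 2))" if s: "s \<in> panel n j" for s
  proof -
    \<comment> \<open>T - P is a times the nodal polynomial, so what is left is the interpolation
      error of \<rho>.\<close>
    have "panel_error x j s - a * poly ?\<Omega> (complex_of_real s)
        = \<rho> s - poly (interp_poly r n j \<rho>) (complex_of_real s)"
      by (simp add: panel_error_def interp P_def \<rho>_def)
    also have "norm \<dots> \<le> norm (\<rho> s) + norm (poly (interp_poly r n j \<rho>) (complex_of_real s))"
      by (rule norm_triangle_ineq4)
    also have "\<dots> \<le> C * norm x * (1 / real n) ^ (2 * r + 2)
        + lebesgue_const r * (C * norm x * (1 / real n) ^ (2 * r + 2))"
      by (intro add_mono \<rho> s norm_interp_poly_le n_pos)
    finally show ?thesis by (simp only: distrib_right mult_1)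
  qed
  then show ?thesis using a that by blast
qed

text \<open>The nodal polynomial contributes the order 2 r + 1; the rest is one order smaller and is
  absorbed because 1 / n is at most 1.\<close>

lemma norm_panel_error_le:
  assumes j: "j \<in> {1..n}" and s: "s \<in> panel n j"
  shows "norm (panel_error x j s) \<le> (2 + lebesgue_const r) * C * norm x * (1 / real n) ^ (2 * r + 1)"
proof -
  let ?h = "1 / real n" and ?w = "poly (nodal_poly r n j) (complex_of_real s)"
  obtain a where a: "norm a \<le> C * norm x"
    "norm (panel_error x j s - a * ?w) \<le> (1 + lebesgue_const r) * (C * norm x * ?h ^ (2 * r + 2))"
    by (rule panel_error_expansion[OF j, of x]) (use s in blast)
  have "norm (panel_error x j s) \<le> norm (a * ?w) + norm (panel_error x j s - a * ?w)"
    by (rule norm_triangle_sub)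
  also have "\<dots> \<le> C * norm x * ?h ^ (2 * r + 1) + (1 + lebesgue_const r) * (C * norm x * ?h ^ (2 * r + 1))"
  proof (intro add_mono)
    show "norm (a * ?w) \<le> C * norm x * ?h ^ (2 * r + 1)"
      unfolding norm_mult using a(1) norm_nodal_poly_le[OF s] C_nonneg by (intro mult_mono) auto
    have "?h ^ (2 * r + 2) \<le> ?h ^ (2 * r + 1)"
      using n_pos by (intro power_decreasing) auto
    then have "(1 + lebesgue_const r) * (C * norm x * ?h ^ (2 * r + 2))
        \<le> (1 + lebesgue_const r) * (C * norm x * ?h ^ (2 * r + 1))"
      using C_nonneg lebesgue_const_nonneg by (intro mult_left_mono) auto
    then show "norm (panel_error x j s - a * ?w) \<le> (1 + lebesgue_const r) * (C * norm x * ?h ^ (2 * r + 1))"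
      using a(2) by linarith
  qed
  also have "\<dots> = (2 + lebesgue_const r) * C * norm x * ?h ^ (2 * r + 1)"
  proof -
    have "q + (1 + l) * q = (2 + l) * q" for q l :: real
      by (simp add: algebra_simps)
    then show ?thesis by (simp only: mult.assoc)
  qed
  finally show ?thesis .
qed

definition interp_error :: "linf \<Rightarrow> real \<Rightarrow> complex"
  where "interp_error x s = panel_error x (nat \<lceil>real n * s\<rceil>) s"

lemma AE_interp_error: "AE s in unit_M. norm (interp_error x s) \<le> (2 + lebesgue_const r) * C * norm x * (1 / real n) ^ (2 * r + 1)"
proof -
  have "AE s in unit_M. s \<noteq> 0"
    using AE_completion[OF AE_lborel_singleton, of "0::real"]
    by (subst AE_restrict_space_iff) (auto elim: eventually_mono)
  moreover have "AE s in unit_M. s \<in> {0..1}"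
    by (rule AE_I2) simp
  ultimately show ?thesis
  proof eventually_elim
    case (elim s)
    then have "0 < s" "s \<le> 1" by auto
    then show ?case
      unfolding interp_error_def by (intro norm_panel_error_le panel_index n_pos)
  qed
qed

text \<open>The panel index takes countably many values, and for each of them the function is a
  polynomial.\<close>

lemma measurable_interp:
  "(\<lambda>s. poly (interp_poly r n (nat \<lceil>real n * s\<rceil>) f) (complex_of_real s)) \<in> borel_measurable unit_M"
proof (rule measurable_compose_countable)
  show "(\<lambda>s. poly (interp_poly r n j f) (complex_of_real s)) \<in> borel_measurable unit_M" for j
    by (rule continuous_imp_measurable_on_sets_lebesgue) (auto intro!: continuous_intros)
  have "(\<lambda>s. nat \<lceil>real n * s\<rceil>) \<in> borel \<rightarrow>\<^sub>M count_space UNIV"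
    by measurable
  then show "(\<lambda>s. nat \<lceil>real n * s\<rceil>) \<in> unit_M \<rightarrow>\<^sub>M count_space UNIV"
    by (intro measurable_restrict_space1 measurable_completion) simp
qed

lemma ess_bdd_interp_error: "ess_bdd (interp_error x)"
proof -
  have "kernel_fun \<kappa> x \<in> borel_measurable unit_M"
    using ess_bdd_kernel_fun by (simp add: ess_bdd_def)
  then have "interp_error x \<in> borel_measurable unit_M"
    unfolding interp_error_def[abs_def] panel_error_def by (intro borel_measurable_diff measurable_interp)
  then show ?thesis
    using AE_interp_error by (auto simp: ess_bdd_def)
qed

lemma fredholm_minus_colloc: "fredholm \<kappa> x - colloc r n \<kappa> x = to_linf (interp_error x)"
proof -
  let ?q = "\<lambda>s. poly (interp_poly r n (nat \<lceil>real n * s\<rceil>) (kernel_fun \<kappa> x)) (complex_of_real s)"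
  have "?q = (\<lambda>s. kernel_fun \<kappa> x s - interp_error x s)"
    by (simp add: interp_error_def panel_error_def)
  then have "ess_bdd ?q"
    using ess_bdd_diff[OF ess_bdd_kernel_fun ess_bdd_interp_error] by simp
  then show ?thesis
    using diff_abs_linf[OF ess_bdd_kernel_fun, of ?q x]
    by (simp add: fredholm_def colloc_def interp_proj_def interp_error_def[abs_def] panel_error_def)
qed

lemma norm_fredholm_minus_colloc_le:
  "norm (fredholm \<kappa> x - colloc r n \<kappa> x) \<le> (2 + lebesgue_const r) * C * norm x * (1 / real n) ^ (2 * r + 1)"
  unfolding fredholm_minus_colloc
  using C_nonneg lebesgue_const_nonneg
  by (intro norm_to_linf_le ess_bdd_interp_error AE_interp_error mult_nonneg_nonneg) auto

section \<open>The order gained by applying the operator once more\<close>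

lemma panel_error_cont: "j \<in> {1..n} \<Longrightarrow> continuous_on (panel n j) (panel_error x j)"
  unfolding panel_error_def
  by (intro continuous_intros continuous_on_subset[OF kernel_fun_cont] panel_subset)

text \<open>The leading error term, weighted by the kernel frozen at the midpoint, integrates to 0
  and may be subtracted. What remains is the kernel times the error of order 2 r + 2, plus the
  variation of the kernel over the panel, of order 1, times the leading term of order 2 r + 1. The
  last factor 1 / n is the panel length.\<close>

lemma norm_integral_panel_le:
  assumes j: "j \<in> {1..n}" and s: "s \<in> {0..1}"
  shows "norm (integral (panel n j) (\<lambda>t. complex_of_real (\<kappa> s t) * panel_error x j t))
    \<le> (2 + lebesgue_const r) * C * C * norm x * (1 / real n) ^ (2 * r + 2) * (1 / real n)"
proof -
  let ?h = "1 / real n" and ?w = "\<lambda>t. poly (nodal_poly r n j) (complex_of_real t)"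
  let ?c = "midpoint_of n j" and ?L = "lebesgue_const r"
  obtain a where a: "norm a \<le> C * norm x"
    "\<And>t. t \<in> panel n j \<Longrightarrow> norm (panel_error x j t - a * ?w t) \<le> (1 + ?L) * (C * norm x * ?h ^ (2 * r + 2))"
    by (rule panel_error_expansion[OF j]) (rule that)
  have c: "?c \<in> panel n j" "?c \<in> {0..1}"
    using midpoint_in_panel[OF n_pos] panel_subset[OF j] by blast+
  define g where "g t = complex_of_real (\<kappa> s t) * panel_error x j t - complex_of_real (\<kappa> s ?c) * a * ?w t" for t
  have \<kappa>_cont: "continuous_on (panel n j) (\<lambda>t. complex_of_real (\<kappa> s t))"
    by (intro continuous_on_of_real continuous_on_subset[OF kernel_cont[OF s]] panel_subset[OF j])
  have cont1: "continuous_on (panel n j) (\<lambda>t. complex_of_real (\<kappa> s t) * panel_error x j t)"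
    by (intro continuous_on_mult \<kappa>_cont panel_error_cont[OF j])
  have cont2: "continuous_on (panel n j) (\<lambda>t. complex_of_real (\<kappa> s ?c) * a * ?w t)"
    by (intro continuous_intros)
  have "integral (panel n j) (\<lambda>t. complex_of_real (\<kappa> s t) * panel_error x j t)
      = integral (panel n j) g"
  proof -
    have "integral (panel n j) g = integral (panel n j) (\<lambda>t. complex_of_real (\<kappa> s t) * panel_error x j t)
        - integral (panel n j) (\<lambda>t. complex_of_real (\<kappa> s ?c) * a * ?w t)"
      unfolding g_def[abs_def] using cont1 cont2 unfolding panel_def
      by (intro Henstock_Kurzweil_Integration.integral_diff integrable_continuous_real)
    then show ?thesis
      by (simp add: integral_nodal_poly)
  qed
  also have "norm \<dots> \<le> (2 + ?L) * C * C * norm x * ?h ^ (2 * r + 2) * (real j / real n - (real j - 1) / real n)"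
    unfolding panel_def
  proof (rule integral_bound)
    show "(real j - 1) / real n \<le> real j / real n" by (simp add: divide_right_mono)
    show "continuous_on {(real j - 1) / real n..real j / real n} g"
      using continuous_on_diff[OF cont1 cont2] by (simp add: g_def[abs_def] panel_def)
    fix t assume "t \<in> {(real j - 1) / real n..real j / real n}"
    then have t: "t \<in> panel n j" "t \<in> {0..1}"
      using panel_subset[OF j] by (auto simp: panel_def)
    have "g t = complex_of_real (\<kappa> s t) * (panel_error x j t - a * ?w t) + complex_of_real (\<kappa> s t - \<kappa> s ?c) * (a * ?w t)"
      by (simp add: g_def algebra_simps)
    also have "norm \<dots> \<le> norm (complex_of_real (\<kappa> s t) * (panel_error x j t - a * ?w t))
        + norm (complex_of_real (\<kappa> s t - \<kappa> s ?c) * (a * ?w t))"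
      by (rule norm_triangle_ineq)
    also have "\<dots> \<le> C * ((1 + ?L) * (C * norm x * ?h ^ (2 * r + 2))) + C * ?h * (C * norm x * ?h ^ (2 * r + 1))"
    proof (intro add_mono)
      show "norm (complex_of_real (\<kappa> s t) * (panel_error x j t - a * ?w t))
          \<le> C * ((1 + ?L) * (C * norm x * ?h ^ (2 * r + 2)))"
        unfolding norm_mult norm_of_real
        using kernel_bound[OF s t(2)] a(2)[OF t(1)] C_nonneg by (intro mult_mono) auto
      have "\<bar>\<kappa> s t - \<kappa> s ?c\<bar> \<le> C * \<bar>t - ?c\<bar>"
        by (rule kernel_Lipschitz[OF s t(2) c(2)])
      also have "\<dots> \<le> C * ?h"
        by (intro mult_left_mono panel_dist[OF t(1) c(1)] C_nonneg)
      finally have "norm (complex_of_real (\<kappa> s t - \<kappa> s ?c)) \<le> C * ?h"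
        by (simp only: norm_of_real)
      moreover have "norm (a * ?w t) \<le> C * norm x * ?h ^ (2 * r + 1)"
        unfolding norm_mult using a(1) norm_nodal_poly_le[OF t(1)] C_nonneg by (intro mult_mono) auto
      ultimately show "norm (complex_of_real (\<kappa> s t - \<kappa> s ?c) * (a * ?w t)) \<le> C * ?h * (C * norm x * ?h ^ (2 * r + 1))"
        unfolding norm_mult[of "complex_of_real (\<kappa> s t - \<kappa> s ?c)"] using C_nonneg by (intro mult_mono) auto
    qed
    also have "\<dots> = (2 + ?L) * C * C * norm x * ?h ^ (2 * r + 2)"
    proof -
      have "C * ((1 + ?L) * (C * norm x * (q * p))) + C * q * (C * norm x * p)
          = (2 + ?L) * C * C * norm x * (q * p)" for q p
        by (simp add: algebra_simps)
      from this[of ?h "?h ^ (2 * r + 1)"] show ?thesis by (simp only: power_Suc[symmetric]) simp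
    qed
    finally show "norm (g t) \<le> (2 + ?L) * C * C * norm x * ?h ^ (2 * r + 2)" .
  qed
  also have "real j / real n - (real j - 1) / real n = ?h"
    by (simp add: diff_divide_distrib)
  finally show ?thesis .
qed

text \<open>Summing the panel bounds loses nothing, since the n panels have total length 1.\<close>

lemma norm_fredholm_interp_error_le:
  "norm (fredholm \<kappa> (fredholm \<kappa> x - colloc r n \<kappa> x))
    \<le> (2 + lebesgue_const r) * C * C * norm x * (1 / real n) ^ (2 * r + 2)"
proof -
  let ?B = "(2 + lebesgue_const r) * C * C * norm x * (1 / real n) ^ (2 * r + 2)"
  have "norm (kernel_fun \<kappa> (to_linf (interp_error x)) s) \<le> ?B" if s: "s \<in> {0..1}" for s
  proof -
    let ?g = "\<lambda>t. complex_of_real (\<kappa> s t) * interp_error x t"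
    have int: "?g integrable_on {0..1}"
      by (intro ess_bdd_integral ess_bdd_mult ess_bdd_of_real kernel_cont s ess_bdd_interp_error)
    \<comment> \<open>Only at the left end does the index formula select another polynomial, and one
      point does not change the integral.\<close>
    have "integral (panel n j) ?g = integral (panel n j) (\<lambda>t. complex_of_real (\<kappa> s t) * panel_error x j t)"
      if j: "j \<in> {1..n}" for j
      by (rule integral_spike[of "{(real j - 1) / real n}"])
        (use panel_index_eq[OF n_pos j] in \<open>auto simp: interp_error_def\<close>)
    then have "kernel_fun \<kappa> (to_linf (interp_error x)) s
        = (\<Sum>j\<in>{1..n}. integral (panel n j) (\<lambda>t. complex_of_real (\<kappa> s t) * panel_error x j t))"
      using integral_panels[OF int n_pos] by (simp add: kernel_fun_to_linf ess_bdd_interp_error)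
    also have "norm \<dots> \<le> (\<Sum>j\<in>{1..n}. ?B * (1 / real n))"
      by (intro sum_norm_le norm_integral_panel_le s)
    also have "\<dots> = ?B"
      using n_pos by simp
    finally show ?thesis .
  qed
  then have "AE s in unit_M. norm (kernel_fun \<kappa> (to_linf (interp_error x)) s) \<le> ?B"
    by (intro AE_I2) simp
  then show ?thesis
    unfolding fredholm_minus_colloc unfolding fredholm_def[of \<kappa> "to_linf _"]
    using C_nonneg lebesgue_const_nonneg by (intro norm_to_linf_le ess_bdd_kernel_fun) auto
qed

end

section \<open>The error estimates\<close>

context differentiable_kernel
begin

text \<open>For \<open>z \<noteq> 0\<close> the equation \<open>K x - z x = y\<close> gives \<open>x = (K x - y) / z\<close>, which transfers
  solvability from continuous to essentially bounded right-hand sides.\<close>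

lemma resolvent_set_UNIV:
  assumes z: "z \<noteq> 0" "z \<in> resolvent_set C01 (fredholm \<kappa>)"
  shows "z \<in> resolvent_set UNIV (fredholm \<kappa>)"
proof -
  let ?K = "fredholm \<kappa>"
  have diff: "?K (x - y) = ?K x - ?K y" for x y
    by (rule linear_diff[OF bounded_linear.linear[OF bounded_linear_fredholm]])
  obtain M where bij: "bij_betw (\<lambda>x. ?K x - z *\<^sub>C x) C01 C01"
    and M: "\<And>x. x \<in> C01 \<Longrightarrow> norm x \<le> M * norm (?K x - z *\<^sub>C x)"
    using z(2) unfolding resolvent_set_def by blast
  have bound: "norm x \<le> (\<bar>M\<bar> * C + 1) / norm z * norm (?K x - z *\<^sub>C x)" for x
  proof -
    let ?y = "?K x - z *\<^sub>C x"
    \<comment> \<open>K x is continuous and solves the same equation with right-hand side K y, so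
      the bound on \<open>C01\<close> applies to K x in place of x.\<close>
    have "norm (?K x) \<le> M * norm (?K (?K x) - z *\<^sub>C ?K x)"
      by (rule M[OF fredholm_in_C01])
    also have "?K (?K x) - z *\<^sub>C ?K x = ?K ?y"
      by (simp add: diff fredholm_scale)
    also have "M * norm (?K ?y) \<le> \<bar>M\<bar> * (C * norm ?y)"
      using norm_fredholm_le[of ?y] by (intro mult_mono) auto
    finally have Kx: "norm (?K x) \<le> \<bar>M\<bar> * (C * norm ?y)" .
    have "norm z * norm x = norm (?K x - ?y)"
      by (simp add: norm_scaleC)
    also have "\<dots> \<le> (\<bar>M\<bar> * C + 1) * norm ?y"
      using Kx norm_triangle_ineq4[of "?K x" ?y] by (simp only: distrib_right mult_1 mult.assoc)
    finally show ?thesis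
      using z(1) by (simp add: pos_le_divide_eq mult.commute)
  qed
  have "inj (\<lambda>x. ?K x - z *\<^sub>C x)"
  proof (rule injI)
    fix x y assume eq: "?K x - z *\<^sub>C x = ?K y - z *\<^sub>C y"
    have "?K (x - y) - z *\<^sub>C (x - y) = (?K x - z *\<^sub>C x) - (?K y - z *\<^sub>C y)"
      by (simp add: diff scaleC.diff_right)
    also have "\<dots> = 0" by (simp only: eq diff_self)
    finally show "x = y" using bound[of "x - y"] by simp
  qed
  moreover have "\<exists>x. y = ?K x - z *\<^sub>C x" for y
  proof -
    \<comment> \<open>Solve K w - z w = K y with w in \<open>C01\<close>. Then x = (w - y) / z
      satisfies K x = w, and hence K x - z x = y.\<close>
    have "?K y \<in> (\<lambda>x. ?K x - z *\<^sub>C x) ` C01"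
      unfolding bij_betw_imp_surj_on[OF bij] by (rule fredholm_in_C01)
    then obtain w where w: "?K y = ?K w - z *\<^sub>C w"
      by (rule imageE)
    then have "?K w - ?K y = z *\<^sub>C w" by simp
    then have "?K ((1 / z) *\<^sub>C (w - y)) - z *\<^sub>C (1 / z) *\<^sub>C (w - y) = y"
      using z(1) by (simp add: fredholm_scale diff)
    then show ?thesis by (intro exI) (rule sym)
  qed
  ultimately have "bij (\<lambda>x. ?K x - z *\<^sub>C x)"
    unfolding bij_def surj_def by blast
  then show ?thesis
    unfolding resolvent_set_def using bound by blast
qed

lemma resolvent_curve_C01:
  assumes "path \<gamma>" "rectifiable \<gamma>" "path_image \<gamma> \<subseteq> resolvent_set C01 (fredholm \<kappa>)"
  shows "resolvent_curve C01 (fredholm \<kappa>) \<gamma>"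
  by (rule resolvent_curve.intro[OF subspace_C01 fredholm_in_C01 bounded_linear_fredholm
    fredholm_scale assms])

lemma resolvent_curve_UNIV:
  assumes "path \<gamma>" "rectifiable \<gamma>" "path_image \<gamma> \<subseteq> resolvent_set C01 (fredholm \<kappa>)"
    and "0 \<notin> path_image \<gamma>"
  shows "resolvent_curve UNIV (fredholm \<kappa>) \<gamma>"
proof (rule resolvent_curve.intro[OF linf.subspace_UNIV UNIV_I bounded_linear_fredholm
    fredholm_scale assms(1,2)])
  show "path_image \<gamma> \<subseteq> resolvent_set UNIV (fredholm \<kappa>)"
  proof
    fix z assume "z \<in> path_image \<gamma>"
    then show "z \<in> resolvent_set UNIV (fredholm \<kappa>)"
      using assms(3,4) by (intro resolvent_set_UNIV) auto
  qed
qed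

end

lemma bigo_const_powerI:
  assumes "\<forall>\<^sub>F n in sequentially. norm (f n) \<le> c * (1 / real n) ^ k"
  shows "(\<lambda>n. norm (f n)) \<in> O(\<lambda>n. (1 / real n) ^ k)"
  by (rule bigoI[of _ c]) (use assms in simp)

theorem theorem4p6:
  fixes r :: nat
    and \<kappa> :: "real \<Rightarrow> real \<Rightarrow> real"
    and ev :: complex
    and \<Gamma> :: "real \<Rightarrow> complex"
    and ev\<^sub>C :: "nat \<Rightarrow> complex"
    and \<psi>\<^sub>C \<psi>\<^sub>S :: "nat \<Rightarrow> linf"
  defines "K \<equiv> fredholm \<kappa>"
    and "QK \<equiv> \<lambda>n. colloc r n \<kappa>"
  defines "E \<equiv> spectral_projection C01 K \<Gamma>"
    and "E_ext \<equiv> spectral_projection UNIV K \<Gamma>"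
    and "E\<^sub>n \<equiv> \<lambda>n. spectral_projection UNIV (QK n) \<Gamma>"
  assumes kernel: "smooth_kernel (2 * r + 2) \<kappa>"
    and curve: "pos_oriented_jordan_curve \<Gamma>"
    and curve_resolvent: "path_image \<Gamma> \<subseteq> resolvent_set C01 K"
    and separates: "inside (path_image \<Gamma>) \<inter> spectrum C01 K = {ev}"
    and zero_outside: "0 \<in> outside (path_image \<Gamma>)"
    and nonzero: "ev \<noteq> 0"
    and simple: "simple_eigenvalue C01 K \<Gamma> ev"
    and colloc_resolvent:
      "\<forall>\<^sub>F n in sequentially. path_image \<Gamma> \<subseteq> resolvent_set UNIV (QK n)"
    and colloc_unique:
      "\<forall>\<^sub>F n in sequentially. inside (path_image \<Gamma>) \<inter> {\<mu>. eigenvalue UNIV (QK n) \<mu>} = {ev\<^sub>C n}"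
    and colloc_simple:
      "\<forall>\<^sub>F n in sequentially. simple_eigenvalue UNIV (QK n) \<Gamma> (ev\<^sub>C n)"
    and eigenfunction:
      "\<forall>\<^sub>F n in sequentially.
         \<psi>\<^sub>C n \<in> range (E\<^sub>n n) \<and> norm (\<psi>\<^sub>C n) = 1 \<and> QK n (\<psi>\<^sub>C n) = ev\<^sub>C n *\<^sub>C \<psi>\<^sub>C n"
    and iterated:
      "\<forall>\<^sub>F n in sequentially. \<psi>\<^sub>S n = (1 / ev\<^sub>C n) *\<^sub>C K (\<psi>\<^sub>C n)"
  shows "(\<lambda>n. norm (\<psi>\<^sub>C n - E_ext (\<psi>\<^sub>C n))) \<in> O(\<lambda>n. (1 / real n) ^ (2 * r + 1))
       \<and> (\<lambda>n. norm (\<psi>\<^sub>S n - E (\<psi>\<^sub>S n))) \<in> O(\<lambda>n. (1 / real n) ^ (2 * r + 2))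
       \<and> (\<lambda>n. norm (ev - ev\<^sub>C n)) \<in> O(\<lambda>n. (1 / real n) ^ (2 * r + 2))"
proof -
  have "smooth_kernel (Suc (2 * r + 1)) \<kappa>"
    using kernel by simp
  then obtain D C where "differentiable_kernel (2 * r + 1) \<kappa> D C"
    by (rule smooth_kernel_differentiable)
  then interpret k: differentiable_kernel "2 * r + 1" \<kappa> D C .
  note jordan = curve[unfolded pos_oriented_jordan_curve_def]
  have \<Gamma>: "path \<Gamma>" "rectifiable \<Gamma>"
    using jordan by (blast intro: simple_path_imp_path)+
  have winding: "winding_number \<Gamma> w = 1" if "w \<in> inside (path_image \<Gamma>)" for w
    using jordan that by blast
  have zero: "0 \<notin> path_image \<Gamma>"
    using zero_outside outside_no_overlap[of "path_image \<Gamma>"] by blast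
  note K_resolvent = curve_resolvent[unfolded K_def]
  interpret c: resolvent_curve C01 K \<Gamma>
    unfolding K_def by (rule k.resolvent_curve_C01[OF \<Gamma>(1,2) K_resolvent])
  interpret u: resolvent_curve UNIV K \<Gamma>
    unfolding K_def by (rule k.resolvent_curve_UNIV[OF \<Gamma>(1,2) K_resolvent zero])
  have ev: "ev \<notin> path_image \<Gamma>" "winding_number \<Gamma> ev = 1"
  proof -
    have "ev \<in> inside (path_image \<Gamma>)" using separates by blast
    then show "ev \<notin> path_image \<Gamma>" "winding_number \<Gamma> ev = 1"
      using winding inside_no_overlap[of "path_image \<Gamma>"] by blast+
  qed
  \<comment> \<open>The resolvent bound is taken on the whole space because it will be applied to
    \<open>\<psi>\<^sub>C n\<close>.\<close>
  obtain M where M: "0 < M"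
      "\<And>z x. z \<in> path_image \<Gamma> \<Longrightarrow> x \<in> UNIV \<Longrightarrow> norm x \<le> M * norm (K x - z *\<^sub>C x)"
    by (rule u.uniform_bound) (rule that)
  obtain Cu where Cu: "0 < Cu" "\<And>x \<mu> d. x \<in> UNIV \<Longrightarrow> winding_number \<Gamma> \<mu> = 1 \<Longrightarrow> 0 < d \<Longrightarrow>
      \<forall>z\<in>path_image \<Gamma>. d \<le> norm (z - \<mu>) \<Longrightarrow>
      norm (x - E_ext x) \<le> Cu / d * norm (K x - \<mu> *\<^sub>C x)"
    by (rule u.E_almost_fixes[folded E_ext_def]) (rule that)
  obtain Cc where Cc: "0 < Cc" "\<And>x \<mu> d. x \<in> C01 \<Longrightarrow> winding_number \<Gamma> \<mu> = 1 \<Longrightarrow> 0 < d \<Longrightarrow>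
      \<forall>z\<in>path_image \<Gamma>. d \<le> norm (z - \<mu>) \<Longrightarrow>
      norm (x - E x) \<le> Cc / d * norm (K x - \<mu> *\<^sub>C x)"
    by (rule c.E_almost_fixes[folded E_def]) (rule that)
  obtain Ce where Ce: "0 < Ce" "\<And>x. x \<in> C01 \<Longrightarrow> norm (E x) \<le> Ce * norm x"
    by (rule c.E_bound[folded E_def]) (rule that)
  \<comment> \<open>The outside is open and contains 0, so the inside avoids a ball around 0. This
    bounds 1 / \<open>ev\<^sub>C n\<close> uniformly in n.\<close>
  obtain b where b: "0 < b" "\<And>\<mu>. \<mu> \<in> inside (path_image \<Gamma>) \<Longrightarrow> b \<le> norm \<mu>"
  proof -
    have "open (outside (path_image \<Gamma>))"
      by (rule open_outside[OF closed_path_image[OF \<Gamma>(1)]])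
    then obtain b where b: "0 < b" "ball 0 b \<subseteq> outside (path_image \<Gamma>)"
      using zero_outside open_contains_ball by blast
    have "b \<le> norm \<mu>" if "\<mu> \<in> inside (path_image \<Gamma>)" for \<mu>
    proof (rule ccontr)
      assume "\<not> b \<le> norm \<mu>"
      then have "\<mu> \<in> ball 0 b" by simp
      then show False
        using that b(2) inside_Int_outside[of "path_image \<Gamma>"] by blast
    qed
    then show ?thesis using b(1) that by blast
  qed
  define K1 where "K1 = (2 + lebesgue_const r) * C"
  define K2 where "K2 = (2 + lebesgue_const r) * C * C"
  \<comment> \<open>With this choice M d = 1 / 2: a residual below d uses up only half of the
    resolvent estimate for a unit vector, and the other half must come from |z -
    \<open>ev\<^sub>C n\<close>|.\<close>
  define d where "d = 1 / (2 * M)"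
  have d: "0 < d" using M(1) by (simp add: d_def)
  have quarter: "0 < (1 / 4 :: real)" by simp
  have small: "\<forall>\<^sub>F n in sequentially. c * (1 / real n) ^ Suc k < e" if "0 < e" for e c k
  proof -
    have "(\<lambda>n. c * (1 / real n) ^ Suc k) \<longlonglongrightarrow> 0"
      by (intro tendsto_mult_right_zero tendsto_null_power lim_1_over_n) simp
    then show ?thesis
      using that by (rule order_tendstoD(2))
  qed
  \<comment> \<open>The smallness threshold d keeps \<open>ev\<^sub>C n\<close> away from the curve;
    the two thresholds 1/4 together keep the norm of \<open>E (\<psi>\<^sub>S n)\<close> at least
    1/2.\<close>
  have "\<forall>\<^sub>F n in sequentially.
      norm (\<psi>\<^sub>C n - E_ext (\<psi>\<^sub>C n)) \<le> Cu / d * K1 * (1 / real n) ^ (2 * r + 1) \<and>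
      norm (\<psi>\<^sub>S n - E (\<psi>\<^sub>S n)) \<le> Cc / d * (K2 / b) * (1 / real n) ^ (2 * r + 2) \<and>
      norm (ev - ev\<^sub>C n) \<le> 2 * Ce * (K2 / b) * (1 / real n) ^ (2 * r + 2)"
    using colloc_unique eigenfunction iterated eventually_gt_at_top[of "0::nat"]
      small[OF d, of K1 "2 * r"] small[OF quarter, of "K1 / b" "2 * r"]
      small[OF quarter, of "Cc / d * (K2 / b)" "2 * r + 1"]
  proof eventually_elim
    case (elim n)
    then interpret p: collocation r \<kappa> D C n
      by unfold_locales simp
    let ?\<psi> = "\<psi>\<^sub>C n" and ?\<phi> = "\<psi>\<^sub>S n" and ?\<mu> = "ev\<^sub>C n" and ?h = "1 / real n"
    have \<psi>: "norm ?\<psi> = 1" "QK n ?\<psi> = ?\<mu> *\<^sub>C ?\<psi>" and \<phi>: "?\<phi> = (1 / ?\<mu>) *\<^sub>C K ?\<psi>"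
      and inside: "?\<mu> \<in> inside (path_image \<Gamma>)"
      and h_small: "K1 * ?h ^ (2 * r + 1) < d" "K1 / b * ?h ^ (2 * r + 1) < 1 / 4"
        "Cc / d * (K2 / b) * ?h ^ (2 * r + 2) < 1 / 4"
      using elim by auto
    have wn: "winding_number \<Gamma> ?\<mu> = 1" by (rule winding[OF inside])
    have "b \<le> norm ?\<mu>" by (rule b(2)[OF inside])
    then have \<mu>: "b \<le> norm ?\<mu>" "?\<mu> \<noteq> 0" using b(1) by auto
    have \<phi>_C01: "?\<phi> \<in> C01"
      unfolding \<phi> K_def by (rule linf.subspace_scale[OF subspace_C01 k.fredholm_in_C01])
    have res: "norm (K ?\<psi> - ?\<mu> *\<^sub>C ?\<psi>) \<le> K1 * ?h ^ (2 * r + 1)"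
      using p.norm_fredholm_minus_colloc_le[of ?\<psi>] \<psi> by (simp add: K_def QK_def K1_def)
    \<comment> \<open>For z on the curve, K \<psi> - z \<psi> is the residual minus (z - \<mu>)
      \<psi>. Were z closer to \<mu> than d, this would be too small for a vector of norm 1,
      whatever n is.\<close>
    have far: "\<forall>z\<in>path_image \<Gamma>. d \<le> norm (z - ?\<mu>)"
    proof
      fix z assume z: "z \<in> path_image \<Gamma>"
      have eq: "K ?\<psi> - z *\<^sub>C ?\<psi> = (K ?\<psi> - ?\<mu> *\<^sub>C ?\<psi>) - (z - ?\<mu>) *\<^sub>C ?\<psi>"
        by (simp add: scaleC.diff_left)
      have "norm (K ?\<psi> - z *\<^sub>C ?\<psi>) \<le> norm (K ?\<psi> - ?\<mu> *\<^sub>C ?\<psi>) + norm (z - ?\<mu>)"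
        unfolding eq by (rule order_trans[OF norm_triangle_ineq4]) (simp add: norm_scaleC \<psi>(1))
      also have "\<dots> \<le> d + norm (z - ?\<mu>)"
        using res h_small(1) by simp
      finally have "M * norm (K ?\<psi> - z *\<^sub>C ?\<psi>) \<le> M * (d + norm (z - ?\<mu>))"
        using M(1) by (intro mult_left_mono) auto
      then have "1 \<le> M * (d + norm (z - ?\<mu>))"
        using M(2)[OF z UNIV_I, of ?\<psi>] \<psi>(1) by simp
      then have "M * d \<le> M * norm (z - ?\<mu>)"
        using M(1) by (simp add: d_def distrib_left)
      then show "d \<le> norm (z - ?\<mu>)" using M(1) by simp
    qed
    have 1: "norm (?\<psi> - E_ext ?\<psi>) \<le> Cu / d * K1 * ?h ^ (2 * r + 1)"
    proof -
      have "norm (?\<psi> - E_ext ?\<psi>) \<le> Cu / d * norm (K ?\<psi> - ?\<mu> *\<^sub>C ?\<psi>)"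
        by (rule Cu(2)[OF UNIV_I wn d far])
      also have "\<dots> \<le> Cu / d * (K1 * ?h ^ (2 * r + 1))"
        using Cu(1) d by (intro mult_left_mono res) auto
      finally show ?thesis by (simp only: mult.assoc)
    qed
    have \<phi>_res: "norm (K ?\<phi> - ?\<mu> *\<^sub>C ?\<phi>) \<le> K2 / b * ?h ^ (2 * r + 2)"
    proof -
      \<comment> \<open>Here \<mu> \<psi> is rewritten as \<open>QK n ?\<psi>\<close>, which exposes
        the interpolation error under one more application of K.\<close>
      have "K ?\<phi> - ?\<mu> *\<^sub>C ?\<phi> = (1 / ?\<mu>) *\<^sub>C K (K ?\<psi> - QK n ?\<psi>)"
        unfolding \<phi> \<psi>(2) using \<mu>(2) by (simp add: c.homogeneous c.T_diff scaleC.diff_right)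
      also have "norm \<dots> \<le> 1 / b * (K2 * ?h ^ (2 * r + 2))"
        unfolding norm_scaleC
        using p.norm_fredholm_interp_error_le[of ?\<psi>] \<mu>(1) b(1) \<psi>(1)
        by (intro mult_mono) (simp_all add: norm_divide frac_le K_def QK_def K2_def)
      finally show ?thesis by simp
    qed
    have 2: "norm (?\<phi> - E ?\<phi>) \<le> Cc / d * (K2 / b) * ?h ^ (2 * r + 2)"
    proof -
      have "norm (?\<phi> - E ?\<phi>) \<le> Cc / d * norm (K ?\<phi> - ?\<mu> *\<^sub>C ?\<phi>)"
        by (rule Cc(2)[OF \<phi>_C01 wn d far])
      also have "\<dots> \<le> Cc / d * (K2 / b * ?h ^ (2 * r + 2))"
        using Cc(1) d by (intro mult_left_mono \<phi>_res) auto
      finally show ?thesis by (simp only: mult.assoc)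
    qed
    \<comment> \<open>The difference is the residual of \<psi> divided by \<mu>.\<close>
    have "norm (?\<phi> - ?\<psi>) \<le> 1 / 4"
    proof -
      have "?\<phi> - ?\<psi> = (1 / ?\<mu>) *\<^sub>C (K ?\<psi> - ?\<mu> *\<^sub>C ?\<psi>)"
        using \<mu>(2) by (simp add: \<phi> scaleC.diff_right)
      also have "norm \<dots> \<le> 1 / b * (K1 * ?h ^ (2 * r + 1))"
        unfolding norm_scaleC using \<mu>(1) b(1) res
        by (intro mult_mono) (simp_all add: norm_divide frac_le)
      also have "\<dots> = K1 / b * ?h ^ (2 * r + 1)"
        by simp
      finally show ?thesis using h_small(2) by linarith
    qed
    moreover have "norm (?\<psi> - E ?\<phi>) \<le> norm (?\<phi> - ?\<psi>) + norm (?\<phi> - E ?\<phi>)"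
      using norm_triangle_ineq[of "?\<psi> - ?\<phi>" "?\<phi> - E ?\<phi>"] by (simp add: norm_minus_commute)
    \<comment> \<open>The norm of \<psi> is 1, and replacing \<psi> by \<phi> and then by
      \<open>E ?\<phi>\<close> costs at most 1/4 each time.\<close>
    ultimately have half: "1 / 2 \<le> norm (E ?\<phi>)"
      using 2 h_small(3) \<psi>(1) norm_triangle_ineq2[of ?\<psi> "E ?\<phi>"] by linarith
    have "(ev - ?\<mu>) *\<^sub>C E ?\<phi> = E (K ?\<phi> - ?\<mu> *\<^sub>C ?\<phi>)"
      using c.simple_eigenvalue_range[OF simple ev \<phi>_C01] c.E_diff_scale[OF \<phi>_C01, of ?\<mu>]
      by (simp add: E_def scaleC.diff_left)
    then have "norm (ev - ?\<mu>) * norm (E ?\<phi>) = norm (E (K ?\<phi> - ?\<mu> *\<^sub>C ?\<phi>))"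
      by (metis norm_scaleC)
    moreover have "norm (E (K ?\<phi> - ?\<mu> *\<^sub>C ?\<phi>)) \<le> Ce * (K2 / b * ?h ^ (2 * r + 2))"
    proof (rule order_trans[OF Ce(2)])
      show "K ?\<phi> - ?\<mu> *\<^sub>C ?\<phi> \<in> C01"
        using \<phi>_C01 by (intro c.S_closed)
      show "Ce * norm (K ?\<phi> - ?\<mu> *\<^sub>C ?\<phi>) \<le> Ce * (K2 / b * ?h ^ (2 * r + 2))"
        using Ce(1) by (intro mult_left_mono \<phi>_res) auto
    qed
    ultimately have "norm (ev - ?\<mu>) * (1 / 2) \<le> Ce * (K2 / b * ?h ^ (2 * r + 2))"
      using mult_left_mono[OF half norm_ge_zero[of "ev - ?\<mu>"]] by linarith
    then have 3: "norm (ev - ?\<mu>) \<le> 2 * Ce * (K2 / b) * ?h ^ (2 * r + 2)"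
      unfolding mult.assoc by linarith
    show ?case using 1 2 3 by blast
  qed
  then show ?thesis
    unfolding eventually_conj_iff by (elim conjE) (intro conjI; rule bigo_const_powerI; assumption)
qed

end
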